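(* Let $(V,H,V')$ be a normal triple of Hilbert spaces, $T>0$, and let $\mathbf A:V\to V'$ be a bounded linear operator such that $$\langle\mathbf Av,v\rangle+\kappa\|v\|_V^2\le C_A\|v\|_H^2\quad\text{for every }v\in V,$$ with $\kappa>0$ and $C_A\in\mathbb R$ independent of $v$. Assume that each $\mathbf M_k$, $k\ge1$, is a bounded linear operator on $H$ with $\|\mathbf M_k\|_{H\to H}\le c_k$ and $$C_M:=\sum_{k\ge1}c_k^2<\infty.$$ If $f\in\mathcal V'=L_2((0,T);V')$ and $u_0\in H$ are non-random, then there exists a unique solution $u$ of $$\dot u(t)=\mathbf A u(t)+f(t)+\sum_{k\ge1}(\mathbf M_k u(t))\diamond\xi_k,\quad 0<t\le T,\qquad u|_{t=0}=u_0,$$ so that $u(t)\in L_2(\mathbb F;H)$ for every $t\in[0,T]$ and $$\mathbb E\|u(t)\|_H^2\le C(C_A,C_M,\kappa,t)\Big(\int_0^t\|f(s)\|_{V'}^2ds+\|u_0\|_H^2\Big),$$ where the number $C(C_A,C_M,\kappa,t)$ does not depend on $f$ and $u_0$.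
   Context: Wiener chaos. $\mathbb F=(\Omega,\mathcal F,\mathbb P)$ is a complete probability space, $\mathcal U$ a real separable Hilbert space with orthonormal basis $\{\mathfrak u_k\}_{k\ge1}$, $\dot W=\{\dot W(h),h\in\mathcal U\}$ a zero-mean Gaussian family with $\mathbb E(\dot W(h_1)\dot W(h_2))=(h_1,h_2)_{\mathcal U}$, and $\mathcal F$ is generated by $\dot W$. Put $\xi_k=\dot W(\mathfrak u_k)$. $\mathcal J$ is the set of multi-indices $\alpha=(\alpha_1,\alpha_2,\dots)$ of non-negative integers with $|\alpha|=\sum_k\alpha_k<\infty$; $(0)$ is the zero multi-index; $\varepsilon_k$ has $1$ in position $k$ and $0$ elsewhere. $\xi_\alpha=\prod_k H_{\alpha_k}(\xi_k)/\sqrt{\alpha_k!}$, $H_n(x)=(-1)^ne^{x^2/2}\frac{d^n}{dx^n}e^{-x^2/2}$; these form an orthonormal basis of $L_2(\mathbb F)$. For positive bounded weights $\{r_\alpha\}$, $\mathcal R L_2(\mathbb F;X)$ is the space of formal series $\sum_{\alpha}v_\alpha\xi_\alpha$, $v_\alpha\in X$, with $\sum_\alpha r_\alpha^2\|v_\alpha\|_X^2<\infty$; $L_2(\mathbb F;X)$ corresponds to $r_\alpha=1$, with $\mathbb E\|v\|_X^2=\sum_\alpha\|v_\alpha\|_X^2$. Normal triple: dense continuous embeddings $V\hookrightarrow H\hookrightarrow V'$, $V'$ is the dual of $V$ relative to the inner product of $H$ (duality $\langle\cdot,\cdot\rangle$), and $|(h,v)_H|\le C\|v\|_V\|h\|_{V'}$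 for $v\in V,h\in H$. $\mathcal V=L_2((0,T);V)$. Solution: $u=\sum_\alpha u_\alpha\xi_\alpha\in\mathcal RL_2(\mathbb F;\mathcal V)$ for some system of weights, with each $u_\alpha\in\mathbf C([0,T];H)$, such that in $V'$, for all $t\in[0,T]$ and $\alpha\in\mathcal J$, $$u_\alpha(t)=u_0I_{(\alpha=(0))}+\int_0^t\Big(\mathbf Au_\alpha(s)+f(s)I_{(\alpha=(0))}+\sum_{k\ge1}\sqrt{\alpha_k}\,\mathbf M_ku_{\alpha-\varepsilon_k}(s)\Big)ds$$ (terms with $\alpha_k=0$ are zero); $u(t)=\sum_\alpha u_\alpha(t)\xi_\alpha$. *)

theory Defs
  imports "HOL-Probability.Probability" "HOL-Library.Poly_Mapping"
begin

text \<open>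
  Sequences that the literature indexes by \<open>k \<ge> 1\<close> are indexed by \<open>k :: nat\<close> starting at 0.
  A multi-index of finite length is a finitely supported map; its unit multi-indices are
  \<open>Poly_Mapping.single k 1\<close> and the zero multi-index is \<open>0\<close>.
\<close>

type_synonym multi_index = "nat \<Rightarrow>\<^sub>0 nat"


subsection \<open>Square integrable functions with values in a Hilbert space\<close>

text \<open>
  None of the Hilbert spaces below is assumed to be separable, so measurability is strong
  (Bochner) measurability. The library's Bochner integral is not available for such value types.
\<close>

definition strongly_measurable :: "'a measure \<Rightarrow> ('a \<Rightarrow> 'x::real_normed_vector) \<Rightarrow> bool" where
  "strongly_measurable M g \<longleftrightarrow>
     (\<exists>s :: nat \<Rightarrow> 'a \<Rightarrow> 'x. (\<forall>n. simple_function M (s n)) \<and>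
        (AE x in M. (\<lambda>n. s n x) \<longlonglongrightarrow> g x))"

definition in_L2 :: "'a measure \<Rightarrow> ('a \<Rightarrow> 'x::real_normed_vector) \<Rightarrow> bool" where
  "in_L2 M g \<longleftrightarrow> strongly_measurable M g \<and> integrable M (\<lambda>x. (norm (g x))\<^sup>2)"

definition L2_norm :: "'a measure \<Rightarrow> ('a \<Rightarrow> 'x::real_normed_vector) \<Rightarrow> real" where
  "L2_norm M g = sqrt (\<integral>x. (norm (g x))\<^sup>2 \<partial>M)"


subsection \<open>Gaussian noise and the Wiener chaos\<close>

text \<open>The case \<open>\<sigma> = 0\<close> is the degenerate Gaussian distribution.\<close>

definition centered_gaussian :: "'a measure \<Rightarrow> ('a \<Rightarrow> real) \<Rightarrow> bool" where
  "centered_gaussian M X \<longleftrightarrow> X \<in> borel_measurable M \<and>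
     ((AE x in M. X x = 0) \<or>
      (\<exists>\<sigma>>0. distributed M lborel X (\<lambda>x. ennreal (normal_density 0 \<sigma> x))))"

definition centered_gaussian_family :: "'a measure \<Rightarrow> ('i \<Rightarrow> 'a \<Rightarrow> real) \<Rightarrow> bool" where
  "centered_gaussian_family M W \<longleftrightarrow>
     (\<forall>I a. finite I \<longrightarrow> centered_gaussian M (\<lambda>x. \<Sum>i\<in>I. a i * W i x))"

definition orthonormal_basis :: "(nat \<Rightarrow> 'u::real_inner) \<Rightarrow> bool" where
  "orthonormal_basis e \<longleftrightarrow>
     (\<forall>j k. e j \<bullet> e k = (if j = k then 1 else 0)) \<and> closure (span (range e)) = UNIV"

text \<open>
  As the probability space is complete, ``generated by \<open>W\<close>'' is understood up to null sets.
\<close>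

locale gaussian_noise = prob_space M + complete_measure M
  for M :: "'a measure" +
  fixes e :: "nat \<Rightarrow> 'u::{real_inner, complete_space}"
    and W :: "'u \<Rightarrow> 'a \<Rightarrow> real"
  assumes basis: "orthonormal_basis e"
    and gaussian: "centered_gaussian_family M W"
    and covariance: "expectation (\<lambda>\<omega>. W g \<omega> * W h \<omega>) = g \<bullet> h"
    and generated: "sets M = sigma_sets (space M)
      ({W h -` B \<inter> space M | h B. B \<in> sets borel} \<union> null_sets M)"

definition hermite :: "nat \<Rightarrow> real \<Rightarrow> real" where
  "hermite n x = (-1) ^ n * exp (x\<^sup>2 / 2) * (deriv ^^ n) (\<lambda>y. exp (- y\<^sup>2 / 2)) x"

text \<open>
  The product may be restricted to the support of the multi-index since \<open>hermite 0 = (\<lambda>_. 1)\<close>.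
\<close>

definition chaos_basis ::
    "(nat \<Rightarrow> 'u) \<Rightarrow> ('u \<Rightarrow> 'a \<Rightarrow> real) \<Rightarrow> multi_index \<Rightarrow> 'a \<Rightarrow> real" where
  "chaos_basis e W \<alpha> \<omega> =
     (\<Prod>k\<in>Poly_Mapping.keys \<alpha>.
        hermite (Poly_Mapping.lookup \<alpha> k) (W (e k) \<omega>) / sqrt (fact (Poly_Mapping.lookup \<alpha> k)))"

text \<open>
  A formal series \<open>\<Sum>\<^sub>\<alpha> v\<^sub>\<alpha> \<xi>\<^sub>\<alpha>\<close> is represented by its coefficients; membership in the weighted
  chaos space depends on the norms \<open>N \<alpha>\<close> of the coefficients only.
\<close>

definition chaos_weights :: "(multi_index \<Rightarrow> real) \<Rightarrow> bool" where
  "chaos_weights r \<longleftrightarrow> (\<forall>\<alpha>. 0 < r \<alpha>) \<and> (\<exists>K. \<forall>\<alpha>. r \<alpha> \<le> K)"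

definition in_weighted_chaos :: "(multi_index \<Rightarrow> real) \<Rightarrow> (multi_index \<Rightarrow> real) \<Rightarrow> bool" where
  "in_weighted_chaos r N \<longleftrightarrow> (\<lambda>\<alpha>. (r \<alpha>)\<^sup>2 * (N \<alpha>)\<^sup>2) summable_on UNIV"

text \<open>The random element \<open>U\<close> is the mean square limit of \<open>\<Sum>\<^sub>\<alpha> v\<^sub>\<alpha> \<xi>\<^sub>\<alpha>\<close>.\<close>

definition has_chaos_expansion ::
    "'a measure \<Rightarrow> (nat \<Rightarrow> 'u) \<Rightarrow> ('u \<Rightarrow> 'a \<Rightarrow> real) \<Rightarrow> ('a \<Rightarrow> 'x::real_normed_vector)
      \<Rightarrow> (multi_index \<Rightarrow> 'x) \<Rightarrow> bool" where
  "has_chaos_expansion M e W U v \<longleftrightarrow> in_L2 M U \<and>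
     ((\<lambda>F. \<integral>\<^sup>+\<omega>. ennreal ((norm (U \<omega> - (\<Sum>\<alpha>\<in>F. chaos_basis e W \<alpha> \<omega> *\<^sub>R v \<alpha>)))\<^sup>2) \<partial>M)
        \<longlongrightarrow> 0) (finite_subsets_at_top UNIV)"


subsection \<open>Normal triples\<close>

definition dense_embedding :: "('x::real_normed_vector \<Rightarrow> 'y::real_normed_vector) \<Rightarrow> bool" where
  "dense_embedding i \<longleftrightarrow> bounded_linear i \<and> inj i \<and> closure (range i) = UNIV"

text \<open>
  The type \<open>'w\<close> plays the role of \<open>V'\<close>. It is identified with the dual of \<open>'v\<close> by the pairing
  \<open>dual\<close>, which extends the inner product of \<open>'h\<close>; the norm of \<open>'w\<close> need not be equal to the
  dual norm, but is equivalent to it.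
\<close>

locale normal_triple =
  fixes i :: "'v::{real_inner, complete_space} \<Rightarrow> 'h::{real_inner, complete_space}"
    and j :: "'h \<Rightarrow> 'w::{real_inner, complete_space}"
    and dual :: "'w \<Rightarrow> 'v \<Rightarrow> real"
  assumes embedding_V_H: "dense_embedding i"
    and embedding_H_V': "dense_embedding j"
    and bounded_bilinear_dual: "bounded_bilinear dual"
    and dual_extends_inner: "dual (j h) v = h \<bullet> i v"
    and dual_represents: "bounded_linear \<phi> \<Longrightarrow> \<exists>!w. \<forall>v. dual w v = \<phi> v"
    and inner_bound: "\<exists>C. \<forall>h v. \<bar>h \<bullet> i v\<bar> \<le> C * norm v * norm (j h)"


subsection \<open>The equation\<close>

text \<open>
  The coefficients \<open>u \<alpha>\<close> are continuous with values in \<open>H\<close>; as elements of \<open>L\<^sub>2((0,T);V)\<close> they are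
  given by \<open>v \<alpha>\<close>, which is determined by \<open>u \<alpha>\<close> almost everywhere because \<open>i\<close> is injective.
  The equation is an equation in \<open>V'\<close>. Its integrand is strongly measurable with integrable norm,
  and for such functions the Henstock-Kurzweil integral is the Bochner integral.
\<close>

definition chaos_solution ::
    "('v::{real_inner, complete_space} \<Rightarrow> 'h::{real_inner, complete_space})
      \<Rightarrow> ('h \<Rightarrow> 'w::{real_inner, complete_space}) \<Rightarrow> real \<Rightarrow> ('v \<Rightarrow> 'w) \<Rightarrow> (nat \<Rightarrow> 'h \<Rightarrow> 'h)
      \<Rightarrow> (real \<Rightarrow> 'w) \<Rightarrow> 'h \<Rightarrow> (multi_index \<Rightarrow> real \<Rightarrow> 'h) \<Rightarrow> bool" where
  "chaos_solution i j T A B f u\<^sub>0 u \<longleftrightarrow>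
     (\<forall>\<alpha>. continuous_on {0..T} (u \<alpha>)) \<and>
     (\<exists>v :: multi_index \<Rightarrow> real \<Rightarrow> 'v.
        (\<forall>\<alpha>. in_L2 (lebesgue_on {0..T}) (v \<alpha>)) \<and>
        (\<forall>\<alpha>. AE s in lebesgue_on {0..T}. i (v \<alpha> s) = u \<alpha> s) \<and>
        (\<exists>r. chaos_weights r \<and> in_weighted_chaos r (\<lambda>\<alpha>. L2_norm (lebesgue_on {0..T}) (v \<alpha>))) \<and>
        (\<forall>\<alpha>. \<forall>t\<in>{0..T}.
           ((\<lambda>s. A (v \<alpha> s) + (if \<alpha> = 0 then f s else 0) +
                 (\<Sum>k\<in>Poly_Mapping.keys \<alpha>. sqrt (real (Poly_Mapping.lookup \<alpha> k)) *\<^sub>R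
                    j (B k (u (\<alpha> - Poly_Mapping.single k 1) s))))
            has_integral (j (u \<alpha> t) - (if \<alpha> = 0 then j u\<^sub>0 else 0))) {0..t}))"

end

theory Submission
  imports Defs
begin

text \<open>
  The coefficients of the solution satisfy a lower triangular system of deterministic evolution
  equations, solved by induction on \<open>\<bar>\<alpha>\<bar>\<close>. Each deterministic equation is solved by approximation:
  right-hand sides \<open>e\<^sup>\<mu>\<^sup>t t\<^sup>m w\<close>, which are dense, have explicit solutions, initial values are
  handled by interpolated implicit Euler steps, whose residual is of the order of the step size, and
  the energy inequality lets one pass to the limit. Cauchy's inequality in
  \<open>\<Sum>\<^sub>k \<surd>\<alpha>\<^sub>k M\<^sub>k u\<^bsub>\<alpha>-\<epsilon>\<^sub>k\<^esub>\<close> costs a factor \<open>\<bar>\<alpha>\<bar> C\<^sub>M\<close>, which the successive time integrations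
  compensate, so that the level \<open>\<bar>\<alpha>\<bar> = n\<close> contributes at most a multiple of \<open>2\<^sup>-\<^sup>n\<close> once the energy
  is weighted by \<open>e\<^sup>-\<^sup>\<mu>\<^sup>t\<close> with \<open>\<mu>\<close> large. Orthonormality of the chaos basis turns the sum of the
  squared norms into a second moment.
\<close>

subsection \<open>Strongly measurable and square integrable functions\<close>

text \<open>The obstacle is that a solution in L2(0,T;V) need not have a derivative in V, so its
  energy cannot simply be differentiated. Estimates are derived for functions differentiable in V
  off finitely many times and inherited by limits; uniqueness, where no approximation is at hand,
  goes through the time integral. The energy inequality splits the right-hand side into an H-valued
  part, which is charged to the exponential weight and costs 1/\<nu>, and a V'-valued part, which is
  charged to coercivity at a cost independent of \<nu>. Only f is treated in the second way. The
  noise is H-valued, so level n + 1 costs \<open>C\<^sub>M\<close> t / \<nu> relative to level n,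
  and \<nu> = 2 \<open>C\<^sub>M\<close> t + 1 brings this ratio down to 1/2 at most. The explicit
  solutions have exponent |\<open>C\<^sub>A\<close>| because |\<open>C\<^sub>A\<close>| - A is
  coercive, hence invertible from V onto V'. None of V, H, V' is assumed separable, so measurability
  is always handled through simple functions, and vector integrals are often reduced to real ones by
  inner products.\<close>

lemma (in complete_measure) borel_measurable_AE_eq:
  fixes f g :: "'a \<Rightarrow> 'b::topological_space"
  assumes f: "f \<in> borel_measurable M" and eq: "AE x in M. f x = g x"
  shows "g \<in> borel_measurable M"
proof (rule measurableI)
  fix B :: "'b set" assume "B \<in> sets borel"
  then have A: "f -` B \<inter> space M \<in> sets M"
    by (rule measurable_sets[OF f])
  have "AE x in M. x \<in> f -` B \<inter> space M \<longleftrightarrow> x \<in> g -` B \<inter> space M"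
    using eq by eventually_elim auto
  then show "g -` B \<inter> space M \<in> sets M"
    by (rule in_sets_AE[OF _ A Int_lower2])
qed simp

lemma (in complete_measure) borel_measurable_AE_limit:
  fixes u :: "nat \<Rightarrow> 'a \<Rightarrow> 'b::{banach, second_countable_topology}"
  assumes u: "\<And>n. u n \<in> borel_measurable M" and lim: "AE x in M. (\<lambda>n. u n x) \<longlonglongrightarrow> g x"
  shows "g \<in> borel_measurable M"
proof (rule borel_measurable_AE_eq)
  show "(\<lambda>x. lim (\<lambda>n. u n x)) \<in> borel_measurable M"
    using u by (rule borel_measurable_lim_metric)
  show "AE x in M. lim (\<lambda>n. u n x) = g x"
    using lim by eventually_elim (rule limI)
qed

lemma strongly_measurable_simple:
  "simple_function M s \<Longrightarrow> strongly_measurable M s"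
  unfolding strongly_measurable_def by (intro exI[of _ "\<lambda>_. s"]) simp

lemma strongly_measurable_real:
  fixes f :: "'a \<Rightarrow> real"
  assumes "f \<in> borel_measurable M"
  shows "strongly_measurable M f"
proof -
  obtain s where s: "\<And>n. simple_function M (s n)" "\<And>x. x \<in> space M \<Longrightarrow> (\<lambda>n. s n x) \<longlonglongrightarrow> f x"
    using borel_measurable_implies_sequence_metric[OF assms, of 0] by blast
  have "AE x in M. (\<lambda>n. s n x) \<longlonglongrightarrow> f x"
    using s(2) by (rule AE_I2)
  with s(1) show ?thesis unfolding strongly_measurable_def by blast
qed

text \<open>Without separability the pair of two Borel maps need not be Borel measurable into the
  product, so closure properties are read off the approximants: a pointwise combination of two
  simple functions is simple, and joint continuity carries the limit.\<close>

lemma strongly_measurable_compose2: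
  assumes f: "strongly_measurable M f" and g: "strongly_measurable M g"
    and c: "\<And>p. isCont (\<lambda>(x, y). c x y) p"
  shows "strongly_measurable M (\<lambda>x. c (f x) (g x))"
proof -
  obtain s where s: "\<And>n. simple_function M (s n)" "AE x in M. (\<lambda>n. s n x) \<longlonglongrightarrow> f x"
    using f unfolding strongly_measurable_def by blast
  obtain r where r: "\<And>n. simple_function M (r n)" "AE x in M. (\<lambda>n. r n x) \<longlonglongrightarrow> g x"
    using g unfolding strongly_measurable_def by blast
  have "AE x in M. (\<lambda>n. c (s n x) (r n x)) \<longlonglongrightarrow> c (f x) (g x)"
    using s(2) r(2)
  proof eventually_elim
    case (elim x)
    have "(\<lambda>n. (s n x, r n x)) \<longlonglongrightarrow> (f x, g x)"
      using elim by (rule tendsto_Pair)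
    from isCont_tendsto_compose[OF c this] show ?case by simp
  qed
  moreover have "\<And>n. simple_function M (\<lambda>x. c (s n x) (r n x))"
    using s(1) r(1) by (rule simple_function_compose2)
  ultimately show ?thesis
    unfolding strongly_measurable_def by (intro exI[of _ "\<lambda>n x. c (s n x) (r n x)"]) blast
qed

lemma strongly_measurable_add:
  "strongly_measurable M f \<Longrightarrow> strongly_measurable M g \<Longrightarrow> strongly_measurable M (\<lambda>x. f x + g x)"
  by (rule strongly_measurable_compose2[where c="(+)"]) (simp_all add: case_prod_unfold continuous_intros)

lemma strongly_measurable_diff:
  "strongly_measurable M f \<Longrightarrow> strongly_measurable M g \<Longrightarrow> strongly_measurable M (\<lambda>x. f x - g x)"
  by (rule strongly_measurable_compose2[where c="(-)"]) (simp_all add: case_prod_unfold continuous_intros)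

lemma strongly_measurable_const: "strongly_measurable M (\<lambda>_. c)"
  by (intro strongly_measurable_simple simple_function_const)

lemma strongly_measurable_scaleR:
  fixes \<phi> :: "'a \<Rightarrow> real"
  assumes "\<phi> \<in> borel_measurable M" and "strongly_measurable M g"
  shows "strongly_measurable M (\<lambda>x. \<phi> x *\<^sub>R g x)"
  by (rule strongly_measurable_compose2[OF strongly_measurable_real[OF assms(1)] assms(2)])
    (simp add: case_prod_unfold continuous_intros)

lemma strongly_measurable_bounded_linear:
  assumes "bounded_linear L" and "strongly_measurable M g"
  shows "strongly_measurable M (\<lambda>x. L (g x))"
  by (rule strongly_measurable_compose2[OF assms(2,2), of "\<lambda>a b. L a"])
    (simp add: case_prod_unfold bounded_linear.isCont[OF assms(1)] continuous_intros)

lemma (in complete_measure) strongly_measurable_norm: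
  assumes "strongly_measurable M g"
  shows "(\<lambda>x. norm (g x)) \<in> borel_measurable M"
proof -
  obtain s where s: "\<And>n. simple_function M (s n)" "AE x in M. (\<lambda>n. s n x) \<longlonglongrightarrow> g x"
    using assms unfolding strongly_measurable_def by blast
  show ?thesis
  proof (rule borel_measurable_AE_limit)
    show "(\<lambda>x. norm (s n x)) \<in> borel_measurable M" for n
      using simple_function_compose1[OF s(1)] by (rule borel_measurable_simple_function)
    show "AE x in M. (\<lambda>n. norm (s n x)) \<longlonglongrightarrow> norm (g x)"
      using s(2) by eventually_elim (rule tendsto_norm)
  qed
qed

lemma power2_norm_add_le:
  fixes a b :: "'b::real_normed_vector"
  shows "(norm (a + b))\<^sup>2 \<le> 2 * (norm a)\<^sup>2 + 2 * (norm b)\<^sup>2"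
proof -
  have "(norm (a + b))\<^sup>2 \<le> (norm a + norm b)\<^sup>2"
    by (intro power_mono norm_triangle_ineq) auto
  also have "\<dots> \<le> 2 * (norm a)\<^sup>2 + 2 * (norm b)\<^sup>2"
    using sum_squares_bound[of "norm a" "norm b"] by (simp add: power2_sum)
  finally show ?thesis .
qed

lemma power2_norm_diff_le:
  fixes a b :: "'b::real_normed_vector"
  shows "(norm (a - b))\<^sup>2 \<le> 2 * (norm a)\<^sup>2 + 2 * (norm b)\<^sup>2"
  using power2_norm_add_le[of a "- b"] by simp

lemma power2_norm_diff_triangle:
  fixes a b c :: "'b::real_normed_vector"
  shows "(norm (a - c))\<^sup>2 \<le> 2 * (norm (a - b))\<^sup>2 + 2 * (norm (b - c))\<^sup>2"
  using power2_norm_add_le[of "a - b" "b - c"] by simp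

lemma (in complete_measure) in_L2_bound:
  assumes g: "strongly_measurable M g" and h: "integrable M h"
    and le: "AE x in M. (norm (g x))\<^sup>2 \<le> h x"
  shows "in_L2 M g"
proof -
  have "integrable M (\<lambda>x. (norm (g x))\<^sup>2)"
    using h by (rule Bochner_Integration.integrable_bound)
      (use le strongly_measurable_norm[OF g] in \<open>auto elim!: eventually_mono\<close>)
  with g show ?thesis unfolding in_L2_def by blast
qed

lemma in_L2_integrable: "in_L2 M g \<Longrightarrow> integrable M (\<lambda>x. (norm (g x))\<^sup>2)"
  and in_L2_strongly_measurable: "in_L2 M g \<Longrightarrow> strongly_measurable M g"
  unfolding in_L2_def by auto

lemma (in complete_measure) in_L2_add:
  assumes "in_L2 M f" "in_L2 M g"
  shows "in_L2 M (\<lambda>x. f x + g x)"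
  using assms
  by (intro in_L2_bound[where h="\<lambda>x. 2 * (norm (f x))\<^sup>2 + 2 * (norm (g x))\<^sup>2"])
    (auto simp: power2_norm_add_le in_L2_integrable in_L2_strongly_measurable
      intro!: strongly_measurable_add)

lemma (in complete_measure) in_L2_diff:
  assumes "in_L2 M f" "in_L2 M g"
  shows "in_L2 M (\<lambda>x. f x - g x)"
  using assms
  by (intro in_L2_bound[where h="\<lambda>x. 2 * (norm (f x))\<^sup>2 + 2 * (norm (g x))\<^sup>2"])
    (auto simp: power2_norm_diff_le in_L2_integrable in_L2_strongly_measurable
      intro!: strongly_measurable_diff)

lemma (in complete_measure) in_L2_bounded_linear:
  assumes L: "bounded_linear L" and g: "in_L2 M g"
  shows "in_L2 M (\<lambda>x. L (g x))"
proof (rule in_L2_bound)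
  show "strongly_measurable M (\<lambda>x. L (g x))"
    using L in_L2_strongly_measurable[OF g] by (rule strongly_measurable_bounded_linear)
  show "integrable M (\<lambda>x. (onorm L)\<^sup>2 * (norm (g x))\<^sup>2)"
    using in_L2_integrable[OF g] by simp
  show "AE x in M. (norm (L (g x)))\<^sup>2 \<le> (onorm L)\<^sup>2 * (norm (g x))\<^sup>2"
    using onorm[OF L] by (intro AE_I2) (simp flip: power_mult_distrib add: power_mono)
qed

lemma (in complete_measure) in_L2_sum:
  assumes "\<And>k. k \<in> K \<Longrightarrow> in_L2 M (f k)"
  shows "in_L2 M (\<lambda>x. \<Sum>k\<in>K. f k x)"
  using assms
proof (induction K rule: infinite_finite_induct)
  case (insert k K)
  then show ?case by (simp add: in_L2_add)
qed (auto simp: in_L2_def strongly_measurable_const)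

lemma (in complete_measure) in_L2_scaled:
  fixes \<phi> :: "'a \<Rightarrow> real"
  assumes \<phi>: "\<phi> \<in> borel_measurable M" and int: "integrable M (\<lambda>x. (\<phi> x)\<^sup>2)"
  shows "in_L2 M (\<lambda>x. \<phi> x *\<^sub>R c)"
proof (rule in_L2_bound)
  show "strongly_measurable M (\<lambda>x. \<phi> x *\<^sub>R c)"
    by (intro strongly_measurable_scaleR \<phi> strongly_measurable_const)
  show "integrable M (\<lambda>x. (norm c)\<^sup>2 * (\<phi> x)\<^sup>2)" using int by simp
qed (auto simp: power_mult_distrib mult.commute)

lemma (in complete_measure) in_L2_simple_approx:
  assumes g: "in_L2 M g" and "0 < \<epsilon>"
  obtains s where "simple_function M s" "in_L2 M s" "(\<integral>x. (norm (s x - g x))\<^sup>2 \<partial>M) < \<epsilon>"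
proof -
  obtain s where s: "\<And>n. simple_function M (s n)" and lim: "AE x in M. (\<lambda>n. s n x) \<longlonglongrightarrow> g x"
    using g unfolding in_L2_def strongly_measurable_def by blast
  \<comment> \<open>The cut-off at twice the norm of g provides the majorant for dominated
    convergence. As the factor exceeds 1, the cut eventually does nothing where g x is nonzero;
    where g x = 0 it forces the value 0.\<close>
  define s' where "s' n x = (if norm (s n x) \<le> 2 * norm (g x) then s n x else 0)" for n x
  have s'_le: "norm (s' n x) \<le> 2 * norm (g x)" for n x
    unfolding s'_def by simp
  have [measurable]: "(\<lambda>x. norm (g x)) \<in> borel_measurable M" "\<And>n. (\<lambda>x. norm (s n x)) \<in> borel_measurable M"
    by (intro strongly_measurable_norm in_L2_strongly_measurable[OF g]
        strongly_measurable_norm[OF strongly_measurable_simple, OF s])+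
  have simple: "simple_function M (s' n)" for n
    unfolding s'_def[abs_def] by (intro simple_function_If s) auto
  have L2: "in_L2 M (s' n)" for n
    using in_L2_integrable[OF g]
    by (intro in_L2_bound[where h="\<lambda>x. 4 * (norm (g x))\<^sup>2"] strongly_measurable_simple simple)
      (auto intro!: AE_I2 power_mono[OF s'_le, THEN order_trans] simp: power_mult_distrib)
  have "(\<lambda>n. \<integral>x. (norm (s' n x - g x))\<^sup>2 \<partial>M) \<longlonglongrightarrow> (\<integral>x. 0 \<partial>M)"
  proof (rule integral_dominated_convergence[where w="\<lambda>x. 9 * (norm (g x))\<^sup>2"])
    have "(\<lambda>x. norm (s' n x - g x)) \<in> borel_measurable M" for n
      using L2 g by (intro strongly_measurable_norm strongly_measurable_diff in_L2_strongly_measurable)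
    then show "(\<lambda>x. (norm (s' n x - g x))\<^sup>2) \<in> borel_measurable M" for n by simp
    show "AE x in M. (\<lambda>n. (norm (s' n x - g x))\<^sup>2) \<longlonglongrightarrow> 0"
      using lim
    proof eventually_elim
      case (elim x)
      have "(\<lambda>n. s' n x) \<longlonglongrightarrow> g x"
      proof (cases "g x = 0")
        case True
        then show ?thesis using s'_le[of _ x] by simp
      next
        case False
        have "\<forall>\<^sub>F n in sequentially. norm (s n x) < 2 * norm (g x)"
          using tendsto_norm[OF elim] False by (intro order_tendstoD(2)[of _ "norm (g x)"]) auto
        then have "\<forall>\<^sub>F n in sequentially. s n x = s' n x"
          by eventually_elim (simp add: s'_def)
        then show ?thesis using elim by (rule Lim_transform_eventually[rotated])
      qed
      then have "(\<lambda>n. s' n x - g x) \<longlonglongrightarrow> 0" by (simp add: LIM_zero_iff)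
      from tendsto_power[OF tendsto_norm_zero[OF this], of 2] show ?case by simp
    qed
    show "AE x in M. norm ((norm (s' n x - g x))\<^sup>2) \<le> 9 * (norm (g x))\<^sup>2" for n
    proof (intro AE_I2)
      fix x
      have "norm (s' n x - g x) \<le> 3 * norm (g x)"
        using norm_triangle_ineq4[of "s' n x" "g x"] s'_le[of n x] by linarith
      from power_mono[OF this, of 2] show "norm ((norm (s' n x - g x))\<^sup>2) \<le> 9 * (norm (g x))\<^sup>2"
        by (simp add: power_mult_distrib)
    qed
  qed (use in_L2_integrable[OF g] in auto)
  then have "\<forall>\<^sub>F n in sequentially. (\<integral>x. (norm (s' n x - g x))\<^sup>2 \<partial>M) < \<epsilon>"
    using \<open>0 < \<epsilon>\<close> by (intro order_tendstoD(2)[of _ 0]) auto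
  then obtain n where "(\<integral>x. (norm (s' n x - g x))\<^sup>2 \<partial>M) < \<epsilon>"
    by (auto simp: eventually_sequentially)
  with simple L2 show ?thesis by (rule that)
qed

text \<open>The norms are summed with the help of \<open>a \<le> 2\<^sup>-\<^sup>n + 2\<^sup>n a\<^sup>2\<close>.\<close>

lemma AE_summable_norm_if_L2_rapid:
  assumes int: "\<And>n. integrable M (\<lambda>x. (norm (d n x))\<^sup>2)"
    and le: "\<And>n. (\<integral>x. (norm (d n x))\<^sup>2 \<partial>M) \<le> (1/4) ^ n"
  shows "AE x in M. summable (\<lambda>n. norm (d n x))"
proof -
  have [measurable]: "(\<lambda>x. (norm (d n x))\<^sup>2) \<in> borel_measurable M" for n
    using int by (rule borel_measurable_integrable)
  have int2: "integrable M (\<lambda>x. 2 ^ n * (norm (d n x))\<^sup>2)" for n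
    using int by simp
  have "(\<integral>\<^sup>+x. suminf (\<lambda>n. ennreal (2 ^ n * (norm (d n x))\<^sup>2)) \<partial>M)
      = suminf (\<lambda>n. \<integral>\<^sup>+x. ennreal (2 ^ n * (norm (d n x))\<^sup>2) \<partial>M)"
    by (rule nn_integral_suminf) simp
  also have "\<dots> \<le> suminf (\<lambda>n. ennreal ((1/2) ^ n))"
  proof (intro suminf_le)
    fix n
    have "(\<integral>\<^sup>+x. ennreal (2 ^ n * (norm (d n x))\<^sup>2) \<partial>M) = ennreal (\<integral>x. 2 ^ n * (norm (d n x))\<^sup>2 \<partial>M)"
      using int2 by (intro nn_integral_eq_integral) auto
    also have "\<dots> \<le> ennreal (2 ^ n * (1/4) ^ n)"
      using le[of n] by (intro ennreal_leI) simp
    also have "2 ^ n * (1/4) ^ n = (1/2 :: real) ^ n"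
      by (simp flip: power_mult_distrib)
    finally show "(\<integral>\<^sup>+x. ennreal (2 ^ n * (norm (d n x))\<^sup>2) \<partial>M) \<le> ennreal ((1/2) ^ n)" .
  qed auto
  also have "\<dots> = ennreal (suminf (\<lambda>n. (1/2) ^ n))"
    by (intro suminf_ennreal2) (auto intro: summable_geometric)
  also have "\<dots> < \<infinity>" by simp
  finally have "AE x in M. suminf (\<lambda>n. ennreal (2 ^ n * (norm (d n x))\<^sup>2)) \<noteq> \<infinity>"
    by (intro nn_integral_PInf_AE) (auto intro!: borel_measurable_suminf)
  then show ?thesis
  proof eventually_elim
    case (elim x)
    then have "summable (\<lambda>n. 2 ^ n * (norm (d n x))\<^sup>2)"
      by (intro summable_suminf_not_top) (auto simp: top_unique)
    then have sum: "summable (\<lambda>n. (1/2) ^ n + 2 ^ n * (norm (d n x))\<^sup>2)"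
      by (intro summable_add summable_geometric) auto
    show ?case
    proof (rule summable_comparison_test'[OF sum])
      fix n
      let ?a = "norm (d n x)"
      have "2 ^ n * ?a \<le> 1 + (2 ^ n * ?a)\<^sup>2"
        using sum_squares_bound[of 1 "2 ^ n * ?a"] by (simp, smt (verit) zero_le_power2)
      then have "2 ^ n * ?a \<le> 2 ^ n * ((1/2) ^ n + 2 ^ n * ?a\<^sup>2)"
        by (simp add: algebra_simps power2_eq_square power_one_over)
      then show "norm (norm (d n x)) \<le> (1/2) ^ n + 2 ^ n * ?a\<^sup>2"
        by simp
    qed
  qed
qed

text \<open>One sequence of simple functions has to be extracted from infinitely many. The diagonal
  choice, within (1/4)^n of f n in squared L2 norm, has summable errors almost everywhere, hence
  errors tending to 0.\<close>

lemma (in complete_measure) strongly_measurable_AE_limit: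
  assumes f: "\<And>n. in_L2 M (f n)" and lim: "AE x in M. (\<lambda>n. f n x) \<longlonglongrightarrow> g x"
  shows "strongly_measurable M g"
proof -
  have "\<exists>s. simple_function M s \<and> in_L2 M s \<and> (\<integral>x. (norm (s x - f n x))\<^sup>2 \<partial>M) < (1/4) ^ n" for n
    using in_L2_simple_approx[OF f, of "(1/4)^n" n] by auto
  then obtain s where s: "\<And>n. simple_function M (s n)" "\<And>n. in_L2 M (s n)"
    "\<And>n. (\<integral>x. (norm (s n x - f n x))\<^sup>2 \<partial>M) < (1/4) ^ n"
    by metis
  have "AE x in M. summable (\<lambda>n. norm (s n x - f n x))"
    using s(2,3) f by (intro AE_summable_norm_if_L2_rapid) (auto intro!: in_L2_integrable in_L2_diff less_imp_le)
  then have "AE x in M. (\<lambda>n. s n x) \<longlonglongrightarrow> g x"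
    using lim
  proof eventually_elim
    case (elim x)
    have "(\<lambda>n. s n x - f n x) \<longlonglongrightarrow> 0"
      using summable_LIMSEQ_zero[OF elim(1)] by (simp add: tendsto_norm_zero_iff)
    from tendsto_add[OF this elim(2)] show ?case by simp
  qed
  with s(1) show ?thesis unfolding strongly_measurable_def by blast
qed

text \<open>The sort \<open>{real_inner, complete_space}\<close> is not contained in the class \<open>banach\<close>, which is why
  some facts of the library are reproved for \<open>{real_normed_vector, complete_space}\<close>.\<close>

lemma convergent_if_summable_norm_increments:
  fixes f :: "nat \<Rightarrow> 'x::{real_normed_vector, complete_space}"
  assumes sum: "summable (\<lambda>n. norm (f (Suc n) - f n))"
  shows "convergent f"
proof -
  have "Cauchy f"
    unfolding Cauchy_altdef2
  proof (intro allI impI)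
    fix e :: real assume "0 < e"
    obtain N where N: "\<And>m n. m \<ge> N \<Longrightarrow> norm (\<Sum>k\<in>{m..<n}. norm (f (Suc k) - f k)) < e"
      using summable_Cauchy[THEN iffD1, OF sum] \<open>0 < e\<close> by blast
    have "dist (f n) (f N) < e" if "n \<ge> N" for n
    proof -
      have "norm (f n - f N) = norm (\<Sum>k\<in>{N..<n}. f (Suc k) - f k)"
        using that by (simp add: sum_Suc_diff')
      also have "\<dots> \<le> (\<Sum>k\<in>{N..<n}. norm (f (Suc k) - f k))" by (rule norm_sum)
      also have "\<dots> < e" using N[of N n] by simp
      finally show ?thesis by (simp add: dist_norm)
    qed
    then show "\<exists>N. \<forall>n\<ge>N. dist (f n) (f N) < e" by blast
  qed
  then show ?thesis by (rule Cauchy_convergent)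
qed

text \<open>The Riesz-Fischer argument: a subsequence with rapidly decreasing increments converges
  almost everywhere, and Fatou's lemma gives convergence of the whole sequence in L2. The
  subsequence is kept in the conclusion because the pointwise limit in V later has to be compared
  with a uniform limit in H.\<close>

lemma (in complete_measure) L2_complete:
  fixes g :: "nat \<Rightarrow> 'a \<Rightarrow> 'x::{real_normed_vector, complete_space}"
  assumes g: "\<And>n. in_L2 M (g n)"
    and Cauchy: "\<And>e. 0 < e \<Longrightarrow> \<exists>N. \<forall>m\<ge>N. \<forall>n\<ge>N. (\<integral>x. (norm (g m x - g n x))\<^sup>2 \<partial>M) < e"
  obtains G r where "in_L2 M G" "strict_mono (r :: nat \<Rightarrow> nat)"
    "AE x in M. (\<lambda>n. g (r n) x) \<longlonglongrightarrow> G x"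
    "(\<lambda>n. \<integral>x. (norm (g n x - G x))\<^sup>2 \<partial>M) \<longlonglongrightarrow> 0"
proof -
  have "\<forall>k. \<exists>N. \<forall>m\<ge>N. \<forall>n\<ge>N. (\<integral>x. (norm (g m x - g n x))\<^sup>2 \<partial>M) < (1/4) ^ k"
    using Cauchy by simp
  then obtain N where N: "\<And>k m n. m \<ge> N k \<Longrightarrow> n \<ge> N k \<Longrightarrow> (\<integral>x. (norm (g m x - g n x))\<^sup>2 \<partial>M) < (1/4) ^ k"
    by metis
  \<comment> \<open>Summing the thresholds makes r strictly increasing and at least N k at the same
    time.\<close>
  define r where "r k = (\<Sum>l\<le>k. Suc (N l))" for k
  have r: "strict_mono r" unfolding r_def by (simp add: strict_mono_Suc_iff)
  have rN: "r k \<ge> N k" for k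
  proof -
    have "Suc (N k) \<le> r k" unfolding r_def by (intro member_le_sum) auto
    then show ?thesis by simp
  qed
  have rN': "r (Suc k) \<ge> N k" for k
    using rN[of k] strict_mono_less_eq[OF r, of k "Suc k"] by simp
  have "AE x in M. summable (\<lambda>k. norm (g (r (Suc k)) x - g (r k) x))"
  proof (rule AE_summable_norm_if_L2_rapid)
    show "integrable M (\<lambda>x. (norm (g (r (Suc k)) x - g (r k) x))\<^sup>2)" for k
      by (rule in_L2_integrable[OF in_L2_diff[OF g g]])
    show "(\<integral>x. (norm (g (r (Suc k)) x - g (r k) x))\<^sup>2 \<partial>M) \<le> (1/4) ^ k" for k
      using N[OF rN' rN] by (rule less_imp_le)
  qed
  then have conv: "AE x in M. convergent (\<lambda>n. g (r n) x)"
    by eventually_elim (rule convergent_if_summable_norm_increments)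
  define G where "G x = lim (\<lambda>n. g (r n) x)" for x
  have lim: "AE x in M. (\<lambda>n. g (r n) x) \<longlonglongrightarrow> G x"
    using conv by eventually_elim (simp add: G_def convergent_LIMSEQ_iff)
  have G: "strongly_measurable M G"
    using g lim by (intro strongly_measurable_AE_limit[of "\<lambda>n. g (r n)"])
  have meas [measurable]: "(\<lambda>x. norm (g n x - G x)) \<in> borel_measurable M"
     "(\<lambda>x. norm (g n x - g m x)) \<in> borel_measurable M" for n m
    by (intro strongly_measurable_norm strongly_measurable_diff in_L2_strongly_measurable g G)+
  \<comment> \<open>Fatou's lemma along the subsequence with m fixed. Both the square integrability
    of G (with e = 1) and the convergence come from it.\<close>
  have key: "(\<integral>\<^sup>+x. ennreal ((norm (g m x - G x))\<^sup>2) \<partial>M) \<le> ennreal e"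
    if "0 < e" "\<And>n. n \<ge> K \<Longrightarrow> (\<integral>x. (norm (g m x - g n x))\<^sup>2 \<partial>M) < e" for m K e
  proof -
    have "(\<integral>\<^sup>+x. ennreal ((norm (g m x - G x))\<^sup>2) \<partial>M)
        = (\<integral>\<^sup>+x. liminf (\<lambda>n. ennreal ((norm (g m x - g (r n) x))\<^sup>2)) \<partial>M)"
    proof (rule nn_integral_cong_AE)
      show "AE x in M. ennreal ((norm (g m x - G x))\<^sup>2) = liminf (\<lambda>n. ennreal ((norm (g m x - g (r n) x))\<^sup>2))"
        using lim
      proof eventually_elim
        case (elim x)
        have "(\<lambda>n. ennreal ((norm (g m x - g (r n) x))\<^sup>2)) \<longlonglongrightarrow> ennreal ((norm (g m x - G x))\<^sup>2)"
          by (intro tendsto_intros elim tendsto_ennrealI)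
        from lim_imp_Liminf[OF _ this] show ?case by simp
      qed
    qed
    also have "\<dots> \<le> liminf (\<lambda>n. \<integral>\<^sup>+x. ennreal ((norm (g m x - g (r n) x))\<^sup>2) \<partial>M)"
      by (rule nn_integral_liminf) simp
    also have "\<dots> \<le> ennreal e"
    proof (rule Liminf_le)
      show "\<forall>\<^sub>F n in sequentially. (\<integral>\<^sup>+x. ennreal ((norm (g m x - g (r n) x))\<^sup>2) \<partial>M) \<le> ennreal e"
        unfolding eventually_sequentially
      proof (intro exI[of _ K] allI impI)
        fix n assume "n \<ge> K"
        then have "r n \<ge> K" using seq_suble[OF r, of n] by simp
        then have "(\<integral>x. (norm (g m x - g (r n) x))\<^sup>2 \<partial>M) < e" by (rule that(2))
        then show "(\<integral>\<^sup>+x. ennreal ((norm (g m x - g (r n) x))\<^sup>2) \<partial>M) \<le> ennreal e"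
          by (subst nn_integral_eq_integral) (auto intro!: ennreal_leI in_L2_integrable in_L2_diff g)
      qed
    qed simp
    finally show ?thesis .
  qed
  have "in_L2 M G"
  proof -
    obtain K where K: "\<And>m n. m \<ge> K \<Longrightarrow> n \<ge> K \<Longrightarrow> (\<integral>x. (norm (g m x - g n x))\<^sup>2 \<partial>M) < 1"
      using Cauchy[of 1] by auto
    have "(\<integral>\<^sup>+x. ennreal ((norm (g K x - G x))\<^sup>2) \<partial>M) < \<infinity>"
      using key[of 1 K K] K by (auto simp: less_top[symmetric] top_unique)
    then have "integrable M (\<lambda>x. (norm (g K x - G x))\<^sup>2)"
      by (intro integrableI_nonneg) auto
    then have "in_L2 M (\<lambda>x. g K x - G x)"
      using g G by (simp add: in_L2_def strongly_measurable_diff)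
    from in_L2_diff[OF g[of K] this] show ?thesis by simp
  qed
  moreover have "(\<lambda>n. \<integral>x. (norm (g n x - G x))\<^sup>2 \<partial>M) \<longlonglongrightarrow> 0"
  proof (rule LIMSEQ_I)
    fix e :: real assume e: "0 < e"
    obtain K where K: "\<And>m n. m \<ge> K \<Longrightarrow> n \<ge> K \<Longrightarrow> (\<integral>x. (norm (g m x - g n x))\<^sup>2 \<partial>M) < e/2"
      using Cauchy[of "e/2"] e by auto
    show "\<exists>K. \<forall>n\<ge>K. norm ((\<integral>x. (norm (g n x - G x))\<^sup>2 \<partial>M) - 0) < e"
    proof (intro exI[of _ K] allI impI)
      fix n assume n: "n \<ge> K"
      have "ennreal (\<integral>x. (norm (g n x - G x))\<^sup>2 \<partial>M) = (\<integral>\<^sup>+x. ennreal ((norm (g n x - G x))\<^sup>2) \<partial>M)"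
        using g \<open>in_L2 M G\<close> by (subst nn_integral_eq_integral) (auto intro!: in_L2_integrable in_L2_diff)
      also have "\<dots> \<le> ennreal (e/2)"
        using e K n by (intro key[of _ K]) auto
      finally have "(\<integral>x. (norm (g n x - G x))\<^sup>2 \<partial>M) \<le> e/2" using e by simp
      then show "norm ((\<integral>x. (norm (g n x - G x))\<^sup>2 \<partial>M) - 0) < e" using e by simp
    qed
  qed
  ultimately show ?thesis using r lim that by blast
qed

subsection \<open>Square integrable functions on an interval\<close>

lemma complete_measure_lebesgue_on:
  assumes "S \<in> sets lebesgue"
  shows "complete_measure (lebesgue_on S)"
proof
  fix A B assume "B \<subseteq> A" "A \<in> null_sets (lebesgue_on S)"
  then have "A \<subseteq> S" "A \<in> null_sets lebesgue"
    using assms by (auto simp: null_sets_restrict_space)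
  with \<open>B \<subseteq> A\<close> have "B \<in> sets lebesgue" "B \<subseteq> S"
    by (auto intro: completion.complete)
  then show "B \<in> sets (lebesgue_on S)"
    using assms by (simp add: sets_restrict_space_iff)
qed

interpretation lebesgue_on_interval: complete_measure "lebesgue_on {a..b::real}" for a b
  by (rule complete_measure_lebesgue_on) simp

lemma integrable_lebesgue_on_Icc_continuous:
  fixes g :: "real \<Rightarrow> real"
  assumes "continuous_on {a..b} g"
  shows "integrable (lebesgue_on {a..b}) g"
  using absolutely_integrable_continuous_real[OF assms]
  by (rule absolutely_integrable_imp_integrable) simp

lemma strongly_measurable_continuous:
  fixes g :: "real \<Rightarrow> 'b::real_normed_vector"
  assumes g: "continuous_on {a..b} g"
  shows "strongly_measurable (lebesgue_on {a..b}) g"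
proof -
  \<comment> \<open>Time is rounded down to a grid of mesh 1/(n+1). The maximum with a keeps the
    rounded point inside the interval, and boundedness of the interval leaves finitely many
    values.\<close>
  define q where "q n t = max a (of_int \<lfloor>real (Suc n) * t\<rfloor> / real (Suc n))" for n t
  have q_le: "of_int \<lfloor>real (Suc n) * t\<rfloor> / real (Suc n) \<le> t"
    and q_ge: "t - 1 / real (Suc n) \<le> of_int \<lfloor>real (Suc n) * t\<rfloor> / real (Suc n)" for n t
  proof -
    have "of_int \<lfloor>real (Suc n) * t\<rfloor> \<le> real (Suc n) * t" by simp
    then show "of_int \<lfloor>real (Suc n) * t\<rfloor> / real (Suc n) \<le> t"
      by (simp add: field_simps del: of_nat_Suc of_int_floor_le)
    have "real (Suc n) * t - 1 \<le> of_int \<lfloor>real (Suc n) * t\<rfloor>" by linarith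
    then show "t - 1 / real (Suc n) \<le> of_int \<lfloor>real (Suc n) * t\<rfloor> / real (Suc n)"
      unfolding diff_le_eq divide_inverse by (subst distrib_right[symmetric], subst divide_inverse[symmetric],
        subst pos_le_divide_eq) (simp_all add: algebra_simps del: of_nat_Suc)
  qed
  have simple: "simple_function (lebesgue_on {a..b}) (q n)" for n
  proof (rule simple_function_borel_measurable)
    have "q n \<in> borel_measurable borel" unfolding q_def[abs_def] by measurable
    then have "q n \<in> borel_measurable lebesgue" by (simp add: measurable_completion)
    then show "q n \<in> borel_measurable (lebesgue_on {a..b})"
      by (rule measurable_restrict_space1)
    have "q n ` space (lebesgue_on {a..b}) \<subseteq>
        (\<lambda>k::int. max a (of_int k / real (Suc n))) ` {\<lfloor>real (Suc n) * a\<rfloor>..\<lfloor>real (Suc n) * b\<rfloor>}"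
    proof
      fix y assume "y \<in> q n ` space (lebesgue_on {a..b})"
      then obtain t where t: "a \<le> t" "t \<le> b" "y = q n t" by auto
      have "\<lfloor>real (Suc n) * t\<rfloor> \<in> {\<lfloor>real (Suc n) * a\<rfloor>..\<lfloor>real (Suc n) * b\<rfloor>}"
        using t by (auto intro!: floor_mono mult_left_mono)
      then show "y \<in> (\<lambda>k::int. max a (of_int k / real (Suc n))) ` {\<lfloor>real (Suc n) * a\<rfloor>..\<lfloor>real (Suc n) * b\<rfloor>}"
        unfolding t(3) q_def by (rule imageI)
    qed
    then show "finite (q n ` space (lebesgue_on {a..b}))"
      by (rule finite_subset) simp
  qed
  have lim: "(\<lambda>n. g (q n t)) \<longlonglongrightarrow> g t" if t: "t \<in> {a..b}" for t
  proof -
    have "(\<lambda>n. q n t) \<longlonglongrightarrow> t"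
    proof (rule tendsto_sandwich)
      show "\<forall>\<^sub>F n in sequentially. t - 1 / real (Suc n) \<le> q n t"
        by (intro always_eventually allI order_trans[OF q_ge]) (simp add: q_def)
      show "\<forall>\<^sub>F n in sequentially. q n t \<le> t"
        using t by (intro always_eventually allI) (simp only: q_def max.bounded_iff q_le atLeastAtMost_iff)
      show "(\<lambda>n. t - 1 / real (Suc n)) \<longlonglongrightarrow> t"
        using tendsto_diff[OF tendsto_const[of t] LIMSEQ_inverse_real_of_nat]
        by (simp only: inverse_eq_divide diff_zero)
    qed simp
    moreover have "q n t \<in> {a..b}" for n
      using t order_trans[OF q_le[of n t], of b] unfolding q_def atLeastAtMost_iff
      by (intro conjI max.cobounded1 max.boundedI) auto
    then have "\<forall>\<^sub>F n in sequentially. q n t \<in> {a..b}" by simp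
    ultimately show ?thesis
      using continuous_on_tendsto_compose[OF g _ t] by blast
  qed
  have "AE t in lebesgue_on {a..b}. (\<lambda>n. g (q n t)) \<longlonglongrightarrow> g t"
    by (rule AE_I2) (simp add: lim)
  with simple_function_compose1[OF simple] show ?thesis
    unfolding strongly_measurable_def by (intro exI[of _ "\<lambda>n t. g (q n t)"] conjI allI)
qed

lemma in_L2_continuous:
  fixes g :: "real \<Rightarrow> 'b::real_normed_vector"
  assumes g: "continuous_on {a..b} g"
  shows "in_L2 (lebesgue_on {a..b}) g"
  unfolding in_L2_def
  by (intro conjI strongly_measurable_continuous g integrable_lebesgue_on_Icc_continuous)
    (intro continuous_intros g)

text \<open>One exponent \<mu> is shared by all summands. This suffices for density, since the
  factor can be divided out before a polynomial approximation, and it allows \<mu> to be tuned to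
  the operator A.\<close>

inductive exp_poly :: "real \<Rightarrow> (real \<Rightarrow> 'w::real_normed_vector) \<Rightarrow> bool" for \<mu> where
  monomial: "exp_poly \<mu> (\<lambda>t. (exp (\<mu> * t) * t ^ m) *\<^sub>R w)"
| add: "exp_poly \<mu> f \<Longrightarrow> exp_poly \<mu> g \<Longrightarrow> exp_poly \<mu> (\<lambda>t. f t + g t)"

lemma exp_poly_continuous: "exp_poly \<mu> f \<Longrightarrow> continuous_on S f"
  by (induction rule: exp_poly.induct) (intro continuous_intros; assumption)+

lemma exp_poly_integrable_on:
  assumes "exp_poly \<mu> f"
  shows "f integrable_on {a..b}"
  using assms
proof (induction rule: exp_poly.induct)
  case (monomial m w)
  have "(\<lambda>t. exp (\<mu> * t) * t ^ m) integrable_on {a..b}"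
    by (intro integrable_continuous_interval continuous_intros)
  from integrable_linear[OF this bounded_linear_scaleR_left, of w] show ?case by (simp add: o_def)
qed (rule integrable_add)

lemma exp_poly_sum: "(\<And>k. k \<in> K \<Longrightarrow> exp_poly \<mu> (f k)) \<Longrightarrow> exp_poly \<mu> (\<lambda>t. \<Sum>k\<in>K. f k t)"
proof (induction K rule: infinite_finite_induct)
  case (insert k K)
  then show ?case by (simp add: exp_poly.add)
qed (use exp_poly.monomial[of \<mu> _ 0] in auto)

lemma exp_poly_scaled_polynomial:
  assumes "real_polynomial_function p"
  shows "exp_poly \<mu> (\<lambda>t. (exp (\<mu> * t) * p t) *\<^sub>R w)"
proof -
  obtain a n where p: "p = (\<lambda>x. \<Sum>i\<le>n. a i * x ^ i)"
    using assms real_polynomial_function_iff_sum by auto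
  have "(\<lambda>t. (exp (\<mu> * t) * p t) *\<^sub>R w) = (\<lambda>t. \<Sum>i\<le>n. (exp (\<mu> * t) * t ^ i) *\<^sub>R (a i *\<^sub>R w))"
    by (simp add: p sum_distrib_left scaleR_left.sum mult_ac)
  then show ?thesis by (simp only:) (intro exp_poly_sum exp_poly.monomial)
qed

text \<open>A measurable indicator is an almost everywhere limit of continuous functions, which
  become dominated once clipped to [0,1]. Stone-Weierstrass is applied to the clipped function times
  e^(-\<mu> t), so that multiplying back produces the prescribed factor.\<close>

lemma indicator_approx_exp_poly:
  assumes A: "A \<in> sets lebesgue" "A \<subseteq> {a..b::real}" and "0 < \<epsilon>"
  obtains p where "real_polynomial_function p"
    "(\<integral>t. (indicator A t - exp (\<mu> * t) * p t)\<^sup>2 \<partial>lebesgue_on {a..b}) < \<epsilon>"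
proof (cases "a \<le> b")
  case False
  then show ?thesis using \<open>0 < \<epsilon>\<close> by (intro that[of "\<lambda>_. 0"]) auto
next
  case True
  let ?L = "lebesgue_on {a..b}"
  have "indicat_real A measurable_on UNIV"
    using A by (intro lebesgue_measurable_imp_measurable_on_real) auto
  then obtain N g where N: "negligible N" and g: "\<And>n::nat. continuous_on UNIV (g n)"
    and lim: "\<And>x. x \<notin> N \<Longrightarrow> (\<lambda>n. g n x) \<longlonglongrightarrow> indicat_real A x"
    unfolding measurable_on_def by auto
  define h where "h n x = max 0 (min 1 (g n x))" for n x
  have h: "continuous_on S (h n)" for n S
    unfolding h_def[abs_def] by (intro continuous_intros continuous_on_subset[OF g]) auto
  have h01: "0 \<le> h n x" "h n x \<le> 1" for n x unfolding h_def by auto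
  have ind_meas: "indicat_real A \<in> borel_measurable ?L"
    using A by (intro measurable_restrict_space1) auto
  have h_meas: "h n \<in> borel_measurable ?L" for n
    using integrable_lebesgue_on_Icc_continuous[OF h] by (rule borel_measurable_integrable)
  have "(\<lambda>n. \<integral>t. (indicator A t - h n t)\<^sup>2 \<partial>?L) \<longlonglongrightarrow> (\<integral>t. 0 \<partial>?L)"
  proof (rule integral_dominated_convergence[where w="\<lambda>_. 1"])
    have "N \<in> null_sets lebesgue" using N by (simp add: negligible_iff_null_sets)
    then have "AE x in lebesgue. x \<notin> N" by (rule AE_not_in)
    then have "AE x in lebesgue. a \<le> x \<and> x \<le> b \<longrightarrow> x \<notin> N" by eventually_elim simp
    then have "AE x in ?L. x \<notin> N" by (simp add: AE_restrict_space_iff)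
    then show "AE x in ?L. (\<lambda>n. (indicator A x - h n x)\<^sup>2) \<longlonglongrightarrow> 0"
    proof eventually_elim
      case (elim x)
      have "(\<lambda>n. h n x) \<longlonglongrightarrow> max 0 (min 1 (indicator A x))"
        unfolding h_def by (intro tendsto_intros lim elim)
      also have "max 0 (min 1 (indicator A x)) = indicat_real A x"
        by (simp add: indicator_def)
      finally have "(\<lambda>n. (indicator A x - h n x)\<^sup>2) \<longlonglongrightarrow> (indicat_real A x - indicator A x)\<^sup>2"
        by (intro tendsto_intros)
      then show ?case by simp
    qed
    show "AE x in ?L. norm ((indicator A x - h n x)\<^sup>2) \<le> 1" for n
    proof (rule AE_I2)
      fix x
      have "\<bar>indicator A x - h n x\<bar> \<le> 1" using h01[of n x] by (auto simp: indicator_def)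
      then show "norm ((indicator A x - h n x)\<^sup>2) \<le> 1" by (simp add: abs_square_le_1)
    qed
  qed (use ind_meas h_meas in auto)
  then have "\<forall>\<^sub>F n in sequentially. (\<integral>t. (indicator A t - h n t)\<^sup>2 \<partial>?L) < \<epsilon> / 4"
    using \<open>0 < \<epsilon>\<close> by (intro order_tendstoD(2)[of _ 0]) auto
  then obtain n where n: "(\<integral>t. (indicator A t - h n t)\<^sup>2 \<partial>?L) < \<epsilon> / 4"
    by (auto simp: eventually_sequentially)
  define E where "E = exp (\<bar>\<mu>\<bar> * max \<bar>a\<bar> \<bar>b\<bar>)"
  have E: "exp (\<mu> * t) \<le> E" if "t \<in> {a..b}" for t
  proof -
    have "\<mu> * t \<le> \<bar>\<mu>\<bar> * \<bar>t\<bar>" by (metis abs_ge_self abs_mult)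
    also have "\<dots> \<le> \<bar>\<mu>\<bar> * max \<bar>a\<bar> \<bar>b\<bar>" using that by (intro mult_left_mono) auto
    finally show ?thesis by (simp add: E_def)
  qed
  have "0 < E" by (simp add: E_def)
  \<comment> \<open>Multiplication by e^(\<mu> t) \<le> E turns the uniform error \<eta> into a
    squared error of at most \<epsilon> / (4 (b - a + 1)), whose integral is at most \<epsilon> / 4;
    the added 1 covers a = b.\<close>
  define \<eta> where "\<eta> = sqrt (\<epsilon> / (4 * (b - a + 1))) / E"
  have "0 < \<eta>" using \<open>0 < E\<close> \<open>0 < \<epsilon>\<close> True by (simp add: \<eta>_def)
  have cont: "continuous_on {a..b} (\<lambda>t. exp (- \<mu> * t) * h n t)"
    by (intro continuous_intros h)
  obtain p where p: "real_polynomial_function p"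
    "\<And>t. t \<in> {a..b} \<Longrightarrow> \<bar>exp (- \<mu> * t) * h n t - p t\<bar> < \<eta>"
    using Stone_Weierstrass_real_polynomial_function[OF compact_Icc cont \<open>0 < \<eta>\<close>] by blast
  have p_cont: "continuous_on {a..b} p"
    using p(1) by (simp add: continuous_on_polymonial_function real_polynomial_function_eq)
  have approx: "(h n t - exp (\<mu> * t) * p t)\<^sup>2 \<le> \<epsilon> / (4 * (b - a + 1))" if t: "t \<in> {a..b}" for t
  proof -
    have "h n t - exp (\<mu> * t) * p t = exp (\<mu> * t) * (exp (- \<mu> * t) * h n t - p t)"
      by (simp add: algebra_simps flip: exp_add mult.assoc)
    then have "\<bar>h n t - exp (\<mu> * t) * p t\<bar> = exp (\<mu> * t) * \<bar>exp (- \<mu> * t) * h n t - p t\<bar>"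
      by (simp add: abs_mult)
    also have "\<dots> \<le> E * \<eta>"
      using E[OF t] p(2)[OF t] \<open>0 < E\<close> by (intro mult_mono) auto
    also have "\<dots> = sqrt (\<epsilon> / (4 * (b - a + 1)))" using \<open>0 < E\<close> by (simp add: \<eta>_def)
    finally show ?thesis
      by (rule sqrt_ge_absD)
  qed
  have int1: "integrable ?L (\<lambda>t. (h n t - exp (\<mu> * t) * p t)\<^sup>2)"
    by (intro integrable_lebesgue_on_Icc_continuous continuous_intros h p_cont)
  have int2: "integrable ?L (\<lambda>t. (indicator A t - h n t)\<^sup>2)"
  proof (rule Bochner_Integration.integrable_bound[where f="\<lambda>_. 1::real"])
    show "AE x in ?L. norm ((indicator A x - h n x)\<^sup>2) \<le> norm (1::real)"
    proof (rule AE_I2)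
      fix x
      have "\<bar>indicator A x - h n x\<bar> \<le> 1" using h01[of n x] by (auto simp: indicator_def)
      then show "norm ((indicator A x - h n x)\<^sup>2) \<le> norm (1::real)" by (simp add: abs_square_le_1)
    qed
  qed (use ind_meas h_meas in auto)
  have "(\<integral>t. (h n t - exp (\<mu> * t) * p t)\<^sup>2 \<partial>?L) \<le> (\<integral>t. \<epsilon> / (4 * (b - a + 1)) \<partial>?L)"
    using approx by (intro integral_mono int1) auto
  also have "\<dots> = \<epsilon> / (4 * (b - a + 1)) * (b - a)"
    using True by (simp add: measure_restrict_space)
  also have "\<dots> \<le> \<epsilon> / 4"
    using True \<open>0 < \<epsilon>\<close> by (simp add: field_simps)
  finally have est: "(\<integral>t. (h n t - exp (\<mu> * t) * p t)\<^sup>2 \<partial>?L) \<le> \<epsilon> / 4" .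
  have "(\<integral>t. (indicator A t - exp (\<mu> * t) * p t)\<^sup>2 \<partial>?L)
      \<le> (\<integral>t. 2 * (indicator A t - h n t)\<^sup>2 + 2 * (h n t - exp (\<mu> * t) * p t)\<^sup>2 \<partial>?L)"
  proof (rule integral_mono')
    show "integrable ?L (\<lambda>t. 2 * (indicator A t - h n t)\<^sup>2 + 2 * (h n t - exp (\<mu> * t) * p t)\<^sup>2)"
      using int1 int2 by simp
    fix t
    show "(indicator A t - exp (\<mu> * t) * p t)\<^sup>2 \<le> 2 * (indicator A t - h n t)\<^sup>2 + 2 * (h n t - exp (\<mu> * t) * p t)\<^sup>2"
      using power2_norm_diff_triangle[of "indicator A t" "exp (\<mu> * t) * p t" "h n t"] by simp
  qed simp
  also have "\<dots> < \<epsilon>" using n est int1 int2 by simp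
  finally show ?thesis using p(1) that by blast
qed

text \<open>A simple function is a finite sum of indicators times vectors, so the scalar
  approximation is applied to each level set and the error is distributed over the finitely many
  values.\<close>

lemma in_L2_approx_exp_poly:
  fixes F :: "real \<Rightarrow> 'w::real_normed_vector"
  assumes F: "in_L2 (lebesgue_on {a..b}) F" and "0 < \<epsilon>"
  obtains G where "exp_poly \<mu> G" "(\<integral>t. (norm (F t - G t))\<^sup>2 \<partial>lebesgue_on {a..b}) < \<epsilon>"
proof -
  let ?L = "lebesgue_on {a..b}"
  obtain s where s: "simple_function ?L s" "in_L2 ?L s" "(\<integral>t. (norm (s t - F t))\<^sup>2 \<partial>?L) < \<epsilon> / 4"
    using lebesgue_on_interval.in_L2_simple_approx[OF F, of "\<epsilon>/4"] \<open>0 < \<epsilon>\<close> by auto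
  define Y where "Y = s ` {a..b}"
  define A where "A y = s -` {y} \<inter> {a..b}" for y
  have finY: "finite Y" using simple_functionD(1)[OF s(1)] by (simp add: Y_def)
  have A: "A y \<in> sets lebesgue" "A y \<subseteq> {a..b}" for y
    using simple_functionD(2)[OF s(1), of "{y}"] by (auto simp: A_def sets_restrict_space_iff)
  have rep: "s t = (\<Sum>y\<in>Y. indicator (A y) t *\<^sub>R y)" if t: "t \<in> {a..b}" for t
  proof -
    have "(\<Sum>y\<in>Y. indicator (A y) t *\<^sub>R y) = (\<Sum>y\<in>Y. if y = s t then y else 0)"
      using t by (intro sum.cong) (auto simp: A_def indicator_def)
    also have "\<dots> = s t" using finY t by (simp add: Y_def)
    finally show ?thesis by simp
  qed
  \<comment> \<open>Cauchy's inequality for the sum over Y costs a factor card Y, and there are card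
    Y summands, whence the square of card Y + 1. The added ones keep the denominators positive when
    Y is empty or y = 0.\<close>
  define \<delta> where "\<delta> y = \<epsilon> / (4 * (real (card Y) + 1) * (real (card Y) + 1) * ((norm y)\<^sup>2 + 1))" for y :: 'w
  have \<delta>: "0 < \<delta> y" for y using \<open>0 < \<epsilon>\<close> by (simp add: \<delta>_def add_nonneg_pos)
  have "\<forall>y. \<exists>p. real_polynomial_function p \<and>
     (\<integral>t. (indicator (A y) t - exp (\<mu> * t) * p t)\<^sup>2 \<partial>?L) < \<delta> y"
    using indicator_approx_exp_poly[OF A \<delta>] by metis
  then obtain p where p: "\<And>y. real_polynomial_function (p y)"
     "\<And>y. (\<integral>t. (indicator (A y) t - exp (\<mu> * t) * p y t)\<^sup>2 \<partial>?L) < \<delta> y" by metis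
  define G where "G t = (\<Sum>y\<in>Y. (exp (\<mu> * t) * p y t) *\<^sub>R y)" for t
  have G: "exp_poly \<mu> G"
    unfolding G_def[abs_def] by (intro exp_poly_sum exp_poly_scaled_polynomial p)
  have G_L2: "in_L2 ?L G" by (intro in_L2_continuous exp_poly_continuous[OF G])
  define d where "d y t = indicator (A y) t - exp (\<mu> * t) * p y t" for y t
  have d_int: "integrable ?L (\<lambda>t. (d y t)\<^sup>2)" for y
  proof -
    have "in_L2 ?L (\<lambda>t. exp (\<mu> * t) * p y t)"
      using p(1)[of y]
      by (intro in_L2_continuous continuous_intros)
        (simp add: continuous_on_polymonial_function real_polynomial_function_eq)
    moreover have "in_L2 ?L (indicat_real (A y))"
      by (rule lebesgue_on_interval.in_L2_bound[where h="\<lambda>_. 1"])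
        (use A in \<open>auto intro!: strongly_measurable_real measurable_restrict_space1 simp: indicator_def\<close>)
    ultimately have "in_L2 ?L (d y)"
      unfolding d_def[abs_def] by (rule lebesgue_on_interval.in_L2_diff[rotated])
    then show ?thesis by (auto dest: in_L2_integrable)
  qed
  have "(\<integral>t. (norm (s t - G t))\<^sup>2 \<partial>?L) \<le> (\<integral>t. real (card Y) * (\<Sum>y\<in>Y. (norm y)\<^sup>2 * (d y t)\<^sup>2) \<partial>?L)"
  proof (rule integral_mono)
    show "integrable ?L (\<lambda>t. (norm (s t - G t))\<^sup>2)"
      by (intro in_L2_integrable lebesgue_on_interval.in_L2_diff s G_L2)
    show "integrable ?L (\<lambda>t. real (card Y) * (\<Sum>y\<in>Y. (norm y)\<^sup>2 * (d y t)\<^sup>2))"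
      using d_int by simp
    fix t assume "t \<in> space ?L"
    then have "s t - G t = (\<Sum>y\<in>Y. d y t *\<^sub>R y)"
      by (simp add: rep G_def d_def scaleR_left_diff_distrib sum_subtractf)
    then have "norm (s t - G t) \<le> (\<Sum>y\<in>Y. \<bar>d y t\<bar> * norm y)"
      using norm_sum[of "\<lambda>y. d y t *\<^sub>R y" Y] by simp
    then have "(norm (s t - G t))\<^sup>2 \<le> (\<Sum>y\<in>Y. \<bar>d y t\<bar> * norm y)\<^sup>2"
      by (intro power_mono) auto
    also have "\<dots> \<le> real (card Y) * (\<Sum>y\<in>Y. (\<bar>d y t\<bar> * norm y)\<^sup>2)"
      using Cauchy_Schwarz_ineq_sum[of "\<lambda>_. 1" "\<lambda>y. \<bar>d y t\<bar> * norm y" Y] by simp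
    finally show "(norm (s t - G t))\<^sup>2 \<le> real (card Y) * (\<Sum>y\<in>Y. (norm y)\<^sup>2 * (d y t)\<^sup>2)"
      by (simp add: power_mult_distrib mult.commute)
  qed
  also have "\<dots> = real (card Y) * (\<Sum>y\<in>Y. (norm y)\<^sup>2 * (\<integral>t. (d y t)\<^sup>2 \<partial>?L))"
    using d_int by simp
  also have "\<dots> \<le> real (card Y) * (\<Sum>y\<in>Y. \<epsilon> / (4 * (real (card Y) + 1) * (real (card Y) + 1)))"
  proof (intro mult_left_mono sum_mono)
    fix y
    have "(norm y)\<^sup>2 * (\<integral>t. (d y t)\<^sup>2 \<partial>?L) \<le> ((norm y)\<^sup>2 + 1) * \<delta> y"
      using p(2)[of y] by (intro mult_mono) (auto simp: d_def)
    also have "\<dots> = \<epsilon> / (4 * (real (card Y) + 1) * (real (card Y) + 1))"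
      unfolding \<delta>_def by (simp add: add_nonneg_eq_0_iff)
    finally show "(norm y)\<^sup>2 * (\<integral>t. (d y t)\<^sup>2 \<partial>?L) \<le> \<epsilon> / (4 * (real (card Y) + 1) * (real (card Y) + 1))" .
  qed simp
  also have "\<dots> = \<epsilon> / 4 * ((real (card Y) / (real (card Y) + 1)) * (real (card Y) / (real (card Y) + 1)))"
    by (simp only: sum_constant times_divide_eq_left times_divide_eq_right divide_divide_eq_left mult_ac)
  also have "\<dots> \<le> \<epsilon> / 4"
    using \<open>0 < \<epsilon>\<close> by (intro mult_left_le mult_le_one) auto
  finally have est: "(\<integral>t. (norm (s t - G t))\<^sup>2 \<partial>?L) \<le> \<epsilon> / 4" .
  have i1: "integrable ?L (\<lambda>t. (norm (s t - F t))\<^sup>2)" and i2: "integrable ?L (\<lambda>t. (norm (s t - G t))\<^sup>2)"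
    by (intro in_L2_integrable lebesgue_on_interval.in_L2_diff s G_L2 F)+
  have "(\<integral>t. (norm (F t - G t))\<^sup>2 \<partial>?L) \<le> (\<integral>t. 2 * (norm (s t - F t))\<^sup>2 + 2 * (norm (s t - G t))\<^sup>2 \<partial>?L)"
    using i1 i2
    by (intro integral_mono in_L2_integrable lebesgue_on_interval.in_L2_diff G_L2 F)
      (auto simp: norm_minus_commute[of "s _" "F _"] power2_norm_diff_triangle)
  also have "\<dots> < \<epsilon>" using s(3) est i1 i2 by simp
  finally show ?thesis using G that by blast
qed

section \<open>Gauge integrals of square integrable functions\<close>

lemma norm_diff_triangle4:
  fixes a b c d :: "'b::real_normed_vector"
  shows "norm (a - d) \<le> norm (a - b) + norm (b - c) + norm (d - c)"
  using norm_triangle_ineq[of "a - b" "b - c"] norm_triangle_ineq4[of "a - c" "d - c"] by simp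

text \<open>Over a fine tagged division the Riemann sums of f and g differ by at most the Riemann
  sum of \<phi>, which is close to a small integral. Cauchy's criterion therefore passes from g to
  f, and completeness makes the criterion sufficient.\<close>

lemma integrable_on_Icc_approx:
  fixes f :: "real \<Rightarrow> 'b::{real_normed_vector, complete_space}"
  assumes approx: "\<And>e. 0 < e \<Longrightarrow> \<exists>g \<phi>. g integrable_on {a..b} \<and> \<phi> integrable_on {a..b} \<and>
     (\<forall>x\<in>{a..b}. norm (f x - g x) \<le> \<phi> x) \<and> integral {a..b} \<phi> < (e::real)"
  shows "f integrable_on {a..b}"
proof -
  let ?S = "\<lambda>f \<D>. \<Sum>(x,K)\<in>\<D>. measure lborel K *\<^sub>R f x"
  have "f integrable_on cbox a b"
    unfolding integrable_Cauchy
  proof (intro allI impI)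
    fix e :: real assume e: "0 < e"
    have e3: "0 < e/3" and e6: "0 < e/6" using e by simp_all
    obtain g \<phi> where g: "g integrable_on cbox a b" and \<phi>: "\<phi> integrable_on cbox a b"
      and le: "\<forall>x\<in>cbox a b. norm (f x - g x) \<le> \<phi> x" and small: "integral (cbox a b) \<phi> < e/6"
      using approx[OF e6] unfolding box_real by blast
    obtain \<gamma>1 where \<gamma>1: "gauge \<gamma>1"
      "\<forall>D1 D2. D1 tagged_division_of cbox a b \<and> \<gamma>1 fine D1 \<and> D2 tagged_division_of cbox a b \<and> \<gamma>1 fine D2
        \<longrightarrow> norm (?S g D1 - ?S g D2) < e/3"
      using mp[OF spec[OF g[unfolded integrable_Cauchy]] e3] by (elim exE conjE) (rule that)
    obtain \<gamma>2 where \<gamma>2: "gauge \<gamma>2"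
      "\<forall>D. D tagged_division_of cbox a b \<and> \<gamma>2 fine D \<longrightarrow> norm (?S \<phi> D - integral (cbox a b) \<phi>) < e/6"
      using mp[OF spec[OF integrable_integral[OF \<phi>, unfolded has_integral]] e6]
      by (elim exE conjE) (rule that)
    have close: "norm (?S f D - ?S g D) < e/3" if D: "D tagged_division_of cbox a b" "\<gamma>2 fine D" for D
    proof -
      have "?S f D - ?S g D = ?S (\<lambda>x. f x - g x) D"
        by (simp add: sum_subtractf[symmetric] case_prod_unfold scaleR_diff_right)
      also have "norm \<dots> \<le> ?S \<phi> D"
      proof (rule sum_norm_le, safe)
        fix x K assume xK: "(x, K) \<in> D"
        then have "x \<in> cbox a b" using tagged_division_ofD(2,3)[OF D(1)] by blast
        then show "norm (measure lborel K *\<^sub>R (f x - g x)) \<le> measure lborel K *\<^sub>R \<phi> x"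
          using bspec[OF le, of x] by (simp add: mult_left_mono)
      qed
      also have "\<dots> < e/3"
        using mp[OF spec[OF \<gamma>2(2)] conjI[OF D]] small unfolding real_norm_def abs_less_iff real_scaleR_def by linarith
      finally show ?thesis .
    qed
    show "\<exists>\<gamma>. gauge \<gamma> \<and> (\<forall>D1 D2. D1 tagged_division_of cbox a b \<and> \<gamma> fine D1 \<and>
       D2 tagged_division_of cbox a b \<and> \<gamma> fine D2 \<longrightarrow> norm (?S f D1 - ?S f D2) < e)"
    proof (intro exI[of _ "\<lambda>x. \<gamma>1 x \<inter> \<gamma>2 x"] conjI allI impI)
      show "gauge (\<lambda>x. \<gamma>1 x \<inter> \<gamma>2 x)" using \<gamma>1(1) \<gamma>2(1) by (rule gauge_Int)
      fix D1 D2
      assume A: "D1 tagged_division_of cbox a b \<and> (\<lambda>x. \<gamma>1 x \<inter> \<gamma>2 x) fine D1 \<and>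
        D2 tagged_division_of cbox a b \<and> (\<lambda>x. \<gamma>1 x \<inter> \<gamma>2 x) fine D2"
      have D: "D1 tagged_division_of cbox a b" "\<gamma>1 fine D1" "\<gamma>2 fine D1"
        "D2 tagged_division_of cbox a b" "\<gamma>1 fine D2" "\<gamma>2 fine D2"
        using A unfolding fine_def by blast+
      have "norm (?S f D1 - ?S f D2)
          \<le> norm (?S f D1 - ?S g D1) + norm (?S g D1 - ?S g D2) + norm (?S f D2 - ?S g D2)"
        by (rule norm_diff_triangle4)
      also have "\<dots> < e"
        using close[OF D(1,3)] close[OF D(4,6)] mp[OF spec[OF spec[OF \<gamma>1(2)]], OF conjI[OF D(1) conjI[OF D(2) conjI[OF D(4,5)]]]] by linarith
      finally show "norm (?S f D1 - ?S f D2) < e" .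
    qed
  qed
  then show ?thesis by simp
qed

text \<open>Takes the place of Cauchy-Schwarz in passing from L2 to L1: on a bounded interval the
  integral of a norm is at most d (b - a) plus 1/d times the squared L2 norm, and d is free.\<close>

lemma le_add_power2_div:
  fixes x d :: real
  assumes "0 < d"
  shows "x \<le> d + x\<^sup>2 / d"
proof -
  have "d * x \<le> d\<^sup>2 + x\<^sup>2"
  proof -
    have "0 \<le> (d - x / 2)\<^sup>2" by simp
    also have "\<dots> = d\<^sup>2 - d * x + x\<^sup>2 / 4" by (simp add: power2_eq_square algebra_simps)
    finally show ?thesis using zero_le_power2[of x] by linarith
  qed
  then show ?thesis using assms by (simp add: field_simps power2_eq_square)
qed

lemma L2_dominating_integral:
  fixes g :: "real \<Rightarrow> 'b::real_normed_vector"
  assumes g: "in_L2 (lebesgue_on {a..b}) g" and "0 < d" "a \<le> b"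
  shows "(\<lambda>x. d + (norm (g x))\<^sup>2 / d) integrable_on {a..b}"
    "integral {a..b} (\<lambda>x. d + (norm (g x))\<^sup>2 / d)
      = d * (b - a) + (\<integral>x. (norm (g x))\<^sup>2 \<partial>lebesgue_on {a..b}) / d"
proof -
  have "((\<lambda>x. (norm (g x))\<^sup>2) has_integral (\<integral>x. (norm (g x))\<^sup>2 \<partial>lebesgue_on {a..b})) {a..b}"
    by (intro has_integral_integral_lebesgue_on in_L2_integrable g) simp
  then have "((\<lambda>x. d + (norm (g x))\<^sup>2 / d) has_integral
      (d * (b - a) + (\<integral>x. (norm (g x))\<^sup>2 \<partial>lebesgue_on {a..b}) / d)) {a..b}"
    using has_integral_const_real[of d a b] \<open>a \<le> b\<close>
    by (intro has_integral_add has_integral_divide) (auto simp: mult.commute)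
  then show "(\<lambda>x. d + (norm (g x))\<^sup>2 / d) integrable_on {a..b}"
    "integral {a..b} (\<lambda>x. d + (norm (g x))\<^sup>2 / d)
      = d * (b - a) + (\<integral>x. (norm (g x))\<^sup>2 \<partial>lebesgue_on {a..b}) / d"
    by (auto simp: has_integral_iff)
qed

text \<open>Vector-valued polynomials (exponent 0) are integrable and dense in L2, and the pointwise
  error has an integrable majorant of small integral.\<close>

lemma in_L2_integrable_on:
  fixes g :: "real \<Rightarrow> 'b::{real_normed_vector, complete_space}"
  assumes g: "in_L2 (lebesgue_on {a..b}) g" and t: "t \<in> {a..b}"
  shows "g integrable_on {a..t}"
proof (rule integrable_on_Icc_approx)
  fix e :: real assume e: "0 < e"
  have ab: "a \<le> b" and sub: "{a..t} \<subseteq> {a..b}" using t by auto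
  define d where "d = e / (b - a + 2)"
  have d: "0 < d" using e ab by (simp add: d_def)
  obtain G where G: "exp_poly 0 G" "(\<integral>t. (norm (g t - G t))\<^sup>2 \<partial>lebesgue_on {a..b}) < d\<^sup>2"
    using in_L2_approx_exp_poly[OF g, of "d\<^sup>2" 0] d by auto
  have L2: "in_L2 (lebesgue_on {a..b}) (\<lambda>t. g t - G t)"
    by (intro lebesgue_on_interval.in_L2_diff g in_L2_continuous exp_poly_continuous[OF G(1)])
  note I = L2_dominating_integral[OF L2 d ab]
  have I': "(\<lambda>x. d + (norm (g x - G x))\<^sup>2 / d) integrable_on {a..t}"
    using I(1) sub by (rule integrable_on_subinterval)
  have "integral {a..t} (\<lambda>x. d + (norm (g x - G x))\<^sup>2 / d) < e"
  proof -
    have "integral {a..t} (\<lambda>x. d + (norm (g x - G x))\<^sup>2 / d) \<le> integral {a..b} (\<lambda>x. d + (norm (g x - G x))\<^sup>2 / d)"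
      using d by (intro integral_subset_le I I' sub) auto
    also have "(\<integral>t. (norm (g t - G t))\<^sup>2 \<partial>lebesgue_on {a..b}) / d < d"
      using G(2) d by (simp add: field_simps power2_eq_square)
    then have "integral {a..b} (\<lambda>x. d + (norm (g x - G x))\<^sup>2 / d) < d * (b - a) + d"
      by (simp add: I(2))
    also have "\<dots> \<le> d * (b - a + 2)" using d by (simp add: algebra_simps)
    also have "\<dots> = e" using ab by (simp add: d_def)
    finally show ?thesis .
  qed
  then show "\<exists>G \<phi>. G integrable_on {a..t} \<and> \<phi> integrable_on {a..t} \<and>
     (\<forall>x\<in>{a..t}. norm (g x - G x) \<le> \<phi> x) \<and> integral {a..t} \<phi> < e"
    using I' exp_poly_integrable_on[OF G(1)] le_add_power2_div[OF d]
    by (intro exI[of _ G] exI[of _ "\<lambda>x. d + (norm (g x - G x))\<^sup>2 / d"]) auto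
qed

section \<open>Vector integrals tested by inner products\<close>

lemma inner_eqI:
  fixes a b :: "'b::real_inner"
  assumes "\<And>y. a \<bullet> y = b \<bullet> y"
  shows "a = b"
proof -
  have "(a - b) \<bullet> (a - b) = 0" by (simp add: inner_diff_left assms)
  then show ?thesis by simp
qed

text \<open>Pairing the integrand with its own integral I reduces everything to real functions: the
  squared norm of I is the integral of I \<bullet> f, hence at most norm I times the integral of
  g.\<close>

lemma norm_integral_le:
  fixes f :: "real \<Rightarrow> 'b::real_inner"
  assumes f: "f integrable_on S" and g: "g integrable_on S"
    and le: "\<And>x. x \<in> S \<Longrightarrow> norm (f x) \<le> g x"
  shows "norm (integral S f) \<le> integral S g"
proof (cases "integral S f = 0")
  case True
  then show ?thesis using le norm_ge_zero order_trans by (simp, intro integral_nonneg[OF g]) blast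
next
  case False
  let ?I = "integral S f"
  have "((\<lambda>x. ?I \<bullet> f x) has_integral (?I \<bullet> ?I)) S"
    using has_integral_linear[OF integrable_integral[OF f] bounded_linear_inner_right, of ?I]
    by (simp add: o_def)
  moreover have "((\<lambda>x. norm ?I * g x) has_integral (norm ?I * integral S g)) S"
    by (intro has_integral_mult_right integrable_integral g)
  moreover have "?I \<bullet> f x \<le> norm ?I * g x" if "x \<in> S" for x
    using norm_cauchy_schwarz[of ?I "f x"] mult_left_mono[OF le[OF that], of "norm ?I"] by simp
  ultimately have "?I \<bullet> ?I \<le> norm ?I * integral S g" by (rule has_integral_le)
  then have "norm ?I * norm ?I \<le> norm ?I * integral S g"
    by (simp add: power2_norm_eq_inner[symmetric] power2_eq_square)
  then show ?thesis using False by simp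
qed

lemma norm_integral_le_L2:
  fixes g :: "real \<Rightarrow> 'b::{real_inner, complete_space}"
  assumes g: "in_L2 (lebesgue_on {a..b}) g" and d: "0 < d" and t: "t \<in> {a..b}"
  shows "norm (integral {a..t} g) \<le> d * (b - a) + (\<integral>x. (norm (g x))\<^sup>2 \<partial>lebesgue_on {a..b}) / d"
proof -
  have ab: "a \<le> b" and sub: "{a..t} \<subseteq> {a..b}" using t by auto
  note I = L2_dominating_integral[OF g d ab]
  have I': "(\<lambda>x. d + (norm (g x))\<^sup>2 / d) integrable_on {a..t}"
    using I(1) sub by (rule integrable_on_subinterval)
  have "norm (integral {a..t} g) \<le> integral {a..t} (\<lambda>x. d + (norm (g x))\<^sup>2 / d)"
    by (intro norm_integral_le in_L2_integrable_on[OF g t] I' le_add_power2_div d)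
  also have "\<dots> \<le> integral {a..b} (\<lambda>x. d + (norm (g x))\<^sup>2 / d)"
    using d by (intro integral_subset_le I I' sub) auto
  finally show ?thesis by (simp add: I(2))
qed

lemma integral_tendsto_L2:
  fixes g :: "real \<Rightarrow> 'b::{real_inner, complete_space}"
  assumes G: "\<And>n. in_L2 (lebesgue_on {a..b}) (G n)" and g: "in_L2 (lebesgue_on {a..b}) g"
    and lim: "(\<lambda>n. \<integral>x. (norm (G n x - g x))\<^sup>2 \<partial>lebesgue_on {a..b}) \<longlonglongrightarrow> 0" and t: "t \<in> {a..b}"
  shows "(\<lambda>n. integral {a..t} (G n)) \<longlonglongrightarrow> integral {a..t} g"
proof (rule LIMSEQ_I)
  fix e :: real assume e: "0 < e"
  have ab: "a \<le> b" and sub: "{a..t} \<subseteq> {a..b}" using t by auto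
  define d where "d = e / (b - a + 2)"
  have d: "0 < d" using e ab by (simp add: d_def)
  obtain N where N: "\<And>n. n \<ge> N \<Longrightarrow> (\<integral>x. (norm (G n x - g x))\<^sup>2 \<partial>lebesgue_on {a..b}) < d\<^sup>2"
    using order_tendstoD(2)[OF lim, of "d\<^sup>2"] d by (auto simp: eventually_sequentially)
  show "\<exists>N. \<forall>n\<ge>N. norm (integral {a..t} (G n) - integral {a..t} g) < e"
  proof (intro exI[of _ N] allI impI)
    fix n assume "n \<ge> N"
    have "integral {a..t} (G n) - integral {a..t} g = integral {a..t} (\<lambda>x. G n x - g x)"
      by (intro integral_diff[symmetric] in_L2_integrable_on[OF _ t] G g)
    also have "norm \<dots> \<le> d * (b - a) + (\<integral>x. (norm (G n x - g x))\<^sup>2 \<partial>lebesgue_on {a..b}) / d"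
      by (intro norm_integral_le_L2 lebesgue_on_interval.in_L2_diff G g d t)
    also have "\<dots> < d * (b - a) + d"
      using N[OF \<open>n \<ge> N\<close>] d by (simp add: field_simps power2_eq_square)
    also have "\<dots> \<le> d * (b - a + 2)" using d by (simp add: algebra_simps)
    also have "\<dots> = e" using ab by (simp add: d_def)
    finally show "norm (integral {a..t} (G n) - integral {a..t} g) < e" .
  qed
qed

text \<open>Additivity of the integral over adjacent intervals is obtained for each scalar product
  with y and transferred by \<open>inner_eqI\<close>. The rest is the usual comparison of an
  increment with its linear part, once on each side of t.\<close>

lemma integral_has_vector_derivative_inner:
  fixes f :: "real \<Rightarrow> 'b::{real_inner, complete_space}"
  assumes f: "continuous_on {a..b} f" and t: "t \<in> {a..b}"
  shows "((\<lambda>t. integral {a..t} f) has_vector_derivative f t) (at t within {a..b})"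
proof -
  have L2: "in_L2 (lebesgue_on {a..b}) f" using f by (rule in_L2_continuous)
  have sub: "f integrable_on {c..d}" if "a \<le> c" "d \<le> b" for c d
  proof (cases "c \<le> d")
    case True
    have "in_L2 (lebesgue_on {c..d}) f"
      using that by (intro in_L2_continuous continuous_on_subset[OF f]) auto
    from in_L2_integrable_on[OF this, of d] True show ?thesis by simp
  qed (simp add: integrable_on_empty)
  have diff: "norm (integral {a..d} f - integral {a..c} f - (d - c) *\<^sub>R x) \<le> e * (d - c)"
    if "a \<le> c" "c \<le> d" "d \<le> b" "\<And>s. s \<in> {c..d} \<Longrightarrow> norm (f s - x) \<le> e" for c d x e
  proof -
    have I: "((\<lambda>s. f s \<bullet> y) has_integral (integral {p..q} f \<bullet> y)) {p..q}" if "a \<le> p" "q \<le> b" for p q y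
      using has_integral_linear[OF integrable_integral[OF sub[OF that]] bounded_linear_inner_left, of y]
      by (simp add: o_def)
    have "(integral {a..d} f - integral {a..c} f) \<bullet> y = integral {c..d} f \<bullet> y" for y
    proof -
      have "c \<le> b" "a \<le> d" using that(1,2,3) by auto
      from has_integral_combine[OF that(1,2) I[OF order_refl \<open>c \<le> b\<close>] I[OF that(1,3)]]
      have "((\<lambda>s. f s \<bullet> y) has_integral (integral {a..c} f \<bullet> y + integral {c..d} f \<bullet> y)) {a..d}" .
      from has_integral_unique[OF this I[OF order_refl that(3)]] show ?thesis
        by (simp only: inner_diff_left)
    qed
    then have "integral {a..d} f - integral {a..c} f = integral {c..d} f"
      by (rule inner_eqI)
    moreover have "((\<lambda>s. f s - x) has_integral (integral {c..d} f - (d - c) *\<^sub>R x)) {c..d}"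
      using has_integral_diff[OF integrable_integral[OF sub[OF that(1,3)]] has_integral_const_real[of x c d]] that(2)
      by simp
    ultimately have fx: "((\<lambda>s. f s - x) has_integral (integral {a..d} f - integral {a..c} f - (d - c) *\<^sub>R x)) {c..d}"
      by simp
    have "norm (integral {c..d} (\<lambda>s. f s - x)) \<le> integral {c..d} (\<lambda>s. e)"
      by (rule norm_integral_le[OF has_integral_integrable[OF fx] _ that(4)])
        (rule integrable_continuous_interval[OF continuous_on_const])
    also have "integral {c..d} (\<lambda>s. e) = e * (d - c)" using that(2) by simp
    finally show ?thesis unfolding integral_unique[OF fx] .
  qed
  show ?thesis
    unfolding has_vector_derivative_def has_derivative_within_alt2
  proof (intro conjI allI impI)
    fix e :: real assume "0 < e"
    have "\<forall>\<^sub>F s in at t within {a..b}. dist (f s) (f t) < e"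
      using f t \<open>0 < e\<close> by (auto simp: continuous_on_def tendsto_iff)
    then obtain d where d: "0 < d" "\<And>s. s \<in> {a..b} \<Longrightarrow> dist s t < d \<Longrightarrow> norm (f s - f t) \<le> e"
      unfolding eventually_at
    proof (elim exE conjE)
      fix d assume d: "0 < d" "\<forall>s\<in>{a..b}. s \<noteq> t \<and> dist s t < d \<longrightarrow> dist (f s) (f t) < e"
      show ?thesis
      proof (rule that[OF d(1)])
        fix s assume "s \<in> {a..b}" "dist s t < d"
        with d(2) \<open>0 < e\<close> show "norm (f s - f t) \<le> e"
          by (cases "s = t") (auto simp: dist_norm intro: less_imp_le)
      qed
    qed
    have "norm (integral {a..y} f - integral {a..t} f - (y - t) *\<^sub>R f t) \<le> e * norm (y - t)"
      if y: "y \<in> {a..b}" "dist y t < d" for y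
    proof (cases "t \<le> y")
      case True
      have "norm (integral {a..y} f - integral {a..t} f - (y - t) *\<^sub>R f t) \<le> e * (y - t)"
      proof (rule diff)
        show "norm (f s - f t) \<le> e" if "s \<in> {t..y}" for s
          using that y t by (intro d(2)) (auto simp: dist_real_def)
      qed (use t y True in auto)
      then show ?thesis using True by simp
    next
      case False
      have "norm (integral {a..t} f - integral {a..y} f - (t - y) *\<^sub>R f t) \<le> e * (t - y)"
      proof (rule diff)
        show "norm (f s - f t) \<le> e" if "s \<in> {y..t}" for s
          using that y t False by (intro d(2)) (auto simp: dist_real_def)
      qed (use t y False in auto)
      moreover have "integral {a..t} f - integral {a..y} f - (t - y) *\<^sub>R f t
          = - (integral {a..y} f - integral {a..t} f - (y - t) *\<^sub>R f t)"
        by (simp add: algebra_simps)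
      ultimately show ?thesis using False by (simp only: norm_minus_cancel) simp
    qed
    then show "\<forall>\<^sub>F y in at t within {a..b}.
        norm (integral {a..y} f - integral {a..t} f - (y - t) *\<^sub>R f t) \<le> e * norm (y - t)"
      unfolding eventually_at using d(1) by blast
  qed (rule bounded_linear_scaleR_left)
qed

subsection \<open>The Riesz representation and the Lax-Milgram lemma\<close>

text \<open>The representing vector is the minimiser of \<open>\<parallel>x\<parallel>\<^sup>2 - 2 \<phi> x\<close>.\<close>

lemma riesz_representation:
  fixes \<phi> :: "'v::{real_inner, complete_space} \<Rightarrow> real"
  assumes \<phi>: "bounded_linear \<phi>"
  obtains x where "\<And>y. \<phi> y = x \<bullet> y"
proof -
  interpret \<phi>: bounded_linear \<phi> by (rule \<phi>)
  define J where "J x = x \<bullet> x - 2 * \<phi> x" for x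
  obtain K where K: "\<And>x. norm (\<phi> x) \<le> norm x * K" using \<phi>.bounded by blast
  have J_ge: "- (K\<^sup>2) \<le> J x" for x
  proof -
    have "0 \<le> (norm x - K)\<^sup>2" by simp
    then have "2 * (norm x * K) \<le> (norm x)\<^sup>2 + K\<^sup>2" by (simp add: power2_diff)
    with K[of x] show ?thesis unfolding J_def by (simp add: power2_norm_eq_inner)
  qed
  define m where "m = Inf (range J)"
  have m_le: "m \<le> J x" for x
    unfolding m_def by (rule cInf_lower) (auto intro!: bdd_belowI[of _ "- (K\<^sup>2)"] simp: J_ge)
  have "\<exists>x. J x < m + inverse (real (Suc n))" for n
  proof -
    have "Inf (range J) < m + inverse (real (Suc n))" by (simp add: m_def)
    from cInf_lessD[OF _ this] show ?thesis by auto
  qed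
  then obtain X where X: "\<And>n. J (X n) < m + inverse (real (Suc n))" by metis
  \<comment> \<open>The parallelogram law, with J at the midpoint bounded below by m; it makes every
    minimising sequence a Cauchy sequence.\<close>
  have dist_le: "(norm (x - y))\<^sup>2 \<le> 2 * (J x - m) + 2 * (J y - m)" for x y
  proof -
    have "J ((1/2) *\<^sub>R (x + y)) = (x + y) \<bullet> (x + y) / 4 - \<phi> x - \<phi> y"
      by (simp add: J_def \<phi>.scaleR \<phi>.add add_divide_distrib)
    with m_le[of "(1/2) *\<^sub>R (x + y)"] have "4 * m + 4 * \<phi> x + 4 * \<phi> y \<le> (x + y) \<bullet> (x + y)" by simp
    then show ?thesis
      by (simp add: J_def power2_norm_eq_inner inner_add inner_diff inner_commute algebra_simps)
  qed
  have "Cauchy X"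
  proof (rule metric_CauchyI)
    fix e :: real assume e: "0 < e"
    obtain N where N: "inverse (real (Suc N)) < e\<^sup>2 / 4"
      using reals_Archimedean[of "e\<^sup>2 / 4"] e by auto
    show "\<exists>M. \<forall>m\<ge>M. \<forall>n\<ge>M. dist (X m) (X n) < e"
    proof (intro exI[of _ N] allI impI)
      fix k n assume k: "k \<ge> N" and n: "n \<ge> N"
      have le: "J (X k) - m < e\<^sup>2 / 4" if "k \<ge> N" for k
      proof -
        have "inverse (real (Suc k)) \<le> inverse (real (Suc N))"
          using that by (intro le_imp_inverse_le) auto
        with X[of k] N show ?thesis by linarith
      qed
      have "(norm (X k - X n))\<^sup>2 < e\<^sup>2"
        using dist_le[of "X k" "X n"] le[OF k] le[OF n] by simp
      then show "dist (X k) (X n) < e"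
        using e by (simp add: dist_norm power2_less_imp_less)
    qed
  qed
  then obtain x where x: "X \<longlonglongrightarrow> x" by (auto simp: Cauchy_convergent_iff convergent_def)
  have "J x \<le> m"
  proof (rule LIMSEQ_le)
    show "(\<lambda>n. J (X n)) \<longlonglongrightarrow> J x"
      unfolding J_def by (intro tendsto_intros x \<phi>.tendsto)
    show "(\<lambda>n. m + inverse (real (Suc n))) \<longlonglongrightarrow> m"
      using tendsto_add[OF tendsto_const LIMSEQ_inverse_real_of_nat, of m] by simp
    show "\<exists>N. \<forall>n\<ge>N. J (X n) \<le> m + inverse (real (Suc n))"
      using X by (auto intro: less_imp_le)
  qed
  have "\<phi> y = x \<bullet> y" for y
  proof -
    define d where "d = x \<bullet> y - \<phi> y"
    define N where "N = y \<bullet> y"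
    \<comment> \<open>Along y the quadratic would be minimised at -d / N. Replacing N by N + 1
      admits y = 0 and still gives a strict decrease unless d = 0.\<close>
    define t where "t = - d / (N + 1)"
    have N: "0 \<le> N" by (simp add: N_def)
    have "J x \<le> J (x + t *\<^sub>R y)" using \<open>J x \<le> m\<close> m_le by (rule order_trans)
    also have "J (x + t *\<^sub>R y) = J x + 2 * t * d + t\<^sup>2 * N"
      by (simp add: J_def d_def N_def \<phi>.add \<phi>.scaleR inner_add inner_commute power2_eq_square algebra_simps)
    finally have "0 \<le> 2 * t * d + t\<^sup>2 * N" by simp
    then have "0 \<le> (N + 1)\<^sup>2 * (2 * t * d + t\<^sup>2 * N)" by simp
    also have "\<dots> = 2 * (N + 1) * (t * (N + 1)) * d + (t * (N + 1))\<^sup>2 * N"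
      by (simp add: power2_eq_square algebra_simps)
    also have "t * (N + 1) = - d" using N by (simp add: t_def)
    also have "2 * (N + 1) * (- d) * d + (- d)\<^sup>2 * N = - (d\<^sup>2 * (N + 2))"
      by (simp add: power2_eq_square algebra_simps)
    finally have "d\<^sup>2 * (N + 2) \<le> 0" by simp
    then have "d = 0" using N by (simp add: mult_le_0_iff)
    then show ?thesis by (simp add: d_def)
  qed
  then show ?thesis by (rule that)
qed

context normal_triple
begin

sublocale dual: bounded_bilinear dual
  by (rule bounded_bilinear_dual)

lemma bounded_linear_i: "bounded_linear i" and inj_i: "inj i" and dense_i: "closure (range i) = UNIV"
  using embedding_V_H by (auto simp: dense_embedding_def)

lemma bounded_linear_j: "bounded_linear j" and inj_j: "inj j"
  using embedding_H_V' by (auto simp: dense_embedding_def)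

lemma dual_eqI:
  assumes "\<And>v. dual w v = dual w' v"
  shows "w = w'"
  using dual_represents[OF dual.bounded_linear_right, of w'] assms by blast

text \<open>With R w the Riesz representative of w in V, a solution is a fixed point of v - \<rho>
  (R (G v) - R w), which is a contraction of V for a suitable \<rho>. The norm of V' enters only
  through the boundedness of G and of the pairing, as it need not be the dual norm.\<close>

lemma lax_milgram:
  assumes G: "bounded_linear G" and "0 < \<kappa>" and coercive: "\<And>v. \<kappa> * (norm v)\<^sup>2 \<le> dual (G v) v"
  shows "\<exists>v. G v = w"
proof -
  interpret G: bounded_linear G by (rule G)
  have "\<exists>x. \<forall>y. dual w y = x \<bullet> y" for w
    by (rule riesz_representation[OF dual.bounded_linear_right]) blast
  then obtain R where R: "\<And>w y. dual w y = R w \<bullet> y" by metis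
  obtain K0 where K0: "\<And>w y. norm (dual w y) \<le> norm w * norm y * K0" using dual.bounded by blast
  obtain K1 where K1: "\<And>v. norm (G v) \<le> norm v * K1" using G.bounded by blast
  \<comment> \<open>Adding \<kappa> guarantees 0 < K and \<kappa> \<le> K, so that 1 - (\<kappa> /
    K)^2 is nonnegative.\<close>
  define K where "K = \<bar>K0\<bar> * \<bar>K1\<bar> + \<kappa>"
  have "0 < K" "\<kappa> \<le> K" using \<open>0 < \<kappa>\<close> by (simp_all add: K_def add_nonneg_pos)
  have R_bound: "norm (R (G v)) \<le> K * norm v" for v
  proof -
    let ?r = "R (G v)"
    have "(norm ?r)\<^sup>2 = dual (G v) ?r" by (simp add: R power2_norm_eq_inner)
    also have "\<dots> \<le> norm (G v) * norm ?r * K0" using K0[of "G v" ?r] by simp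
    also have "\<dots> \<le> norm (G v) * norm ?r * \<bar>K0\<bar>" by (intro mult_left_mono) auto
    also have "\<dots> \<le> (norm v * \<bar>K1\<bar>) * norm ?r * \<bar>K0\<bar>"
      by (intro mult_right_mono order_trans[OF K1] mult_left_mono) auto
    also have "\<dots> \<le> (K * norm v) * norm ?r"
      using \<open>0 < \<kappa>\<close> by (simp add: K_def algebra_simps)
    finally have "norm ?r * norm ?r \<le> (K * norm v) * norm ?r" by (simp add: power2_eq_square)
    then show ?thesis
      using \<open>0 < K\<close> by (cases "?r = 0") auto
  qed
  \<comment> \<open>This value minimises 1 - 2 \<rho> \<kappa> + \<rho>^2 K^2, the bound on the
    squared contraction factor; the minimum is 1 - (\<kappa> / K)^2.\<close>
  define \<rho> where "\<rho> = \<kappa> / K\<^sup>2"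
  define f where "f x = x - \<rho> *\<^sub>R (R (G x) - R w)" for x
  have R_diff: "R (G x) - R (G y) = R (G (x - y))" for x y
  proof -
    have "(R (G x) - R (G y) - R (G (x - y))) \<bullet> z = 0" for z
      by (simp add: inner_diff_left G.diff dual.diff_left flip: R)
    from this[of "R (G x) - R (G y) - R (G (x - y))"] show ?thesis by simp
  qed
  define c where "c = sqrt (1 - (\<kappa> / K)\<^sup>2)"
  have q: "0 < (\<kappa> / K)\<^sup>2" "(\<kappa> / K)\<^sup>2 \<le> 1"
    using \<open>0 < \<kappa>\<close> \<open>0 < K\<close> \<open>\<kappa> \<le> K\<close> by (auto intro!: power_le_one)
  have contraction: "dist (f x) (f y) \<le> c * dist x y" for x y
  proof -
    let ?d = "x - y"
    have "f x - f y = ?d - \<rho> *\<^sub>R (R (G x) - R (G y))"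
      by (simp add: f_def algebra_simps)
    then have fd: "f x - f y = ?d - \<rho> *\<^sub>R R (G ?d)" by (simp only: R_diff)
    have "(norm (f x - f y))\<^sup>2 = (norm ?d)\<^sup>2 - 2 * \<rho> * dual (G ?d) ?d + \<rho>\<^sup>2 * (norm (R (G ?d)))\<^sup>2"
      unfolding fd power2_norm_eq_inner R[of "G ?d" ?d]
      by (simp add: inner_diff inner_commute power2_eq_square algebra_simps)
    also have "\<dots> \<le> (norm ?d)\<^sup>2 - 2 * \<rho> * (\<kappa> * (norm ?d)\<^sup>2) + \<rho>\<^sup>2 * (K * norm ?d)\<^sup>2"
      using \<open>0 < \<kappa>\<close> coercive[of ?d] R_bound[of ?d]
      by (intro add_mono diff_mono mult_left_mono power_mono) (auto simp: \<rho>_def)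
    also have "\<dots> = (1 - (\<kappa> / K)\<^sup>2) * (norm ?d)\<^sup>2"
      using \<open>0 < K\<close> by (simp add: \<rho>_def field_simps power2_eq_square)
    also have "\<dots> = (c * norm ?d)\<^sup>2"
      using q by (simp add: c_def power_mult_distrib)
    finally show ?thesis
      unfolding dist_norm by (rule power2_le_imp_le) (use q in \<open>simp add: c_def\<close>)
  qed
  have c: "0 \<le> c" "c < 1" using q by (simp_all add: c_def)
  have "\<exists>!x. f x = x"
    using banach_fix_type[OF c] contraction by blast
  then obtain x where x: "f x = x" by blast
  then have "R (G x) = R w"
    using \<open>0 < \<kappa>\<close> \<open>0 < K\<close> by (simp add: f_def \<rho>_def)
  then have "G x = w" by (intro dual_eqI) (simp add: R)
  then show ?thesis by blast
qed

end

subsection \<open>Classical solutions and the energy inequality\<close>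

locale coercive_evolution = normal_triple i j dual
  for i :: "'v::{real_inner, complete_space} \<Rightarrow> 'h::{real_inner, complete_space}"
    and j :: "'h \<Rightarrow> 'w::{real_inner, complete_space}"
    and dual :: "'w \<Rightarrow> 'v \<Rightarrow> real" +
  fixes A :: "'v \<Rightarrow> 'w" and \<kappa> C\<^sub>A D :: real
  assumes bounded_linear_A: "bounded_linear A"
    and \<kappa>_pos: "0 < \<kappa>"
    and coercive: "dual (A v) v + \<kappa> * (norm v)\<^sup>2 \<le> C\<^sub>A * (norm (i v))\<^sup>2"
    and dual_bound: "\<bar>dual w v\<bar> \<le> D * norm w * norm v"
begin

sublocale A: bounded_linear A by (rule bounded_linear_A)
sublocale i: bounded_linear i by (rule bounded_linear_i)
sublocale j: bounded_linear j by (rule bounded_linear_j)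

text \<open>The finite exceptional set is there for the interpolated Euler solutions, which have
  corners at the grid points. For the same reason F is only square integrable: it jumps where they
  turn.\<close>

definition classical_solution :: "real \<Rightarrow> (real \<Rightarrow> 'v) \<Rightarrow> (real \<Rightarrow> 'w) \<Rightarrow> bool" where
  "classical_solution T v F \<longleftrightarrow> continuous_on {0..T} v \<and> in_L2 (lebesgue_on {0..T}) F \<and>
     (\<exists>S v'. finite S \<and> (\<forall>t\<in>{0<..<T} - S. (v has_vector_derivative v' t) (at t) \<and>
        j (i (v' t)) = A (v t) + F t))"

lemma classical_solutionI:
  assumes "continuous_on {0..T} v" "in_L2 (lebesgue_on {0..T}) F" "finite S"
    "\<And>t. t \<in> {0<..<T} - S \<Longrightarrow> (v has_vector_derivative v' t) (at t)"
    "\<And>t. t \<in> {0<..<T} - S \<Longrightarrow> j (i (v' t)) = A (v t) + F t"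
  shows "classical_solution T v F"
  using assms unfolding classical_solution_def by blast

lemma classical_solution_combine:
  assumes v: "classical_solution T v F" and w: "classical_solution T w G"
  shows "classical_solution T (\<lambda>t. v t + c *\<^sub>R w t) (\<lambda>t. F t + c *\<^sub>R G t)"
proof -
  obtain S v' where S: "finite S" "\<And>t. t \<in> {0<..<T} - S \<Longrightarrow> (v has_vector_derivative v' t) (at t)"
     "\<And>t. t \<in> {0<..<T} - S \<Longrightarrow> j (i (v' t)) = A (v t) + F t"
    using v unfolding classical_solution_def by blast
  obtain S' w' where S': "finite S'" "\<And>t. t \<in> {0<..<T} - S' \<Longrightarrow> (w has_vector_derivative w' t) (at t)"
     "\<And>t. t \<in> {0<..<T} - S' \<Longrightarrow> j (i (w' t)) = A (w t) + G t"
    using w unfolding classical_solution_def by blast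
  show ?thesis
  proof (rule classical_solutionI)
    show "continuous_on {0..T} (\<lambda>t. v t + c *\<^sub>R w t)"
      using v w unfolding classical_solution_def by (intro continuous_intros) auto
    have "in_L2 (lebesgue_on {0..T}) F" "in_L2 (lebesgue_on {0..T}) G"
      using v w unfolding classical_solution_def by auto
    then show "in_L2 (lebesgue_on {0..T}) (\<lambda>t. F t + c *\<^sub>R G t)"
      by (intro lebesgue_on_interval.in_L2_add
          lebesgue_on_interval.in_L2_bounded_linear[OF bounded_linear_scaleR_right])
    show "finite (S \<union> S')" using S(1) S'(1) by simp
    fix t assume t: "t \<in> {0<..<T} - (S \<union> S')"
    then have tS: "t \<in> {0<..<T} - S" and tS': "t \<in> {0<..<T} - S'" by auto
    show "((\<lambda>t. v t + c *\<^sub>R w t) has_vector_derivative (v' t + c *\<^sub>R w' t)) (at t)"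
      using S(2)[OF tS] S'(2)[OF tS']
      by (intro has_vector_derivative_add bounded_linear.has_vector_derivative[OF bounded_linear_scaleR_right])
    show "j (i (v' t + c *\<^sub>R w' t)) = A (v t + c *\<^sub>R w t) + (F t + c *\<^sub>R G t)"
      by (simp add: i.add i.scaleR j.add j.scaleR A.add A.scaleR S(3)[OF tS] S'(3)[OF tS'] scaleR_add_right)
  qed
qed

lemma dual_le:
  assumes "0 < d"
  shows "2 * dual w v \<le> d * (norm v)\<^sup>2 + D\<^sup>2 / d * (norm w)\<^sup>2"
proof -
  have "0 \<le> (d * norm v - D * norm w)\<^sup>2" by simp
  then have "2 * (d * norm v) * (D * norm w) \<le> d\<^sup>2 * (norm v)\<^sup>2 + D\<^sup>2 * (norm w)\<^sup>2"
    by (simp add: power2_diff power_mult_distrib)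
  then have "2 * (D * norm w * norm v) \<le> d * (norm v)\<^sup>2 + D\<^sup>2 / d * (norm w)\<^sup>2"
    using assms by (simp add: field_simps power2_eq_square)
  with dual_bound[of w v] show ?thesis by linarith
qed

lemma weighted_L2_integrable_on:
  fixes g :: "real \<Rightarrow> 'b::real_normed_vector" and \<phi> :: "real \<Rightarrow> real"
  assumes g: "in_L2 (lebesgue_on {a..b}) g" and \<phi>: "continuous_on {a..b} \<phi>" and t: "t \<in> {a..b}"
  shows "(\<lambda>s. \<phi> s * (norm (g s))\<^sup>2) integrable_on {a..t}"
proof -
  obtain B where B: "\<And>s. s \<in> {a..b} \<Longrightarrow> norm (\<phi> s) \<le> B"
    using compact_imp_bounded[OF compact_continuous_image[OF \<phi> compact_Icc]]
    unfolding bounded_iff by blast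
  have [measurable]: "\<phi> \<in> borel_measurable (lebesgue_on {a..b})"
    using integrable_lebesgue_on_Icc_continuous[OF \<phi>] by (rule borel_measurable_integrable)
  have [measurable]: "(\<lambda>s. (norm (g s))\<^sup>2) \<in> borel_measurable (lebesgue_on {a..b})"
    using in_L2_integrable[OF g] by (rule borel_measurable_integrable)
  have "integrable (lebesgue_on {a..b}) (\<lambda>s. \<phi> s * (norm (g s))\<^sup>2)"
  proof (rule Bochner_Integration.integrable_bound)
    show "integrable (lebesgue_on {a..b}) (\<lambda>s. B * (norm (g s))\<^sup>2)"
      using in_L2_integrable[OF g] by simp
    show "AE s in lebesgue_on {a..b}. norm (\<phi> s * (norm (g s))\<^sup>2) \<le> norm (B * (norm (g s))\<^sup>2)"
    proof (rule AE_I2)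
      fix s assume "s \<in> space (lebesgue_on {a..b})"
      then have "\<bar>\<phi> s\<bar> \<le> \<bar>B\<bar>" using B[of s] by simp
      then show "norm (\<phi> s * (norm (g s))\<^sup>2) \<le> norm (B * (norm (g s))\<^sup>2)"
        by (simp add: abs_mult mult_right_mono)
    qed
  qed simp
  then have "(\<lambda>s. \<phi> s * (norm (g s))\<^sup>2) integrable_on {a..b}"
    by (rule integrable_on_lebesgue_on) simp
  then show ?thesis by (rule integrable_on_subinterval) (use t in auto)
qed

text \<open>Differentiate e^(-\<mu> s) times the squared H-norm and write F = j h + (F - j h). The
  pairing with h is absorbed by the summand \<nu> of \<mu>, leaving 1/\<nu>; the pairing with F - j
  h is absorbed by half of the coercivity term 2 \<kappa>, leaving D^2 / \<kappa>. The freedom in h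
  lets later uses decide which part of the right-hand side profits from a large \<nu>.\<close>

lemma classical_solution_energy:
  fixes h :: "real \<Rightarrow> 'h"
  assumes v: "classical_solution T v F" and h: "continuous_on {0..T} h"
    and "0 < \<nu>" and t: "t \<in> {0..T}"
  defines "\<mu> \<equiv> 2 * \<bar>C\<^sub>A\<bar> + \<nu>"
  shows "exp (- \<mu> * t) * (norm (i (v t)))\<^sup>2 + \<kappa> * integral {0..t} (\<lambda>s. exp (- \<mu> * s) * (norm (v s))\<^sup>2)
    \<le> (norm (i (v 0)))\<^sup>2 + integral {0..t} (\<lambda>s. exp (- \<mu> * s) * (norm (h s))\<^sup>2) / \<nu>
      + D\<^sup>2 / \<kappa> * integral {0..t} (\<lambda>s. exp (- \<mu> * s) * (norm (F s - j (h s)))\<^sup>2)"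
proof -
  obtain S v' where S: "finite S" and v': "\<And>t. t \<in> {0<..<T} - S \<Longrightarrow> (v has_vector_derivative v' t) (at t)"
     and eq: "\<And>t. t \<in> {0<..<T} - S \<Longrightarrow> j (i (v' t)) = A (v t) + F t"
    using v unfolding classical_solution_def by blast
  have vc: "continuous_on {0..T} v" and F: "in_L2 (lebesgue_on {0..T}) F"
    using v unfolding classical_solution_def by auto
  define E where "E s = exp (- \<mu> * s)" for s
  have E_cont: "continuous_on X E" for X unfolding E_def[abs_def] by (intro continuous_intros)
  have int_v: "(\<lambda>s. E s * (norm (v s))\<^sup>2) integrable_on {0..t}"
    and int_h: "(\<lambda>s. E s * (norm (h s))\<^sup>2) integrable_on {0..t}"
    and int_F: "(\<lambda>s. E s * (norm (F s - j (h s)))\<^sup>2) integrable_on {0..t}"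
    by (rule weighted_L2_integrable_on[OF _ E_cont t], intro in_L2_continuous vc h
        lebesgue_on_interval.in_L2_diff[OF F] lebesgue_on_interval.in_L2_bounded_linear[OF bounded_linear_j])+
  define P where "P s = E s * (norm (i (v s)))\<^sup>2" for s
  define R where "R s = E s * (norm (h s))\<^sup>2 / \<nu> + D\<^sup>2 / \<kappa> * (E s * (norm (F s - j (h s)))\<^sup>2)
      - \<kappa> * (E s * (norm (v s))\<^sup>2)" for s
  \<comment> \<open>At the end points and at the exceptional times P' takes the value of its
    majorant R, so that the comparison holds on the whole interval; the fundamental theorem does not
    look at these points.\<close>
  define P' where "P' s = (if s \<in> {0<..<T} - S
     then E s * (2 * (i (v' s) \<bullet> i (v s)) - \<mu> * (norm (i (v s)))\<^sup>2) else R s)" for s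
  have R_int: "(R has_integral (integral {0..t} (\<lambda>s. E s * (norm (h s))\<^sup>2) / \<nu>
      + D\<^sup>2 / \<kappa> * integral {0..t} (\<lambda>s. E s * (norm (F s - j (h s)))\<^sup>2)
      - \<kappa> * integral {0..t} (\<lambda>s. E s * (norm (v s))\<^sup>2))) {0..t}"
    unfolding R_def[abs_def]
    by (intro has_integral_diff has_integral_add has_integral_divide has_integral_mult_right
        integrable_integral int_v int_h int_F)
  have P_int: "(P' has_integral (P t - P 0)) {0..t}"
  proof (rule fundamental_theorem_of_calculus_interior_strong[OF S])
    show "0 \<le> t" using t by simp
    have sub: "{0..t} \<subseteq> {0..T}" using t by auto
    show "continuous_on {0..t} P"
      unfolding P_def[abs_def]
      by (intro continuous_intros E_cont continuous_on_subset[OF vc sub] i.continuous_on)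
    fix s assume s: "s \<in> {0<..<t} - S"
    then have s': "s \<in> {0<..<T} - S" using t by auto
    have "((\<lambda>s. i (v s)) has_vector_derivative i (v' s)) (at s)"
      by (rule i.has_vector_derivative[OF v'[OF s']])
    note iv' = this
    have "((\<lambda>s. i (v s) \<bullet> i (v s)) has_vector_derivative (i (v s) \<bullet> i (v' s) + i (v' s) \<bullet> i (v s))) (at s)"
      by (rule bounded_bilinear.has_vector_derivative[OF bounded_bilinear_inner iv' iv'])
    moreover have "(E has_vector_derivative - \<mu> * E s) (at s)"
      unfolding E_def has_real_derivative_iff_has_vector_derivative[symmetric]
      by (auto intro!: derivative_eq_intros)
    ultimately have "((\<lambda>s. E s * (i (v s) \<bullet> i (v s))) has_vector_derivative
        E s * (i (v s) \<bullet> i (v' s) + i (v' s) \<bullet> i (v s)) + - \<mu> * E s * (i (v s) \<bullet> i (v s))) (at s)"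
      by (intro has_vector_derivative_mult)
    moreover have "E s * (i (v s) \<bullet> i (v' s) + i (v' s) \<bullet> i (v s)) + - \<mu> * E s * (i (v s) \<bullet> i (v s)) = P' s"
      using s' by (simp add: P'_def power2_norm_eq_inner inner_commute algebra_simps)
    ultimately show "(P has_vector_derivative P' s) (at s)"
      by (simp add: P_def[abs_def] power2_norm_eq_inner)
  qed
  have "P t - P 0 \<le> integral {0..t} (\<lambda>s. E s * (norm (h s))\<^sup>2) / \<nu>
      + D\<^sup>2 / \<kappa> * integral {0..t} (\<lambda>s. E s * (norm (F s - j (h s)))\<^sup>2)
      - \<kappa> * integral {0..t} (\<lambda>s. E s * (norm (v s))\<^sup>2)"
  proof (rule has_integral_le[OF P_int R_int])
    fix s assume "s \<in> {0..t}"
    show "P' s \<le> R s"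
    proof (cases "s \<in> {0<..<T} - S")
      case True
      have "i (v' s) \<bullet> i (v s) = dual (j (i (v' s))) (v s)" by (simp add: dual_extends_inner)
      also have "\<dots> = dual (A (v s)) (v s) + dual (j (h s)) (v s) + dual (F s - j (h s)) (v s)"
        by (simp add: eq[OF True] dual.add_left dual.diff_left)
      finally have e1: "i (v' s) \<bullet> i (v s) = dual (A (v s)) (v s) + h s \<bullet> i (v s) + dual (F s - j (h s)) (v s)"
        by (simp only: dual_extends_inner)
      have e2: "2 * (h s \<bullet> i (v s)) \<le> \<nu> * (norm (i (v s)))\<^sup>2 + (norm (h s))\<^sup>2 / \<nu>"
      proof -
        have "0 \<le> (norm (h s) - \<nu> * norm (i (v s)))\<^sup>2" by simp
        then have "2 * (norm (h s) * norm (i (v s))) \<le> \<nu> * (norm (i (v s)))\<^sup>2 + (norm (h s))\<^sup>2 / \<nu>"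
          using \<open>0 < \<nu>\<close> by (simp add: power2_diff field_simps power2_eq_square)
        with norm_cauchy_schwarz[of "h s" "i (v s)"] show ?thesis by linarith
      qed
      have e3: "C\<^sub>A * (norm (i (v s)))\<^sup>2 \<le> \<bar>C\<^sub>A\<bar> * (norm (i (v s)))\<^sup>2"
        by (intro mult_right_mono) auto
      have "2 * (i (v' s) \<bullet> i (v s)) - \<mu> * (norm (i (v s)))\<^sup>2
          \<le> (norm (h s))\<^sup>2 / \<nu> + D\<^sup>2 / \<kappa> * (norm (F s - j (h s)))\<^sup>2 - \<kappa> * (norm (v s))\<^sup>2"
        using e1 e2 e3 coercive[of "v s"] dual_le[OF \<kappa>_pos, of "F s - j (h s)" "v s"]
        unfolding \<mu>_def distrib_right mult.assoc by linarith
      then have "E s * (2 * (i (v' s) \<bullet> i (v s)) - \<mu> * (norm (i (v s)))\<^sup>2)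
          \<le> E s * ((norm (h s))\<^sup>2 / \<nu> + D\<^sup>2 / \<kappa> * (norm (F s - j (h s)))\<^sup>2 - \<kappa> * (norm (v s))\<^sup>2)"
        by (rule mult_left_mono) (simp add: E_def)
      also have "\<dots> = R s" by (simp add: R_def algebra_simps)
      finally show ?thesis using True unfolding P'_def by simp
    next
      case False
      then show ?thesis unfolding P'_def by (simp only: if_False)
    qed
  qed
  moreover have "P 0 = (norm (i (v 0)))\<^sup>2" by (simp add: P_def E_def)
  ultimately show ?thesis by (simp add: P_def E_def)
qed

text \<open>Each scalar component is continuous and differentiable off finitely many points, so the
  fundamental theorem applies to it, and \<open>inner_eqI\<close> reassembles the vectors.\<close>

lemma classical_solution_integral:
  assumes v: "classical_solution T v F" and t: "t \<in> {0..T}"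
  shows "integral {0..t} (\<lambda>s. A (v s) + F s) = j (i (v t)) - j (i (v 0))"
proof -
  obtain S v' where S: "finite S" and v': "\<And>t. t \<in> {0<..<T} - S \<Longrightarrow> (v has_vector_derivative v' t) (at t)"
     and eq: "\<And>t. t \<in> {0<..<T} - S \<Longrightarrow> j (i (v' t)) = A (v t) + F t"
    using v unfolding classical_solution_def by blast
  have vc: "continuous_on {0..T} v" using v unfolding classical_solution_def by auto
  have "in_L2 (lebesgue_on {0..T}) (\<lambda>s. A (v s) + F s)"
    using v unfolding classical_solution_def
    by (intro lebesgue_on_interval.in_L2_add in_L2_continuous[OF A.continuous_on[OF vc]]) blast
  then have int: "((\<lambda>s. A (v s) + F s) has_integral integral {0..t} (\<lambda>s. A (v s) + F s)) {0..t}"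
    by (intro integrable_integral in_L2_integrable_on[OF _ t])
  have "integral {0..t} (\<lambda>s. A (v s) + F s) \<bullet> y = (j (i (v t)) - j (i (v 0))) \<bullet> y" for y
  proof -
    have "((\<lambda>s. (A (v s) + F s) \<bullet> y) has_integral (j (i (v t)) \<bullet> y - j (i (v 0)) \<bullet> y)) {0..t}"
    proof (rule fundamental_theorem_of_calculus_interior_strong[OF S, where f="\<lambda>s. j (i (v s)) \<bullet> y"])
      show "0 \<le> t" using t by simp
      show "continuous_on {0..t} (\<lambda>s. j (i (v s)) \<bullet> y)"
        using t by (intro continuous_intros j.continuous_on i.continuous_on continuous_on_subset[OF vc]) auto
      fix s assume s: "s \<in> {0<..<t} - S"
      then have s': "s \<in> {0<..<T} - S" using t by auto
      show "((\<lambda>s. j (i (v s)) \<bullet> y) has_vector_derivative (A (v s) + F s) \<bullet> y) (at s)"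
        using bounded_linear.has_vector_derivative[OF bounded_linear_inner_left
            j.has_vector_derivative[OF i.has_vector_derivative[OF v'[OF s']]]]
        by (simp only: eq[OF s'])
    qed
    moreover have "((\<lambda>s. (A (v s) + F s) \<bullet> y) has_integral (integral {0..t} (\<lambda>s. A (v s) + F s) \<bullet> y)) {0..t}"
      using has_integral_linear[OF int bounded_linear_inner_left, of y] by (simp add: o_def)
    ultimately show ?thesis
      by (metis has_integral_unique inner_diff_left)
  qed
  then show ?thesis by (rule inner_eqI)
qed

text \<open>The energy inequality with h = 0 and \<nu> = 1, the weight being at least e^(-\<mu> T).
  Applied to differences of approximants it yields convergence both uniformly in H and in
  L2(0,T;V).\<close>

lemma classical_solution_bound:
  assumes v: "classical_solution T v F" and "0 \<le> T"
  defines "R \<equiv> exp ((2 * \<bar>C\<^sub>A\<bar> + 1) * T) * ((norm (i (v 0)))\<^sup>2 + D\<^sup>2 / \<kappa> * (\<integral>s. (norm (F s))\<^sup>2 \<partial>lebesgue_on {0..T}))"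
  shows "t \<in> {0..T} \<Longrightarrow> (norm (i (v t)))\<^sup>2 \<le> R"
    and "\<kappa> * (\<integral>s. (norm (v s))\<^sup>2 \<partial>lebesgue_on {0..T}) \<le> R"
proof -
  let ?\<mu> = "2 * \<bar>C\<^sub>A\<bar> + 1"
  have vc: "continuous_on {0..T} v" and F: "in_L2 (lebesgue_on {0..T}) F"
    using v unfolding classical_solution_def by auto
  have vL: "in_L2 (lebesgue_on {0..T}) v" using vc by (rule in_L2_continuous)
  have IF: "(\<lambda>s. (norm (F s))\<^sup>2) integrable_on {0..t}" if "t \<in> {0..T}" for t
    using weighted_L2_integrable_on[OF F continuous_on_const[of _ 1] that] by simp
  have Iv: "(\<lambda>s. (norm (v s))\<^sup>2) integrable_on {0..T}"
    using weighted_L2_integrable_on[OF vL continuous_on_const[of _ 1], of T] \<open>0 \<le> T\<close> by simp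
  have LF: "(\<integral>s. (norm (F s))\<^sup>2 \<partial>lebesgue_on {0..T}) = integral {0..T} (\<lambda>s. (norm (F s))\<^sup>2)"
    by (rule lebesgue_integral_eq_integral[OF in_L2_integrable[OF F]]) simp
  have Lv: "(\<integral>s. (norm (v s))\<^sup>2 \<partial>lebesgue_on {0..T}) = integral {0..T} (\<lambda>s. (norm (v s))\<^sup>2)"
    by (rule lebesgue_integral_eq_integral[OF in_L2_integrable[OF vL]]) simp
  have cE: "continuous_on {0..T} (\<lambda>s. exp (- ?\<mu> * s))" by (intro continuous_intros)
  have IEF: "(\<lambda>s. exp (- ?\<mu> * s) * (norm (F s))\<^sup>2) integrable_on {0..t}" if "t \<in> {0..T}" for t
    by (rule weighted_L2_integrable_on[OF F cE that])
  have IEv: "(\<lambda>s. exp (- ?\<mu> * s) * (norm (v s))\<^sup>2) integrable_on {0..t}" if "t \<in> {0..T}" for t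
    by (rule weighted_L2_integrable_on[OF vL cE that])
  have main: "exp (- ?\<mu> * t) * (norm (i (v t)))\<^sup>2 + \<kappa> * integral {0..t} (\<lambda>s. exp (- ?\<mu> * s) * (norm (v s))\<^sup>2)
     \<le> (norm (i (v 0)))\<^sup>2 + D\<^sup>2 / \<kappa> * (\<integral>s. (norm (F s))\<^sup>2 \<partial>lebesgue_on {0..T})" if t: "t \<in> {0..T}" for t
  proof -
    have "integral {0..t} (\<lambda>s. exp (- ?\<mu> * s) * (norm (F s))\<^sup>2) \<le> integral {0..t} (\<lambda>s. (norm (F s))\<^sup>2)"
    proof (rule integral_le[OF IEF[OF t] IF[OF t]])
      fix s assume "s \<in> {0..t}"
      then have "0 \<le> ?\<mu> * s" by (intro mult_nonneg_nonneg) auto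
      then have "exp (- ?\<mu> * s) \<le> 1" by (simp only: exp_le_one_iff mult_minus_left neg_le_0_iff_le)
      then show "exp (- ?\<mu> * s) * (norm (F s))\<^sup>2 \<le> (norm (F s))\<^sup>2"
        by (intro mult_left_le_one_le) auto
    qed
    also have "\<dots> \<le> integral {0..T} (\<lambda>s. (norm (F s))\<^sup>2)"
      using t by (intro integral_subset_le IF) auto
    finally have "D\<^sup>2 / \<kappa> * integral {0..t} (\<lambda>s. exp (- ?\<mu> * s) * (norm (F s))\<^sup>2)
        \<le> D\<^sup>2 / \<kappa> * (\<integral>s. (norm (F s))\<^sup>2 \<partial>lebesgue_on {0..T})"
      unfolding LF using \<kappa>_pos by (intro mult_left_mono) auto
    then show ?thesis
      using classical_solution_energy[OF v continuous_on_const[of _ 0], of 1 t] t by (simp add: j.zero)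
  qed
  have exp_le: "exp (- ?\<mu> * T) \<le> exp (- ?\<mu> * t)" if "t \<in> {0..T}" for t
  proof -
    have "?\<mu> * t \<le> ?\<mu> * T" using that by (intro mult_left_mono) auto
    then show ?thesis by (simp only: exp_le_cancel_iff mult_minus_left neg_le_iff_le)
  qed
  have nn: "0 \<le> integral {0..t} (\<lambda>s. exp (- ?\<mu> * s) * (norm (v s))\<^sup>2)" if "t \<in> {0..T}" for t
    by (intro integral_nonneg IEv that) simp
  have R': "exp (- ?\<mu> * T) * R = (norm (i (v 0)))\<^sup>2 + D\<^sup>2 / \<kappa> * (\<integral>s. (norm (F s))\<^sup>2 \<partial>lebesgue_on {0..T})"
  proof -
    have "exp (- ?\<mu> * T) * exp (?\<mu> * T) = 1"
      using exp_minus_inverse[of "?\<mu> * T"]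
      unfolding mult_minus_left by (simp only: mult.commute[of "exp (- (?\<mu> * T))"])
    then show ?thesis unfolding R_def mult.assoc[symmetric] by simp
  qed
  show "(norm (i (v t)))\<^sup>2 \<le> R" if t: "t \<in> {0..T}"
  proof -
    have "exp (- ?\<mu> * T) * (norm (i (v t)))\<^sup>2 \<le> exp (- ?\<mu> * t) * (norm (i (v t)))\<^sup>2"
      by (rule mult_right_mono[OF exp_le[OF t]]) simp
    also have "\<dots> \<le> exp (- ?\<mu> * T) * R"
      using main[OF t] mult_nonneg_nonneg[OF less_imp_le[OF \<kappa>_pos] nn[OF t]] unfolding R' by linarith
    finally show ?thesis by simp
  qed
  show "\<kappa> * (\<integral>s. (norm (v s))\<^sup>2 \<partial>lebesgue_on {0..T}) \<le> R"
  proof -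
    have T: "T \<in> {0..T}" using \<open>0 \<le> T\<close> by simp
    have "exp (- ?\<mu> * T) * integral {0..T} (\<lambda>s. (norm (v s))\<^sup>2)
        = integral {0..T} (\<lambda>s. exp (- ?\<mu> * T) * (norm (v s))\<^sup>2)"
      by simp
    also have "\<dots> \<le> integral {0..T} (\<lambda>s. exp (- ?\<mu> * s) * (norm (v s))\<^sup>2)"
    proof (rule integral_le)
      show "(\<lambda>s. exp (- ?\<mu> * T) * (norm (v s))\<^sup>2) integrable_on {0..T}"
        by (rule weighted_L2_integrable_on[OF vL continuous_on_const T])
      show "exp (- ?\<mu> * T) * (norm (v s))\<^sup>2 \<le> exp (- ?\<mu> * s) * (norm (v s))\<^sup>2" if "s \<in> {0..T}" for s
        by (rule mult_right_mono[OF exp_le[OF that]]) simp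
    qed (rule IEv[OF T])
    finally have "\<kappa> * (exp (- ?\<mu> * T) * integral {0..T} (\<lambda>s. (norm (v s))\<^sup>2))
        \<le> \<kappa> * integral {0..T} (\<lambda>s. exp (- ?\<mu> * s) * (norm (v s))\<^sup>2)"
      using \<kappa>_pos by (intro mult_left_mono) auto
    also have "\<dots> \<le> exp (- ?\<mu> * T) * R"
      using main[OF T] mult_nonneg_nonneg[OF exp_ge_zero[of "- ?\<mu> * T"] zero_le_power2[of "norm (i (v T))"]]
      unfolding R' by linarith
    finally have "exp (- ?\<mu> * T) * (\<kappa> * integral {0..T} (\<lambda>s. (norm (v s))\<^sup>2)) \<le> exp (- ?\<mu> * T) * R"
      by (simp only: mult.left_commute)
    then have "\<kappa> * integral {0..T} (\<lambda>s. (norm (v s))\<^sup>2) \<le> R"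
      by (rule mult_left_le_imp_le) simp
    then show ?thesis unfolding Lv .
  qed
qed

end

subsection \<open>Approximation by classical solutions\<close>

context coercive_evolution
begin

lemma i_norm_le: "norm (i v) \<le> onorm i * norm v"
  by (rule onorm[OF bounded_linear_i])

text \<open>The substitution v = e^(|\<open>C\<^sub>A\<close>| t) z turns v' = A v into z' = - shift
  z, whose operator is coercive without a correction in the H-norm.\<close>

definition shift :: "'v \<Rightarrow> 'w" where
  "shift v = \<bar>C\<^sub>A\<bar> *\<^sub>R j (i v) - A v"

lemma bounded_linear_ji: "bounded_linear (\<lambda>v. j (i v))"
  by (rule bounded_linear_compose[OF bounded_linear_j bounded_linear_i])

lemma bounded_linear_shift: "bounded_linear shift"
  unfolding shift_def[abs_def]
  by (intro bounded_linear_sub bounded_linear_A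
      bounded_linear_compose[OF bounded_linear_scaleR_right bounded_linear_ji])

sublocale shift: bounded_linear shift by (rule bounded_linear_shift)

lemma shift_coercive: "\<kappa> * (norm v)\<^sup>2 \<le> dual (shift v) v"
proof -
  have "dual (shift v) v = \<bar>C\<^sub>A\<bar> * (norm (i v))\<^sup>2 - dual (A v) v"
    by (simp add: shift_def dual.diff_left dual.scaleR_left dual_extends_inner power2_norm_eq_inner)
  moreover have "C\<^sub>A * (norm (i v))\<^sup>2 \<le> \<bar>C\<^sub>A\<bar> * (norm (i v))\<^sup>2"
    by (intro mult_right_mono) auto
  ultimately show ?thesis using coercive[of v] by linarith
qed

lemma shift_surj: "\<exists>v. shift v = w"
  by (rule lax_milgram[OF bounded_linear_shift \<kappa>_pos shift_coercive])

lemma shift_eq_0: "shift v = 0 \<Longrightarrow> v = 0"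
  using shift_coercive[of v] \<kappa>_pos by (simp add: dual.zero_left mult_le_0_iff)

lemma shift_inj: "shift v = shift w \<Longrightarrow> v = w"
  using shift_eq_0[of "v - w"] by (simp add: shift.diff)

text \<open>If \<open>shift x = w\<close>, then \<open>e\<^sup>\<mu>\<^sup>t t\<^sup>m x\<close> is a solution for \<open>e\<^sup>\<mu>\<^sup>t t\<^sup>m w\<close> up to a right-hand side with
  exponent \<open>m - 1\<close>.\<close>

lemma exp_poly_solvable:
  assumes "exp_poly \<bar>C\<^sub>A\<bar> F"
  obtains v where "classical_solution T v F"
proof -
  let ?\<mu> = "\<bar>C\<^sub>A\<bar>"
  have mono: "\<exists>v. classical_solution T v (\<lambda>t. (exp (?\<mu> * t) * t ^ m) *\<^sub>R w)" for m w
  proof (induction m arbitrary: w)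
    case 0
    obtain x where x: "shift x = w" using shift_surj by blast
    show ?case
    proof (intro exI classical_solutionI[where S="{}" and v'="\<lambda>t. (?\<mu> * exp (?\<mu> * t)) *\<^sub>R x"])
      show "continuous_on {0..T} (\<lambda>t. exp (?\<mu> * t) *\<^sub>R x)" by (intro continuous_intros)
      show "in_L2 (lebesgue_on {0..T}) (\<lambda>t. (exp (?\<mu> * t) * t ^ 0) *\<^sub>R w)"
        by (intro in_L2_continuous continuous_intros)
      fix t
      have "((\<lambda>t. exp (?\<mu> * t)) has_real_derivative (?\<mu> * exp (?\<mu> * t))) (at t)"
        by (auto intro!: derivative_eq_intros)
      then show "((\<lambda>t. exp (?\<mu> * t) *\<^sub>R x) has_vector_derivative (?\<mu> * exp (?\<mu> * t)) *\<^sub>R x) (at t)"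
        unfolding has_real_derivative_iff_has_vector_derivative
        by (rule bounded_linear.has_vector_derivative[OF bounded_linear_scaleR_left])
      show "j (i ((?\<mu> * exp (?\<mu> * t)) *\<^sub>R x)) = A (exp (?\<mu> * t) *\<^sub>R x) + (exp (?\<mu> * t) * t ^ 0) *\<^sub>R w"
        unfolding x[symmetric] shift_def
        by (simp add: i.scaleR j.scaleR A.scaleR scaleR_diff_right mult.commute)
    qed simp
  next
    case (Suc m)
    obtain x where x: "shift x = w" using shift_surj by blast
    obtain v1 where v1: "classical_solution T v1 (\<lambda>t. (exp (?\<mu> * t) * t ^ m) *\<^sub>R j (i x))"
      using Suc.IH by blast
    define v2 where "v2 t = (exp (?\<mu> * t) * t ^ Suc m) *\<^sub>R x" for t
    define e' where "e' t = ?\<mu> * (exp (?\<mu> * t) * t ^ Suc m) + real (Suc m) * (exp (?\<mu> * t) * t ^ m)" for t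
    have v2: "classical_solution T v2
      (\<lambda>t. (exp (?\<mu> * t) * t ^ Suc m) *\<^sub>R w + real (Suc m) *\<^sub>R (exp (?\<mu> * t) * t ^ m) *\<^sub>R j (i x))"
    proof (rule classical_solutionI[where S="{}" and v'="\<lambda>t. e' t *\<^sub>R x"])
      show "continuous_on {0..T} v2" unfolding v2_def by (intro continuous_intros)
      show "in_L2 (lebesgue_on {0..T}) (\<lambda>t. (exp (?\<mu> * t) * t ^ Suc m) *\<^sub>R w
          + real (Suc m) *\<^sub>R (exp (?\<mu> * t) * t ^ m) *\<^sub>R j (i x))"
        by (intro in_L2_continuous continuous_intros)
      fix t
      have "((\<lambda>t. exp (?\<mu> * t) * t ^ Suc m) has_real_derivative e' t) (at t)"
        unfolding e'_def by (rule derivative_eq_intros refl | simp add: algebra_simps)+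
      then show "(v2 has_vector_derivative e' t *\<^sub>R x) (at t)"
        unfolding has_real_derivative_iff_has_vector_derivative v2_def[abs_def]
        by (rule bounded_linear.has_vector_derivative[OF bounded_linear_scaleR_left])
      show "j (i (e' t *\<^sub>R x)) = A (v2 t) + ((exp (?\<mu> * t) * t ^ Suc m) *\<^sub>R w
          + real (Suc m) *\<^sub>R (exp (?\<mu> * t) * t ^ m) *\<^sub>R j (i x))"
        unfolding x[symmetric] shift_def v2_def e'_def
        by (simp add: i.add j.add i.scaleR j.scaleR A.scaleR scaleR_diff_right scaleR_add_left mult_ac del: of_nat_Suc)
    qed simp
    have "classical_solution T (\<lambda>t. v2 t + (- real (Suc m)) *\<^sub>R v1 t)
      (\<lambda>t. ((exp (?\<mu> * t) * t ^ Suc m) *\<^sub>R w + real (Suc m) *\<^sub>R (exp (?\<mu> * t) * t ^ m) *\<^sub>R j (i x))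
        + (- real (Suc m)) *\<^sub>R (exp (?\<mu> * t) * t ^ m) *\<^sub>R j (i x))"
      by (rule classical_solution_combine[OF v2 v1])
    then show ?case by (simp only: scaleR_minus_left add.assoc right_minus add_0_right) blast
  qed
  have "\<exists>v. classical_solution T v F"
    using assms
  proof (induction rule: exp_poly.induct)
    case (monomial m w)
    show ?case by (rule mono)
  next
    case (add f g)
    then obtain v w where "classical_solution T v f" "classical_solution T w g" by blast
    from classical_solution_combine[OF this, of 1] show ?case by simp blast
  qed
  then show ?thesis using that by blast
qed

text \<open>The inverse of the generator - shift on V. Initial values of the form K (K c) lie in the
  domain of the square of the generator, which is what gives the Euler scheme a residual of first
  order.\<close>

definition K :: "'v \<Rightarrow> 'v" where
  "K g = (SOME v. shift v = - j (i g))"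

lemma shift_K: "shift (K g) = - j (i g)"
  unfolding K_def by (rule someI_ex[OF shift_surj])

text \<open>One implicit Euler step of size \<open>h\<close> for \<open>z' = - shift z\<close>.\<close>

definition euler_step :: "real \<Rightarrow> 'v \<Rightarrow> 'v" where
  "euler_step h g = (SOME v. j (i v) + h *\<^sub>R shift v = j (i g))"

lemma euler_step:
  assumes "0 < h"
  shows "j (i (euler_step h g)) + h *\<^sub>R shift (euler_step h g) = j (i g)"
proof -
  have "\<exists>v. j (i v) + h *\<^sub>R shift v = j (i g)"
  proof (rule lax_milgram)
    show "bounded_linear (\<lambda>v. j (i v) + h *\<^sub>R shift v)"
      by (intro bounded_linear_add bounded_linear_ji
          bounded_linear_compose[OF bounded_linear_scaleR_right bounded_linear_shift])
    show "0 < h * \<kappa>" using assms \<kappa>_pos by simp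
    fix v
    have "dual (j (i v) + h *\<^sub>R shift v) v = (norm (i v))\<^sup>2 + h * dual (shift v) v"
      by (simp add: dual.add_left dual.scaleR_left dual_extends_inner power2_norm_eq_inner)
    moreover have "h * (\<kappa> * (norm v)\<^sup>2) \<le> h * dual (shift v) v"
      using assms shift_coercive by (intro mult_left_mono) auto
    ultimately show "h * \<kappa> * (norm v)\<^sup>2 \<le> dual (j (i v) + h *\<^sub>R shift v) v"
      by (simp add: mult.assoc add_increasing)
  qed
  then show ?thesis unfolding euler_step_def by (rule someI_ex)
qed

text \<open>The step equation is tested with the step itself, and coercivity supplies the sign. This
  bounds all Euler iterates in H independently of the step size.\<close>

lemma euler_step_contraction:
  assumes "0 < h"
  shows "norm (i (euler_step h g)) \<le> norm (i g)"
proof -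
  let ?a = "euler_step h g"
  have "dual (j (i ?a) + h *\<^sub>R shift ?a) ?a = dual (j (i g)) ?a" by (simp add: euler_step[OF assms])
  then have "(norm (i ?a))\<^sup>2 + h * dual (shift ?a) ?a = i g \<bullet> i ?a"
    by (simp add: dual.add_left dual.scaleR_left dual_extends_inner power2_norm_eq_inner)
  moreover have "0 \<le> h * dual (shift ?a) ?a"
    using assms \<kappa>_pos order_trans[OF _ shift_coercive[of ?a]] by simp
  ultimately have "(norm (i ?a))\<^sup>2 \<le> norm (i g) * norm (i ?a)"
    using norm_cauchy_schwarz[of "i g" "i ?a"] by linarith
  then have "norm (i ?a) * norm (i ?a) \<le> norm (i g) * norm (i ?a)" by (simp add: power2_eq_square)
  then show ?thesis by (cases "i ?a = 0") auto
qed

text \<open>The increments of the scheme become exact: for iterates c n, those of K (c n) are h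
  times c (n+1), and those of K (K (c n)) are h times K (c (n+1)).\<close>

lemma K_euler_step:
  assumes "0 < h"
  shows "K (euler_step h g) - K g = h *\<^sub>R euler_step h g"
proof (rule shift_inj)
  show "shift (K (euler_step h g) - K g) = shift (h *\<^sub>R euler_step h g)"
    using euler_step[OF assms, of g] by (simp add: shift.diff shift.scaleR shift_K algebra_simps)
qed

lemma K_diff: "K (a - b) = K a - K b" and K_scaleR: "K (c *\<^sub>R a) = c *\<^sub>R K a"
  by (rule shift_inj, simp add: shift.diff shift.scaleR shift_K i.diff j.diff i.scaleR j.scaleR)+

lemma norm_i_K_le: "norm (i (K g)) \<le> (onorm i)\<^sup>2 / \<kappa> * norm (i g)"
proof -
  have 1: "\<kappa> * (norm (K g))\<^sup>2 \<le> norm (i g) * (onorm i * norm (K g))"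
  proof -
    have "\<kappa> * (norm (K g))\<^sup>2 \<le> dual (shift (K g)) (K g)" by (rule shift_coercive)
    also have "\<dots> = - (i g \<bullet> i (K g))" by (simp add: shift_K dual.minus_left dual_extends_inner)
    also have "\<dots> \<le> norm (i g) * norm (i (K g))"
      using Cauchy_Schwarz_ineq2[of "i g" "i (K g)"] by linarith
    also have "\<dots> \<le> norm (i g) * (onorm i * norm (K g))" by (intro mult_left_mono i_norm_le) simp
    finally show ?thesis .
  qed
  have "norm (K g) \<le> onorm i / \<kappa> * norm (i g)"
  proof (cases "K g = 0")
    case True
    then show ?thesis using \<kappa>_pos onorm_pos_le[OF bounded_linear_i] by simp
  next
    case False
    from 1 have "(\<kappa> * norm (K g)) * norm (K g) \<le> (norm (i g) * onorm i) * norm (K g)"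
      by (simp only: power2_eq_square mult.assoc)
    then have "\<kappa> * norm (K g) \<le> norm (i g) * onorm i" using False by simp
    then show ?thesis using \<kappa>_pos by (simp add: field_simps)
  qed
  then have "onorm i * norm (K g) \<le> onorm i * (onorm i / \<kappa> * norm (i g))"
    using onorm_pos_le[OF bounded_linear_i] by (rule mult_left_mono)
  with i_norm_le[of "K g"] show ?thesis by (simp add: power2_eq_square)
qed

text \<open>An Euler step a started at v lies in the range of K, being K ((a - v) / h), and it
  approaches v in H as h tends to 0: testing the defect d = a - v with itself bounds its squared
  H-norm by h (b |d| - \<kappa> |d|^2) \<le> h b^2 / (4 \<kappa>).\<close>

lemma range_K_dense:
  assumes "0 < \<epsilon>"
  obtains g where "norm (i v - i (K g)) < \<epsilon>"
proof -
  obtain B where B: "0 < B" "\<And>w v. norm (dual w v) \<le> norm w * norm v * B"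
    using dual.pos_bounded by blast
  define b where "b = B * norm (shift v)"
  have b: "0 \<le> b" using B(1) by (simp add: b_def)
  \<comment> \<open>Chosen so that h b^2 / (4 \<kappa>) \<le> \<epsilon>^2 / 2; the added 1 admits b
    = 0.\<close>
  define h where "h = 4 * \<kappa> * \<epsilon>\<^sup>2 / (b\<^sup>2 + 1) / 2"
  have h: "0 < h" using assms \<kappa>_pos b by (simp add: h_def add_nonneg_pos)
  let ?a = "euler_step h v"
  let ?d = "?a - v"
  have eq: "j (i ?d) = - (h *\<^sub>R shift ?a)"
    using euler_step[OF h, of v] by (simp add: i.diff j.diff algebra_simps)
  have "(norm (i ?d))\<^sup>2 = dual (j (i ?d)) ?d" by (simp add: dual_extends_inner power2_norm_eq_inner)
  also have "\<dots> = - (h * dual (shift ?d) ?d) - h * dual (shift v) ?d"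
    unfolding eq by (simp add: dual.minus_left dual.scaleR_left shift.diff dual.diff_left algebra_simps)
  also have "\<dots> \<le> - (h * (\<kappa> * (norm ?d)\<^sup>2)) + h * (b * norm ?d)"
  proof -
    have "h * (\<kappa> * (norm ?d)\<^sup>2) \<le> h * dual (shift ?d) ?d"
      using h shift_coercive by (intro mult_left_mono) auto
    moreover have "h * (- dual (shift v) ?d) \<le> h * (b * norm ?d)"
      using B(2)[of "shift v" ?d] h by (intro mult_left_mono) (auto simp: b_def mult_ac)
    ultimately show ?thesis by simp
  qed
  also have "\<dots> \<le> h * (b\<^sup>2 / (4 * \<kappa>))"
  proof -
    have "0 \<le> (2 * \<kappa> * norm ?d - b)\<^sup>2" by simp
    then have "b * norm ?d - \<kappa> * (norm ?d)\<^sup>2 \<le> b\<^sup>2 / (4 * \<kappa>)"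
      using \<kappa>_pos by (simp add: field_simps power2_eq_square)
    from mult_left_mono[OF this, of h] show ?thesis using h by (simp add: algebra_simps)
  qed
  also have "\<dots> < \<epsilon>\<^sup>2"
  proof -
    have "h * (b\<^sup>2 / (4 * \<kappa>)) = (\<epsilon>\<^sup>2 / 2) * (b\<^sup>2 / (b\<^sup>2 + 1))"
      using \<kappa>_pos by (simp add: h_def)
    also have "\<dots> \<le> \<epsilon>\<^sup>2 / 2 * 1"
    proof (rule mult_left_mono)
      have "0 < b\<^sup>2 + 1" by (simp add: add_nonneg_pos)
      then show "b\<^sup>2 / (b\<^sup>2 + 1) \<le> 1" by (simp only: pos_divide_le_eq) simp
    qed simp
    finally have "h * (b\<^sup>2 / (4 * \<kappa>)) \<le> \<epsilon>\<^sup>2 / 2 * 1" .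
    moreover have "0 < \<epsilon>\<^sup>2" using assms by simp
    ultimately show ?thesis by linarith
  qed
  finally have "norm (i ?d) < \<epsilon>" using assms by (simp add: power2_less_imp_less)
  moreover have "?a = K ((1 / h) *\<^sub>R ?d)"
  proof (rule shift_inj)
    show "shift ?a = shift (K ((1 / h) *\<^sub>R ?d))"
      using h by (simp add: shift_K i.scaleR j.scaleR eq)
  qed
  ultimately have "norm (i v - i (K ((1 / h) *\<^sub>R ?d))) < \<epsilon>"
    by (simp add: i.diff norm_minus_commute)
  then show ?thesis by (rule that)
qed

text \<open>Three errors of \<epsilon>/3: from H to V by density of the embedding, from V to the
  range of K, and once more below K, where boundedness of K in the H-norm transports the
  approximation.\<close>

lemma range_KK_dense:
  fixes x :: 'h
  assumes "0 < \<epsilon>"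
  obtains c where "norm (x - i (K (K c))) < \<epsilon>"
proof -
  have e: "0 < \<epsilon> / 3" using assms by simp
  have "x \<in> closure (range i)" using dense_i by simp
  then obtain y where "y \<in> range i" "dist y x < \<epsilon> / 3"
    unfolding closure_approachable using e by blast
  then obtain v where v: "norm (x - i v) < \<epsilon> / 3" by (auto simp: dist_norm norm_minus_commute)
  obtain g where g: "norm (i v - i (K g)) < \<epsilon> / 3" using range_K_dense[OF e] by blast
  let ?C = "(onorm i)\<^sup>2 / \<kappa> + 1"
  have C: "0 < ?C" using \<kappa>_pos by (simp add: add_nonneg_pos)
  obtain c where c: "norm (i g - i (K c)) < \<epsilon> / 3 / ?C"
    using range_K_dense[of "\<epsilon> / 3 / ?C" g] e C by auto
  have "norm (i (K g) - i (K (K c))) \<le> (onorm i)\<^sup>2 / \<kappa> * norm (i g - i (K c))"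
    using norm_i_K_le[of "g - K c"] by (simp add: K_diff i.diff)
  also have "\<dots> \<le> ?C * norm (i g - i (K c))" by (intro mult_right_mono) auto
  also have "\<dots> < \<epsilon> / 3" using c C by (simp add: field_simps)
  finally have "norm (i (K g) - i (K (K c))) < \<epsilon> / 3" .
  moreover have "x - i (K (K c)) = (x - i v) + (i v - i (K g)) + (i (K g) - i (K (K c)))" by simp
  then have "norm (x - i (K (K c))) \<le> norm (x - i v) + norm (i v - i (K g)) + norm (i (K g) - i (K (K c)))"
    using norm_triangle_ineq[of "(x - i v) + (i v - i (K g))" "i (K g) - i (K (K c))"]
      norm_triangle_ineq[of "x - i v" "i v - i (K g)"] by simp
  ultimately have "norm (x - i (K (K c))) < \<epsilon>" using v g by linarith
  then show ?thesis by (rule that)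
qed

end

section \<open>Interpolated Euler scheme and superposition\<close>

context coercive_evolution
begin

text \<open>In cell m the interpolant starts at a m with slope d m, and \<open>K_euler_step\<close>
  yields z' + shift z = (h - (s - m h)) j (i (c (m+1))) exactly. Since the iterates c n stay bounded
  in H, this residual is of order h. The factor e^(|\<open>C\<^sub>A\<close>| t) converts shift back
  into A.\<close>

lemma homogeneous_approx:
  assumes T: "0 < T" and "0 < \<epsilon>"
  obtains v G where "classical_solution T v G" "norm (i (v 0) - x) < \<epsilon>"
    "(\<integral>s. (norm (G s))\<^sup>2 \<partial>lebesgue_on {0..T}) < \<epsilon>"
proof -
  let ?\<mu> = "\<bar>C\<^sub>A\<bar>"
  obtain g where g: "norm (x - i (K (K g))) < \<epsilon>" using range_KK_dense[OF \<open>0 < \<epsilon>\<close>] by blast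
  \<comment> \<open>B h will bound the norm of the residual: B collects the growth of the
    exponential, the norm of j and the common H-bound of the iterates.\<close>
  define B where "B = exp (?\<mu> * T) * (onorm j * norm (i g))"
  have B: "0 \<le> B" unfolding B_def by (intro mult_nonneg_nonneg onorm_pos_le bounded_linear_j) auto
  \<comment> \<open>The squared L2 norm of the residual is at most (B h)^2 T = B^2 T T^2 / N^2, and
    N^2 is estimated below by N.\<close>
  obtain N where N: "B\<^sup>2 * T * T\<^sup>2 / \<epsilon> < real N" "0 < N"
    using reals_Archimedean2[of "max 0 (B\<^sup>2 * T * T\<^sup>2 / \<epsilon>)"] by auto
  define h where "h = T / real N"
  have h: "0 < h" "real N * h = T" using T N by (simp_all add: h_def)
  define c where "c n = (euler_step h ^^ n) g" for n
  have c_Suc: "c (Suc n) = euler_step h (c n)" for n by (simp add: c_def)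
  have c_le: "norm (i (c n)) \<le> norm (i g)" for n
  proof (induction n)
    case (Suc n)
    then show ?case using euler_step_contraction[OF h(1), of "c n"] by (simp add: c_Suc)
  qed (simp add: c_def)
  define a where "a n = K (K (c n))" for n
  define d where "d n = K (c (Suc n))" for n
  have a_Suc: "a (Suc n) = a n + h *\<^sub>R d n" for n
    using K_euler_step[OF h(1), of "c n"]
    by (simp add: a_def d_def c_Suc K_diff[symmetric] K_scaleR[symmetric] flip: diff_eq_eq)
      (simp add: K_diff K_scaleR algebra_simps)
  have a_sum: "a m = K (K g) + (\<Sum>n<m. h *\<^sub>R d n)" for m
    by (induction m) (simp_all add: a_Suc, simp add: a_def c_def)
  \<comment> \<open>\<open>clamp n t\<close> is the time spent in cell n up to t, which presents the
    interpolant as one finite sum of continuous functions. Below, \<open>\<phi> n t\<close> is the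
    time left in cell n; the cells are half-open so that at most one term is active.\<close>
  define clamp where "clamp n t = max 0 (min h (t - real n * h))" for n :: nat and t
  define z where "z t = K (K g) + (\<Sum>n<N. clamp n t *\<^sub>R d n)" for t
  define \<phi> where "\<phi> n t = (if real n * h \<le> t \<and> t < real (Suc n) * h then h - (t - real n * h) else 0)"
    for n :: nat and t
  define G where "G t = exp (?\<mu> * t) *\<^sub>R (\<Sum>n<N. \<phi> n t *\<^sub>R j (i (c (Suc n))))" for t
  define S where "S = (\<lambda>n. real n * h) ` {..N}"
  have cell: "z s = a m + (s - real m * h) *\<^sub>R d m" "\<And>w. (\<Sum>n<N. \<phi> n s *\<^sub>R (w n :: 'w)) = (h - (s - real m * h)) *\<^sub>R w m"
    if m: "m < N" "real m * h \<le> s" "s < real (Suc m) * h" for s m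
  proof -
    have lt: "real (Suc n) * h \<le> s" if "n < m" for n
    proof -
      have "real (Suc n) * h \<le> real m * h" using that h by (intro mult_right_mono) auto
      with m show ?thesis by linarith
    qed
    have gt: "s < real n * h" if "m < n" for n
    proof -
      have "real (Suc m) * h \<le> real n * h" using that h by (intro mult_right_mono) auto
      with m show ?thesis by linarith
    qed
    have Suc_h: "real (Suc n) * h = real n * h + h" for n by (simp add: algebra_simps)
    have c1: "clamp n s = h" if "n < m" for n
      using lt[OF that] h unfolding clamp_def Suc_h by simp
    have c2: "clamp n s = 0" if "m < n" for n
      using gt[OF that] h unfolding clamp_def by simp
    have c3: "clamp m s = s - real m * h"
      using m h unfolding clamp_def Suc_h by simp
    have split: "{..<N} = {..<m} \<union> {m} \<union> {Suc m..<N}" using m(1) by auto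
    have "(\<Sum>n<N. clamp n s *\<^sub>R d n)
        = (\<Sum>n<m. clamp n s *\<^sub>R d n) + clamp m s *\<^sub>R d m + (\<Sum>n\<in>{Suc m..<N}. clamp n s *\<^sub>R d n)"
      unfolding split by (subst sum.union_disjoint; force?)+
    also have "\<dots> = (\<Sum>n<m. h *\<^sub>R d n) + (s - real m * h) *\<^sub>R d m"
      by (simp add: c1 c2 c3)
    finally show "z s = a m + (s - real m * h) *\<^sub>R d m"
      by (simp add: z_def a_sum)
    fix w :: "nat \<Rightarrow> 'w"
    have p0: "\<phi> n s = 0" if "n \<noteq> m" for n
    proof (cases "n < m")
      case True
      then show ?thesis using lt[OF True] by (simp only: \<phi>_def) simp
    next
      case False
      then show ?thesis using gt[of n] that by (simp only: \<phi>_def) simp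
    qed
    have "(\<Sum>n<N. \<phi> n s *\<^sub>R w n) = (\<Sum>n\<in>{m}. \<phi> n s *\<^sub>R w n)"
      using m(1) by (intro sum.mono_neutral_right) (auto simp: p0)
    also have "\<dots> = (h - (s - real m * h)) *\<^sub>R w m"
      using m by (simp add: \<phi>_def del: of_nat_Suc)
    finally show "(\<Sum>n<N. \<phi> n s *\<^sub>R w n) = (h - (s - real m * h)) *\<^sub>R w m" .
  qed
  have find_cell: "\<exists>m<N. real m * h \<le> t \<and> t < real (Suc m) * h" if "0 \<le> t" "t < T" for t
  proof -
    define m where "m = nat \<lfloor>t / h\<rfloor>"
    have nn: "0 \<le> t / h" using that h by simp
    have m1: "real m \<le> t / h" and m2: "t / h < real (Suc m)"
      using nn unfolding m_def by (auto simp: of_nat_nat) linarith+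
    have e1: "real m * h \<le> t" using m1 h by (simp add: pos_le_divide_eq)
    have e2: "t < real (Suc m) * h" using m2 h by (simp only: pos_divide_less_eq)
    have "real m * h < real N * h" using e1 that h by linarith
    then have "m < N" by (metis h(1) mult_less_cancel_right_pos of_nat_less_iff)
    with e1 e2 show ?thesis by blast
  qed
  have G_L2: "in_L2 (lebesgue_on {0..T}) G"
  proof -
    have phi: "(\<lambda>t. exp (?\<mu> * t) * \<phi> n t) \<in> borel_measurable (lebesgue_on {0..T})" for n
    proof -
      have "(\<lambda>t. exp (?\<mu> * t) * \<phi> n t) \<in> borel_measurable borel" unfolding \<phi>_def by measurable
      then show ?thesis by (intro measurable_restrict_space1) (simp add: measurable_completion)
    qed
    have "in_L2 (lebesgue_on {0..T}) (\<lambda>t. (exp (?\<mu> * t) * \<phi> n t) *\<^sub>R w)" for n and w :: 'w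
    proof (rule lebesgue_on_interval.in_L2_scaled[OF phi])
      show "integrable (lebesgue_on {0..T}) (\<lambda>t. (exp (?\<mu> * t) * \<phi> n t)\<^sup>2)"
      proof (rule Bochner_Integration.integrable_bound)
        show "integrable (lebesgue_on {0..T}) (\<lambda>t. (exp (?\<mu> * t) * h)\<^sup>2)"
          by (intro integrable_lebesgue_on_Icc_continuous continuous_intros)
        show "(\<lambda>t. (exp (?\<mu> * t) * \<phi> n t)\<^sup>2) \<in> borel_measurable (lebesgue_on {0..T})"
          using phi by (rule borel_measurable_power)
        have "\<bar>\<phi> n t\<bar> \<le> h" for t unfolding \<phi>_def using h(1) by (auto simp: algebra_simps)
        then have "(\<phi> n t)\<^sup>2 \<le> h\<^sup>2" for t by (metis abs_ge_zero power2_abs power_mono)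
        then show "AE t in lebesgue_on {0..T}. norm ((exp (?\<mu> * t) * \<phi> n t)\<^sup>2) \<le> norm ((exp (?\<mu> * t) * h)\<^sup>2)"
          by (intro AE_I2) (simp add: power_mult_distrib)
      qed
    qed
    then have "in_L2 (lebesgue_on {0..T}) (\<lambda>t. \<Sum>n<N. (exp (?\<mu> * t) * \<phi> n t) *\<^sub>R j (i (c (Suc n))))"
      by (rule lebesgue_on_interval.in_L2_sum)
    then show ?thesis by (simp add: G_def[abs_def] scaleR_sum_right)
  qed
  define m where "m t = (SOME m. m < N \<and> real m * h \<le> t \<and> t < real (Suc m) * h)" for t
  let ?v' = "\<lambda>t. exp (?\<mu> * t) *\<^sub>R d (m t) + (?\<mu> * exp (?\<mu> * t)) *\<^sub>R z t"
  have sol: "classical_solution T (\<lambda>t. exp (?\<mu> * t) *\<^sub>R z t) G"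
  proof (rule classical_solutionI[where S=S and v'="?v'"])
    show "continuous_on {0..T} (\<lambda>t. exp (?\<mu> * t) *\<^sub>R z t)"
      unfolding z_def clamp_def by (intro continuous_intros)
    show "finite S" by (simp add: S_def)
    fix t assume t: "t \<in> {0<..<T} - S"
    have "\<exists>m. m < N \<and> real m * h \<le> t \<and> t < real (Suc m) * h"
      using t find_cell[of t] by (simp del: of_nat_Suc)
    then have "m t < N \<and> real (m t) * h \<le> t \<and> t < real (Suc (m t)) * h"
      unfolding m_def by (rule someI_ex)
    then have mt: "m t < N" "real (m t) * h \<le> t" "t < real (Suc (m t)) * h" by auto
    have "real (m t) * h \<in> S" using mt(1) by (auto simp: S_def)
    then have "real (m t) * h \<noteq> t" using t by auto
    then have t_in: "t \<in> {real (m t) * h<..<real (Suc (m t)) * h}" using mt by simp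
    have "((\<lambda>s. a (m t) + (s - real (m t) * h) *\<^sub>R d (m t)) has_vector_derivative d (m t)) (at t)"
      by (auto intro!: derivative_eq_intros)
    then have z': "(z has_vector_derivative d (m t)) (at t)"
      by (rule has_vector_derivative_transform_within_open[OF _ open_greaterThanLessThan t_in])
        (use cell(1)[OF mt(1)] in \<open>auto simp del: of_nat_Suc\<close>)
    have "((\<lambda>t. exp (?\<mu> * t)) has_real_derivative (?\<mu> * exp (?\<mu> * t))) (at t)"
      by (auto intro!: derivative_eq_intros)
    from has_vector_derivative_scaleR[OF this z']
    show "((\<lambda>t. exp (?\<mu> * t) *\<^sub>R z t) has_vector_derivative ?v' t) (at t)" .
    let ?s = "t - real (m t) * h"
    have "shift (z t) = - j (i (K (c (m t)))) - ?s *\<^sub>R j (i (c (Suc (m t))))"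
      unfolding cell(1)[OF mt] a_def d_def by (simp add: shift.add shift.scaleR shift_K)
    moreover have "K (c (m t)) = d (m t) - h *\<^sub>R c (Suc (m t))"
      using K_euler_step[OF h(1), of "c (m t)"] by (simp add: d_def c_Suc algebra_simps)
    ultimately have sz: "shift (z t) = - j (i (d (m t))) + (h - ?s) *\<^sub>R j (i (c (Suc (m t))))"
      by (simp add: i.diff j.diff i.scaleR j.scaleR algebra_simps)
    have Az: "A (z t) = ?\<mu> *\<^sub>R j (i (z t)) - shift (z t)" by (simp add: shift_def)
    have Gt: "G t = exp (?\<mu> * t) *\<^sub>R (h - ?s) *\<^sub>R j (i (c (Suc (m t))))"
      unfolding G_def cell(2)[OF mt] by simp
    show "j (i (?v' t)) = A (exp (?\<mu> * t) *\<^sub>R z t) + G t"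
      unfolding A.scaleR Az sz Gt
      by (simp add: i.add j.add i.scaleR j.scaleR scaleR_diff_right scaleR_add_right scaleR_diff_left mult.commute)
  qed (rule G_L2)
  have "(\<integral>s. (norm (G s))\<^sup>2 \<partial>lebesgue_on {0..T}) \<le> (\<integral>s. (B * h)\<^sup>2 \<partial>lebesgue_on {0..T})"
  proof (rule integral_mono[OF in_L2_integrable[OF G_L2]])
    show "integrable (lebesgue_on {0..T}) (\<lambda>s. (B * h)\<^sup>2)" by simp
    fix s assume "s \<in> space (lebesgue_on {0..T})"
    then have s: "0 \<le> s" "s \<le> T" by auto
    have "norm (G s) \<le> B * h"
    proof (cases "s < T")
      case True
      obtain m where m: "m < N" "real m * h \<le> s" "s < real (Suc m) * h"
        using find_cell[OF s(1) True] by blast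
      have "norm (G s) = exp (?\<mu> * s) * (\<bar>h - (s - real m * h)\<bar> * norm (j (i (c (Suc m)))))"
        unfolding G_def cell(2)[OF m] by (simp only: norm_scaleR abs_mult abs_exp_cancel)
      also have "\<dots> \<le> exp (?\<mu> * T) * (h * (onorm j * norm (i g)))"
      proof (intro mult_mono)
        show "exp (?\<mu> * s) \<le> exp (?\<mu> * T)" using s by (simp add: mult_left_mono)
        show "\<bar>h - (s - real m * h)\<bar> \<le> h" using m by (simp add: algebra_simps)
        show "norm (j (i (c (Suc m)))) \<le> onorm j * norm (i g)"
          using onorm[OF bounded_linear_j, of "i (c (Suc m))"] c_le[of "Suc m"]
            onorm_pos_le[OF bounded_linear_j] by (meson mult_left_mono order_trans)
      qed (use h in auto)
      finally show ?thesis by (simp add: B_def mult_ac)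
    next
      \<comment> \<open>At s = T no half-open cell is active, so G vanishes there.\<close>
      case False
      then have "\<phi> n s = 0" if "n < N" for n
      proof -
        have "real (Suc n) * h \<le> real N * h" using that h by (intro mult_right_mono) auto
        then show ?thesis using False h unfolding \<phi>_def by simp
      qed
      then show ?thesis using B h by (simp add: G_def)
    qed
    then show "(norm (G s))\<^sup>2 \<le> (B * h)\<^sup>2" by (rule power_mono) simp
  qed
  also have "\<dots> = (B * h)\<^sup>2 * T" using T by (simp add: measure_restrict_space)
  also have "\<dots> = (B\<^sup>2 * T * T\<^sup>2) / (real N)\<^sup>2" by (simp add: h_def power_mult_distrib power_divide)
  also have "\<dots> \<le> (B\<^sup>2 * T * T\<^sup>2) / real N"
  proof (rule divide_left_mono)
    show "real N \<le> (real N)\<^sup>2" using N(2) by (simp add: power2_eq_square)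
  qed (use T N in auto)
  also have "\<dots> < \<epsilon>" using N \<open>0 < \<epsilon>\<close> by (simp add: field_simps)
  finally have small: "(\<integral>s. (norm (G s))\<^sup>2 \<partial>lebesgue_on {0..T}) < \<epsilon>" .
  have "z 0 = K (K g)"
  proof -
    have "clamp n 0 = 0" for n
    proof -
      have "0 \<le> real n * h" using h by simp
      then show ?thesis unfolding clamp_def by (intro max_absorb1) (simp add: min_le_iff_disj)
    qed
    then show ?thesis by (simp add: z_def)
  qed
  then have "norm (i (exp (?\<mu> * 0) *\<^sub>R z 0) - x) < \<epsilon>" using g by (simp add: norm_minus_commute)
  with sol small show ?thesis by (intro that[of "\<lambda>t. exp (?\<mu> * t) *\<^sub>R z t" G])
qed

text \<open>Superposition: p follows an exponential polynomial close to F but starts at an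
  uncontrolled value, and the nearly homogeneous q corrects the start by x - i (p 0).\<close>

lemma classical_approx:
  assumes T: "0 < T" and F: "in_L2 (lebesgue_on {0..T}) F" and "0 < \<epsilon>"
  obtains v G where "classical_solution T v G" "norm (i (v 0) - x) < \<epsilon>"
    "(\<integral>s. (norm (G s - F s))\<^sup>2 \<partial>lebesgue_on {0..T}) < \<epsilon>"
proof -
  let ?L = "lebesgue_on {0..T}"
  obtain E where E: "exp_poly \<bar>C\<^sub>A\<bar> E" "(\<integral>s. (norm (F s - E s))\<^sup>2 \<partial>?L) < \<epsilon> / 4"
    using in_L2_approx_exp_poly[OF F, of "\<epsilon>/4" "\<bar>C\<^sub>A\<bar>"] \<open>0 < \<epsilon>\<close> by auto
  obtain p where p: "classical_solution T p E" using exp_poly_solvable[OF E(1)] by blast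
  obtain q G where q: "classical_solution T q G" "norm (i (q 0) - (x - i (p 0))) < \<epsilon> / 4"
    "(\<integral>s. (norm (G s))\<^sup>2 \<partial>?L) < \<epsilon> / 4"
    using homogeneous_approx[OF T, of "\<epsilon>/4" "x - i (p 0)"] \<open>0 < \<epsilon>\<close> by auto
  have sol: "classical_solution T (\<lambda>t. p t + q t) (\<lambda>t. E t + G t)"
    using classical_solution_combine[OF p q(1), of 1] by simp
  have EL: "in_L2 ?L E" and GL: "in_L2 ?L G"
    using p q(1) unfolding classical_solution_def by auto
  have i1: "integrable ?L (\<lambda>s. (norm (F s - E s))\<^sup>2)" and i2: "integrable ?L (\<lambda>s. (norm (G s))\<^sup>2)"
    by (intro in_L2_integrable lebesgue_on_interval.in_L2_diff F EL GL)+
  have "(\<integral>s. (norm (E s + G s - F s))\<^sup>2 \<partial>?L) \<le> (\<integral>s. 2 * (norm (F s - E s))\<^sup>2 + 2 * (norm (G s))\<^sup>2 \<partial>?L)"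
  proof (rule integral_mono)
    show "integrable ?L (\<lambda>s. (norm (E s + G s - F s))\<^sup>2)"
      by (intro in_L2_integrable lebesgue_on_interval.in_L2_diff lebesgue_on_interval.in_L2_add F EL GL)
    show "integrable ?L (\<lambda>s. 2 * (norm (F s - E s))\<^sup>2 + 2 * (norm (G s))\<^sup>2)"
      using i1 i2 by simp
    fix s
    show "(norm (E s + G s - F s))\<^sup>2 \<le> 2 * (norm (F s - E s))\<^sup>2 + 2 * (norm (G s))\<^sup>2"
      using power2_norm_diff_le[of "G s" "F s - E s"] by (simp add: algebra_simps)
  qed
  also have "\<dots> < \<epsilon>" using i1 i2 E(2) q(3) by simp
  finally have "(\<integral>s. (norm (E s + G s - F s))\<^sup>2 \<partial>?L) < \<epsilon>" .
  moreover have "norm (i (p 0 + q 0) - x) < \<epsilon>"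
    using q(2) \<open>0 < \<epsilon>\<close> by (simp add: i.add algebra_simps)
  ultimately show ?thesis using sol by (intro that)
qed

end

subsection \<open>The deterministic evolution equation\<close>

text \<open>The factor 1 + \<delta>, in place of the usual 2, can be sent to 1, so that limits
  preserve the constants of an estimate.\<close>

lemma power2_norm_diff_weighted:
  fixes a b c :: "'b::real_normed_vector"
  assumes "0 < \<delta>"
  shows "(norm (a - c))\<^sup>2 \<le> (1 + \<delta>) * (norm (b - c))\<^sup>2 + (1 + 1 / \<delta>) * (norm (a - b))\<^sup>2"
proof -
  let ?x = "norm (a - b)" and ?y = "norm (b - c)"
  have "norm (a - c) \<le> ?x + ?y" using norm_triangle_ineq[of "a - b" "b - c"] by simp
  then have "(norm (a - c))\<^sup>2 \<le> (?x + ?y)\<^sup>2" by (intro power_mono) auto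
  also have "\<dots> \<le> (1 + \<delta>) * ?y\<^sup>2 + (1 + 1 / \<delta>) * ?x\<^sup>2"
  proof -
    have "0 \<le> (?x - \<delta> * ?y)\<^sup>2" by simp
    then have "2 * ?x * ?y \<le> \<delta> * ?y\<^sup>2 + ?x\<^sup>2 / \<delta>"
      using assms by (simp add: power2_diff field_simps power2_eq_square)
    then show ?thesis by (simp add: power2_sum algebra_simps)
  qed
  finally show ?thesis .
qed

context coercive_evolution
begin

definition evolution_solution :: "real \<Rightarrow> (real \<Rightarrow> 'w) \<Rightarrow> 'h \<Rightarrow> (real \<Rightarrow> 'h) \<Rightarrow> (real \<Rightarrow> 'v) \<Rightarrow> bool" where
  "evolution_solution T F x u v \<longleftrightarrow> continuous_on {0..T} u \<and> in_L2 (lebesgue_on {0..T}) v \<and>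
     (AE s in lebesgue_on {0..T}. i (v s) = u s) \<and>
     (\<forall>t\<in>{0..T}. ((\<lambda>s. A (v s) + F s) has_integral (j (u t) - j x)) {0..t})"

text \<open>Approximants with convergent data form a Cauchy sequence uniformly in H and in
  L2(0,T;V), by the energy bound for their differences. The energy inequality is carried along from
  them for arbitrary h and \<nu>, because these are chosen only later, coefficient by
  coefficient.\<close>

lemma evolution_solution_exists:
  assumes T: "0 < T" and F: "in_L2 (lebesgue_on {0..T}) F"
  obtains u v where "evolution_solution T F x u v"
    "\<And>h \<nu> t. continuous_on {0..T} h \<Longrightarrow> 0 < \<nu> \<Longrightarrow> t \<in> {0..T} \<Longrightarrow>
       exp (- (2 * \<bar>C\<^sub>A\<bar> + \<nu>) * t) * (norm (u t))\<^sup>2 \<le> (norm x)\<^sup>2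
         + integral {0..t} (\<lambda>s. exp (- (2 * \<bar>C\<^sub>A\<bar> + \<nu>) * s) * (norm (h s))\<^sup>2) / \<nu>
         + D\<^sup>2 / \<kappa> * integral {0..t} (\<lambda>s. exp (- (2 * \<bar>C\<^sub>A\<bar> + \<nu>) * s) * (norm (F s - j (h s)))\<^sup>2)"
proof -
  let ?L = "lebesgue_on {0..T}"
  have T0: "0 \<le> T" using T by simp
  define Q where "Q n p \<longleftrightarrow> classical_solution T (fst p) (snd p) \<and>
      norm (i (fst p 0) - x) < inverse (real (Suc n)) \<and>
      (\<integral>s. (norm (snd p s - F s))\<^sup>2 \<partial>?L) < inverse (real (Suc n))" for n p
  have "\<exists>p. Q n p" for n
  proof -
    have "0 < inverse (real (Suc n))" by simp
    then obtain v G where "classical_solution T v G" "norm (i (v 0) - x) < inverse (real (Suc n))"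
      "(\<integral>s. (norm (G s - F s))\<^sup>2 \<partial>?L) < inverse (real (Suc n))"
      by (rule classical_approx[OF T F])
    then have "Q n (v, G)" unfolding Q_def fst_conv snd_conv by (intro conjI)
    then show ?thesis ..
  qed
  then obtain P where P: "\<And>n. Q n (P n)" by metis
  define V G where "V n = fst (P n)" and "G n = snd (P n)" for n
  have sol: "classical_solution T (V n) (G n)"
    and V0: "norm (i (V n 0) - x) < inverse (real (Suc n))"
    and GF: "(\<integral>s. (norm (G n s - F s))\<^sup>2 \<partial>?L) < inverse (real (Suc n))" for n
    using P[of n] unfolding Q_def V_def G_def by blast+
  have Vc: "continuous_on {0..T} (V n)" and GL: "in_L2 ?L (G n)" for n
    using sol[of n] unfolding classical_solution_def by auto
  have VL: "in_L2 ?L (V n)" for n using Vc by (rule in_L2_continuous)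
  have V0_lim: "(\<lambda>n. i (V n 0)) \<longlonglongrightarrow> x"
  proof -
    have "(\<lambda>n. i (V n 0) - x) \<longlonglongrightarrow> 0"
      by (rule Lim_null_comparison[OF _ LIMSEQ_inverse_real_of_nat]) (use V0 in \<open>simp add: less_imp_le\<close>)
    then show ?thesis by (simp add: LIM_zero_iff)
  qed
  have GF_lim: "(\<lambda>n. \<integral>s. (norm (G n s - F s))\<^sup>2 \<partial>?L) \<longlonglongrightarrow> 0"
    by (rule tendsto_sandwich[OF _ _ tendsto_const LIMSEQ_inverse_real_of_nat])
      (use GF in \<open>simp_all add: less_imp_le\<close>)
  \<comment> \<open>Both factors 4 come from the squared triangle inequality, once for the initial
    values and once for the right-hand sides of two approximants.\<close>
  define C where "C = exp ((2 * \<bar>C\<^sub>A\<bar> + 1) * T) * (4 + D\<^sup>2 / \<kappa> * 4)"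
  have C: "0 < C" using \<kappa>_pos by (simp add: C_def add_pos_nonneg)
  define q where "q n = inverse (real (Suc n))" for n
  have q_pos: "0 < q n" "q n \<le> 1" for n by (simp_all add: q_def inverse_le_1_iff)
  have diff: "t \<in> {0..T} \<Longrightarrow> (norm (i (V n t) - i (V m t)))\<^sup>2 \<le> C * max (q n) (q m)"
    "\<kappa> * (\<integral>s. (norm (V n s - V m s))\<^sup>2 \<partial>?L) \<le> C * max (q n) (q m)" for n m t
  proof -
    let ?q = "max (q n) (q m)"
    have s: "classical_solution T (\<lambda>t. V n t - V m t) (\<lambda>t. G n t - G m t)"
      using classical_solution_combine[OF sol[of n] sol[of m], of "-1"] by simp
    have v0: "(norm (i (V k 0) - x))\<^sup>2 \<le> ?q" if "q k \<le> ?q" for k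
    proof -
      have "(norm (i (V k 0) - x))\<^sup>2 \<le> (q k)\<^sup>2"
        using V0[of k] by (intro power_mono) (auto simp: q_def)
      also have "\<dots> \<le> q k" using q_pos[of k] by (simp add: power2_eq_square mult_left_le)
      finally show ?thesis using that by linarith
    qed
    have e0: "(norm (i (V n 0 - V m 0)))\<^sup>2 \<le> 4 * ?q"
      using power2_norm_diff_triangle[of "i (V n 0)" "i (V m 0)" x] v0[of n] v0[of m]
      by (simp add: i.diff norm_minus_commute[of x])
    have e1: "(\<integral>s. (norm (G n s - G m s))\<^sup>2 \<partial>?L) \<le> 4 * ?q"
    proof -
      have I: "integrable ?L (\<lambda>s. (norm (G k s - F s))\<^sup>2)" for k
        by (intro in_L2_integrable lebesgue_on_interval.in_L2_diff F GL)
      have "(\<integral>s. (norm (G n s - G m s))\<^sup>2 \<partial>?L)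
          \<le> (\<integral>s. 2 * (norm (G n s - F s))\<^sup>2 + 2 * (norm (G m s - F s))\<^sup>2 \<partial>?L)"
      proof (rule integral_mono)
        show "integrable ?L (\<lambda>s. (norm (G n s - G m s))\<^sup>2)"
          by (intro in_L2_integrable lebesgue_on_interval.in_L2_diff GL)
        show "integrable ?L (\<lambda>s. 2 * (norm (G n s - F s))\<^sup>2 + 2 * (norm (G m s - F s))\<^sup>2)"
          using I by simp
        show "(norm (G n s - G m s))\<^sup>2 \<le> 2 * (norm (G n s - F s))\<^sup>2 + 2 * (norm (G m s - F s))\<^sup>2" for s
          using power2_norm_diff_triangle[of "G n s" "G m s" "F s"] by (simp add: norm_minus_commute[of "F s"])
      qed
      also have "\<dots> = 2 * (\<integral>s. (norm (G n s - F s))\<^sup>2 \<partial>?L) + 2 * (\<integral>s. (norm (G m s - F s))\<^sup>2 \<partial>?L)"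
        using I by simp
      also have "\<dots> \<le> 4 * ?q" using GF[of n] GF[of m] unfolding q_def[symmetric] by linarith
      finally show ?thesis .
    qed
    have "exp ((2 * \<bar>C\<^sub>A\<bar> + 1) * T) * ((norm (i (V n 0 - V m 0)))\<^sup>2
          + D\<^sup>2 / \<kappa> * (\<integral>s. (norm (G n s - G m s))\<^sup>2 \<partial>?L))
        \<le> exp ((2 * \<bar>C\<^sub>A\<bar> + 1) * T) * (4 * ?q + D\<^sup>2 / \<kappa> * (4 * ?q))"
      using \<kappa>_pos by (intro mult_left_mono add_mono e0 e1) auto
    also have "\<dots> = C * ?q" by (simp only: C_def distrib_right mult.assoc)
    finally have le: "exp ((2 * \<bar>C\<^sub>A\<bar> + 1) * T) * ((norm (i (V n 0 - V m 0)))\<^sup>2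
          + D\<^sup>2 / \<kappa> * (\<integral>s. (norm (G n s - G m s))\<^sup>2 \<partial>?L)) \<le> C * ?q" .
    show "t \<in> {0..T} \<Longrightarrow> (norm (i (V n t) - i (V m t)))\<^sup>2 \<le> C * ?q"
      using order_trans[OF classical_solution_bound(1)[OF s T0] le] by (simp add: i.diff)
    show "\<kappa> * (\<integral>s. (norm (V n s - V m s))\<^sup>2 \<partial>?L) \<le> C * ?q"
      by (rule order_trans[OF classical_solution_bound(2)[OF s T0] le])
  qed
  have small: "\<exists>N. \<forall>n\<ge>N. \<forall>m\<ge>N. C * max (q n) (q m) < e" if e: "0 < e" for e
  proof -
    obtain N where N: "inverse (real (Suc N)) < e / C"
      using reals_Archimedean[of "e / C"] e C by auto
    have le: "q n \<le> q N" if "n \<ge> N" for n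
      unfolding q_def using that by (intro le_imp_inverse_le) auto
    show ?thesis
    proof (intro exI[of _ N] allI impI)
      fix n m assume "n \<ge> N" "m \<ge> N"
      then have "max (q n) (q m) \<le> q N" using le by simp
      then have "C * max (q n) (q m) \<le> C * q N" using C by (intro mult_left_mono) auto
      also have "\<dots> < e" using N C unfolding q_def by (simp only: pos_less_divide_eq mult.commute)
      finally show "C * max (q n) (q m) < e" .
    qed
  qed
  have "uniformly_Cauchy_on {0..T} (\<lambda>n t. i (V n t))"
    unfolding uniformly_Cauchy_on_def
  proof (intro allI impI)
    fix e :: real assume e: "0 < e"
    then obtain N where N: "\<And>n m. n \<ge> N \<Longrightarrow> m \<ge> N \<Longrightarrow> C * max (q n) (q m) < e\<^sup>2"
      using small[of "e\<^sup>2"] by auto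
    show "\<exists>M. \<forall>t\<in>{0..T}. \<forall>m\<ge>M. \<forall>n\<ge>M. dist (i (V m t)) (i (V n t)) < e"
    proof (intro exI[of _ N] ballI allI impI)
      fix t m n assume "t \<in> {0..T}" "m \<ge> N" "n \<ge> N"
      then have "(norm (i (V m t) - i (V n t)))\<^sup>2 < e\<^sup>2"
        using diff(1)[of t m n] N[of m n] by linarith
      then show "dist (i (V m t)) (i (V n t)) < e"
        using e by (simp add: dist_norm power2_less_imp_less)
    qed
  qed
  then have "uniformly_convergent_on {0..T} (\<lambda>n t. i (V n t))" by (rule Cauchy_uniformly_convergent)
  then obtain u where u: "uniform_limit {0..T} (\<lambda>n t. i (V n t)) u sequentially"
    unfolding uniformly_convergent_on_def by blast
  have u_cont: "continuous_on {0..T} u"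
    by (rule uniform_limit_theorem[OF _ u])
      (auto intro!: always_eventually i.continuous_on Vc)
  have u_lim: "(\<lambda>n. i (V n t)) \<longlonglongrightarrow> u t" if "t \<in> {0..T}" for t
    using u that by (rule tendsto_uniform_limitI)
  have Cau: "\<exists>N. \<forall>n\<ge>N. \<forall>m\<ge>N. (\<integral>s. (norm (V n s - V m s))\<^sup>2 \<partial>?L) < e" if e: "0 < e" for e
  proof -
    obtain N where N: "\<And>n m. n \<ge> N \<Longrightarrow> m \<ge> N \<Longrightarrow> C * max (q n) (q m) < \<kappa> * e"
      using small[of "\<kappa> * e"] e \<kappa>_pos by auto
    have "(\<integral>s. (norm (V n s - V m s))\<^sup>2 \<partial>?L) < e" if "n \<ge> N" "m \<ge> N" for n m
      using order_le_less_trans[OF diff(2) N[OF that]] \<kappa>_pos by simp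
    then show ?thesis by blast
  qed
  obtain v r where v: "in_L2 ?L v" and r: "strict_mono (r :: nat \<Rightarrow> nat)"
    and v_AE: "AE s in ?L. (\<lambda>n. V (r n) s) \<longlonglongrightarrow> v s"
    and v_lim: "(\<lambda>n. \<integral>s. (norm (V n s - v s))\<^sup>2 \<partial>?L) \<longlonglongrightarrow> 0"
    using lebesgue_on_interval.L2_complete[OF VL Cau] by blast
  have "AE s in ?L. s \<in> {0..T}" using AE_space[of ?L] by simp
  \<comment> \<open>The uniform limit in H and the L2 limit in V are identified along the almost
    everywhere convergent subsequence.\<close>
  with v_AE have iv: "AE s in ?L. i (v s) = u s"
  proof eventually_elim
    case (elim s)
    have "(\<lambda>n. i (V (r n) s)) \<longlonglongrightarrow> i (v s)" by (rule i.tendsto[OF elim(1)])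
    moreover have "(\<lambda>n. i (V (r n) s)) \<longlonglongrightarrow> u s"
      using LIMSEQ_subseq_LIMSEQ[OF u_lim[OF elim(2)] r] by (simp add: o_def)
    ultimately show ?case by (rule LIMSEQ_unique)
  qed
  have AvF: "in_L2 ?L (\<lambda>s. A (v s) + F s)" "in_L2 ?L (\<lambda>s. A (V n s) + G n s)" for n
    by (intro lebesgue_on_interval.in_L2_add lebesgue_on_interval.in_L2_bounded_linear[OF bounded_linear_A] v F VL GL)+
  have AvF_lim: "(\<lambda>n. \<integral>s. (norm ((A (V n s) + G n s) - (A (v s) + F s)))\<^sup>2 \<partial>?L) \<longlonglongrightarrow> 0"
  proof (rule tendsto_sandwich[OF _ _ tendsto_const])
    have i1: "integrable ?L (\<lambda>s. (norm (V n s - v s))\<^sup>2)" and i2: "integrable ?L (\<lambda>s. (norm (G n s - F s))\<^sup>2)" for n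
      by (intro in_L2_integrable lebesgue_on_interval.in_L2_diff VL v GL F)+
    have "(\<integral>s. (norm ((A (V n s) + G n s) - (A (v s) + F s)))\<^sup>2 \<partial>?L)
        \<le> (\<integral>s. 2 * ((onorm A)\<^sup>2 * (norm (V n s - v s))\<^sup>2) + 2 * (norm (G n s - F s))\<^sup>2 \<partial>?L)" for n
    proof (rule integral_mono)
      show "integrable ?L (\<lambda>s. (norm ((A (V n s) + G n s) - (A (v s) + F s)))\<^sup>2)"
        by (intro in_L2_integrable lebesgue_on_interval.in_L2_diff AvF)
      show "integrable ?L (\<lambda>s. 2 * ((onorm A)\<^sup>2 * (norm (V n s - v s))\<^sup>2) + 2 * (norm (G n s - F s))\<^sup>2)"
        using i1 i2 by simp
      fix s
      have le: "(norm (A (V n s - v s)))\<^sup>2 \<le> (onorm A * norm (V n s - v s))\<^sup>2"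
        by (intro power_mono onorm bounded_linear_A) simp
      have split: "(A (V n s) + G n s) - (A (v s) + F s) = A (V n s - v s) + (G n s - F s)"
        by (simp add: A.diff)
      show "(norm ((A (V n s) + G n s) - (A (v s) + F s)))\<^sup>2
          \<le> 2 * ((onorm A)\<^sup>2 * (norm (V n s - v s))\<^sup>2) + 2 * (norm (G n s - F s))\<^sup>2"
        using power2_norm_add_le[of "A (V n s - v s)" "G n s - F s"] le
        unfolding split power_mult_distrib by linarith
    qed
    then have "(\<integral>s. (norm ((A (V n s) + G n s) - (A (v s) + F s)))\<^sup>2 \<partial>?L)
        \<le> 2 * ((onorm A)\<^sup>2 * (\<integral>s. (norm (V n s - v s))\<^sup>2 \<partial>?L)) + 2 * (\<integral>s. (norm (G n s - F s))\<^sup>2 \<partial>?L)" for n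
      using i1 i2 by simp
    then show "\<forall>\<^sub>F n in sequentially. (\<integral>s. (norm ((A (V n s) + G n s) - (A (v s) + F s)))\<^sup>2 \<partial>?L)
        \<le> 2 * ((onorm A)\<^sup>2 * (\<integral>s. (norm (V n s - v s))\<^sup>2 \<partial>?L)) + 2 * (\<integral>s. (norm (G n s - F s))\<^sup>2 \<partial>?L)"
      by (intro always_eventually allI)
    have "(\<lambda>n. 2 * ((onorm A)\<^sup>2 * (\<integral>s. (norm (V n s - v s))\<^sup>2 \<partial>?L)) + 2 * (\<integral>s. (norm (G n s - F s))\<^sup>2 \<partial>?L))
        \<longlonglongrightarrow> 2 * ((onorm A)\<^sup>2 * 0) + 2 * 0"
      by (intro tendsto_intros v_lim GF_lim)
    then show "(\<lambda>n. 2 * ((onorm A)\<^sup>2 * (\<integral>s. (norm (V n s - v s))\<^sup>2 \<partial>?L)) + 2 * (\<integral>s. (norm (G n s - F s))\<^sup>2 \<partial>?L))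
        \<longlonglongrightarrow> 0" by simp
  qed simp
  have eq: "((\<lambda>s. A (v s) + F s) has_integral (j (u t) - j x)) {0..t}" if t: "t \<in> {0..T}" for t
  proof -
    have "(\<lambda>n. integral {0..t} (\<lambda>s. A (V n s) + G n s)) \<longlonglongrightarrow> integral {0..t} (\<lambda>s. A (v s) + F s)"
      by (rule integral_tendsto_L2[OF AvF(2) AvF(1) AvF_lim t])
    then have "(\<lambda>n. j (i (V n t)) - j (i (V n 0))) \<longlonglongrightarrow> integral {0..t} (\<lambda>s. A (v s) + F s)"
      by (simp add: classical_solution_integral[OF sol t])
    moreover have "(\<lambda>n. j (i (V n t)) - j (i (V n 0))) \<longlonglongrightarrow> j (u t) - j x"
      by (intro tendsto_diff j.tendsto u_lim t V0_lim)
    ultimately have "integral {0..t} (\<lambda>s. A (v s) + F s) = j (u t) - j x" by (rule LIMSEQ_unique)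
    then show ?thesis using integrable_integral[OF in_L2_integrable_on[OF AvF(1) t]] by simp
  qed
  have "exp (- (2 * \<bar>C\<^sub>A\<bar> + \<nu>) * t) * (norm (u t))\<^sup>2 \<le> (norm x)\<^sup>2
       + integral {0..t} (\<lambda>s. exp (- (2 * \<bar>C\<^sub>A\<bar> + \<nu>) * s) * (norm (h s))\<^sup>2) / \<nu>
       + D\<^sup>2 / \<kappa> * integral {0..t} (\<lambda>s. exp (- (2 * \<bar>C\<^sub>A\<bar> + \<nu>) * s) * (norm (F s - j (h s)))\<^sup>2)"
    if h: "continuous_on {0..T} h" and \<nu>: "0 < \<nu>" and t: "t \<in> {0..T}" for h \<nu> t
  proof -
    define E where "E s = exp (- (2 * \<bar>C\<^sub>A\<bar> + \<nu>) * s)" for s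
    have E_cont: "continuous_on {0..T} E" unfolding E_def by (intro continuous_intros)
    have E1: "0 \<le> E s" "s \<in> {0..T} \<Longrightarrow> E s \<le> 1" for s
    proof -
      show "0 \<le> E s" by (simp add: E_def)
      assume "s \<in> {0..T}"
      then have "0 \<le> (2 * \<bar>C\<^sub>A\<bar> + \<nu>) * s" using \<nu> by (intro mult_nonneg_nonneg) auto
      then show "E s \<le> 1" unfolding E_def by (simp only: exp_le_one_iff mult_minus_left neg_le_0_iff_le)
    qed
    have jh: "in_L2 ?L (\<lambda>s. j (h s))" by (intro in_L2_continuous j.continuous_on h)
    let ?X = "integral {0..t} (\<lambda>s. E s * (norm (F s - j (h s)))\<^sup>2)"
    let ?H = "integral {0..t} (\<lambda>s. E s * (norm (h s))\<^sup>2) / \<nu>"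
    have IX: "(\<lambda>s. E s * (norm (F s - j (h s)))\<^sup>2) integrable_on {0..t}"
      by (intro weighted_L2_integrable_on[OF _ E_cont t] lebesgue_on_interval.in_L2_diff F jh)
    have IG: "(\<lambda>s. E s * (norm (G n s - j (h s)))\<^sup>2) integrable_on {0..t}" for n
      by (intro weighted_L2_integrable_on[OF _ E_cont t] lebesgue_on_interval.in_L2_diff GL jh)
    have GFL: "in_L2 ?L (\<lambda>s. G n s - F s)" for n by (intro lebesgue_on_interval.in_L2_diff GL F)
    have I1: "(\<lambda>s. (norm (G n s - F s))\<^sup>2) integrable_on {0..t}" if "t \<in> {0..T}" for n t
      using weighted_L2_integrable_on[OF GFL[of n] continuous_on_const[of _ 1] that] by simp
    \<comment> \<open>The energy inequality holds with G n in place of F. Exchanging them costs 1 +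
      \<delta> in front of the desired term and an error that vanishes with n for fixed \<delta>; so
      n goes to infinity first and \<delta> to 0 afterwards.\<close>
    have step: "E t * (norm (i (V n t)))\<^sup>2 \<le> (norm (i (V n 0)))\<^sup>2 + ?H
       + D\<^sup>2 / \<kappa> * ((1 + \<delta>) * ?X + (1 + 1 / \<delta>) * (\<integral>s. (norm (G n s - F s))\<^sup>2 \<partial>?L))"
      if \<delta>: "0 < \<delta>" for n \<delta>
    proof -
      have HI: "((\<lambda>s. (1 + \<delta>) * (E s * (norm (F s - j (h s)))\<^sup>2) + (1 + 1 / \<delta>) * (norm (G n s - F s))\<^sup>2)
          has_integral ((1 + \<delta>) * ?X + (1 + 1 / \<delta>) * integral {0..t} (\<lambda>s. (norm (G n s - F s))\<^sup>2))) {0..t}"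
        by (intro has_integral_add has_integral_mult_right integrable_integral IX I1 t)
      have "integral {0..t} (\<lambda>s. E s * (norm (G n s - j (h s)))\<^sup>2)
        \<le> integral {0..t} (\<lambda>s. (1 + \<delta>) * (E s * (norm (F s - j (h s)))\<^sup>2) + (1 + 1 / \<delta>) * (norm (G n s - F s))\<^sup>2)"
      proof (rule integral_le[OF IG has_integral_integrable[OF HI]])
        fix s assume "s \<in> {0..t}"
        then have s: "s \<in> {0..T}" using t by auto
        have "E s * (norm (G n s - j (h s)))\<^sup>2
            \<le> E s * ((1 + \<delta>) * (norm (F s - j (h s)))\<^sup>2 + (1 + 1 / \<delta>) * (norm (G n s - F s))\<^sup>2)"
          by (intro mult_left_mono power2_norm_diff_weighted \<delta> E1)
        also have "\<dots> = (1 + \<delta>) * (E s * (norm (F s - j (h s)))\<^sup>2) + (1 + 1 / \<delta>) * (E s * (norm (G n s - F s))\<^sup>2)"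
          by (simp only: distrib_left mult.left_commute)
        also have "\<dots> \<le> (1 + \<delta>) * (E s * (norm (F s - j (h s)))\<^sup>2) + (1 + 1 / \<delta>) * (norm (G n s - F s))\<^sup>2"
          using \<delta> E1 s by (intro add_left_mono mult_left_mono mult_left_le_one_le) auto
        finally show "E s * (norm (G n s - j (h s)))\<^sup>2
          \<le> (1 + \<delta>) * (E s * (norm (F s - j (h s)))\<^sup>2) + (1 + 1 / \<delta>) * (norm (G n s - F s))\<^sup>2" .
      qed
      also have "\<dots> = (1 + \<delta>) * ?X + (1 + 1 / \<delta>) * integral {0..t} (\<lambda>s. (norm (G n s - F s))\<^sup>2)"
        by (rule integral_unique[OF HI])
      also have "\<dots> \<le> (1 + \<delta>) * ?X + (1 + 1 / \<delta>) * (\<integral>s. (norm (G n s - F s))\<^sup>2 \<partial>?L)"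
      proof (intro add_left_mono mult_left_mono)
        have "(\<integral>s. (norm (G n s - F s))\<^sup>2 \<partial>?L) = integral {0..T} (\<lambda>s. (norm (G n s - F s))\<^sup>2)"
          by (rule lebesgue_integral_eq_integral[OF in_L2_integrable[OF GFL]]) simp
        then show "integral {0..t} (\<lambda>s. (norm (G n s - F s))\<^sup>2) \<le> (\<integral>s. (norm (G n s - F s))\<^sup>2 \<partial>?L)"
          using t T by (simp only:) (intro integral_subset_le I1; auto)
      qed (use \<delta> in simp)
      finally have "D\<^sup>2 / \<kappa> * integral {0..t} (\<lambda>s. E s * (norm (G n s - j (h s)))\<^sup>2)
          \<le> D\<^sup>2 / \<kappa> * ((1 + \<delta>) * ?X + (1 + 1 / \<delta>) * (\<integral>s. (norm (G n s - F s))\<^sup>2 \<partial>?L))"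
        using \<kappa>_pos by (intro mult_left_mono) auto
      moreover have "0 \<le> \<kappa> * integral {0..t} (\<lambda>s. E s * (norm (V n s))\<^sup>2)"
        using \<kappa>_pos E1 by (intro mult_nonneg_nonneg integral_nonneg weighted_L2_integrable_on[OF VL E_cont t]) auto
      ultimately show ?thesis
        using classical_solution_energy[OF sol[of n] h \<nu> t] unfolding E_def[symmetric] by linarith
    qed
    have lim: "E t * (norm (u t))\<^sup>2 \<le> (norm x)\<^sup>2 + ?H + D\<^sup>2 / \<kappa> * ((1 + \<delta>) * ?X + (1 + 1 / \<delta>) * 0)"
      if \<delta>: "0 < \<delta>" for \<delta>
    proof (rule LIMSEQ_le)
      show "(\<lambda>n. E t * (norm (i (V n t)))\<^sup>2) \<longlonglongrightarrow> E t * (norm (u t))\<^sup>2"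
        by (intro tendsto_intros u_lim t)
      show "(\<lambda>n. (norm (i (V n 0)))\<^sup>2 + ?H
         + D\<^sup>2 / \<kappa> * ((1 + \<delta>) * ?X + (1 + 1 / \<delta>) * (\<integral>s. (norm (G n s - F s))\<^sup>2 \<partial>?L)))
        \<longlonglongrightarrow> (norm x)\<^sup>2 + ?H + D\<^sup>2 / \<kappa> * ((1 + \<delta>) * ?X + (1 + 1 / \<delta>) * 0)"
        by (intro tendsto_add tendsto_mult tendsto_const tendsto_power tendsto_norm V0_lim GF_lim)
      show "\<exists>N. \<forall>n\<ge>N. E t * (norm (i (V n t)))\<^sup>2 \<le> (norm (i (V n 0)))\<^sup>2 + ?H
         + D\<^sup>2 / \<kappa> * ((1 + \<delta>) * ?X + (1 + 1 / \<delta>) * (\<integral>s. (norm (G n s - F s))\<^sup>2 \<partial>?L))"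
        using step[OF \<delta>] by blast
    qed
    have X: "0 \<le> ?X" using E1 by (intro integral_nonneg IX) auto
    have "E t * (norm (u t))\<^sup>2 \<le> (norm x)\<^sup>2 + ?H + D\<^sup>2 / \<kappa> * ?X"
    proof (rule field_le_epsilon)
      fix e :: real assume e: "0 < e"
      define Y where "Y = D\<^sup>2 / \<kappa> * ?X"
      have Y: "0 \<le> Y" using X \<kappa>_pos by (simp add: Y_def)
      have "D\<^sup>2 / \<kappa> * ((1 + \<delta>) * ?X + (1 + 1 / \<delta>) * 0) = Y + \<delta> * Y" for \<delta>
        by (simp add: Y_def algebra_simps)
      then have "E t * (norm (u t))\<^sup>2 \<le> (norm x)\<^sup>2 + ?H + (Y + e / (Y + 1) * Y)"
        using lim[of "e / (Y + 1)"] e Y by simp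
      moreover have "e / (Y + 1) * Y \<le> e" using e Y by (simp add: field_simps)
      ultimately show "E t * (norm (u t))\<^sup>2 \<le> (norm x)\<^sup>2 + ?H + D\<^sup>2 / \<kappa> * ?X + e"
        unfolding Y_def by linarith
    qed
    then show ?thesis unfolding E_def .
  qed
  moreover have "evolution_solution T F x u v"
    unfolding evolution_solution_def using u_cont v iv eq by blast
  ultimately show ?thesis using that by blast
qed

text \<open>Integrating the equation in time turns a difference of solutions into a function that is
  continuously differentiable with values in \<open>H\<close>, for which Gronwall's argument is elementary.\<close>

lemma evolution_solution_zero:
  fixes T :: real
  assumes u: "continuous_on {0..T} u" and v: "in_L2 (lebesgue_on {0..T}) v"
    and iv: "AE s in lebesgue_on {0..T}. i (v s) = u s"
    and eq: "\<And>t. t \<in> {0..T} \<Longrightarrow> ((\<lambda>s. A (v s)) has_integral j (u t)) {0..t}"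
    and t: "t \<in> {0..T}"
  shows "u t = 0"
proof -
  define w where "w t = integral {0..t} v" for t
  define z where "z t = i (w t)" for t
  have v_int: "(v has_integral w t) {0..t}" if "t \<in> {0..T}" for t
    unfolding w_def by (intro integrable_integral in_L2_integrable_on[OF v that])
  \<comment> \<open>A commutes with the integral, so the integrated equation reads A w = j u. As the
    derivative of z = i w is u, the derivative of the squared norm of z is 2
    \<open>dual (A w) w\<close>, to which coercivity applies.\<close>
  have Aw: "A (w t) = j (u t)" if "t \<in> {0..T}" for t
    using has_integral_unique[OF has_integral_linear[OF v_int[OF that] bounded_linear_A, unfolded o_def] eq[OF that]] .
  have z_int: "z t = integral {0..t} u" if t: "t \<in> {0..T}" for t
  proof -
    define N where "N = {s \<in> space (lebesgue_on {0..T}). i (v s) \<noteq> u s}"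
    have "N \<in> null_sets (lebesgue_on {0..T})"
      using iv unfolding N_def lebesgue_on_interval.AE_iff_null_sets .
    then have "negligible N" by (simp add: null_sets_restrict_space negligible_iff_null_sets)
    moreover have "u s = i (v s)" if "s \<in> {0..t} - N" for s
      using that t by (auto simp: N_def)
    ultimately have "(u has_integral z t) {0..t}"
      unfolding z_def
      using has_integral_linear[OF v_int[OF t] bounded_linear_i, unfolded o_def]
      by (rule has_integral_spike)
    then show ?thesis by (simp add: integral_unique)
  qed
  have z_deriv: "(z has_vector_derivative u t) (at t within {0..T})" if t: "t \<in> {0..T}" for t
    by (rule has_vector_derivative_transform[OF t _ integral_has_vector_derivative_inner[OF u t]])
      (simp add: z_int)
  define \<mu> where "\<mu> = 2 * C\<^sub>A"
  define P where "P s = exp (- \<mu> * s) * (z s \<bullet> z s)" for s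
  define P' where "P' s = exp (- \<mu> * s) * (2 * (u s \<bullet> z s) - \<mu> * (z s \<bullet> z s))" for s
  have P_deriv: "(P has_real_derivative P' s) (at s within {0..T})" if s: "s \<in> {0..T}" for s
  proof -
    have 1: "((\<lambda>s. z s \<bullet> z s) has_vector_derivative (z s \<bullet> u s + u s \<bullet> z s)) (at s within {0..T})"
      by (rule bounded_bilinear.has_vector_derivative[OF bounded_bilinear_inner z_deriv[OF s] z_deriv[OF s]])
    have "((\<lambda>s. exp (- \<mu> * s)) has_real_derivative (- \<mu> * exp (- \<mu> * s))) (at s within {0..T})"
      by (auto intro!: derivative_eq_intros)
    from DERIV_mult'[OF this 1[folded has_real_derivative_iff_has_vector_derivative]]
    show ?thesis unfolding P_def[abs_def] P'_def
      by (rule DERIV_cong) (simp add: inner_commute algebra_simps)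
  qed
  have P'_le: "P' s \<le> 0" if s: "s \<in> {0..T}" for s
  proof -
    have "u s \<bullet> z s = dual (A (w s)) (w s)" by (simp add: Aw[OF s] dual_extends_inner z_def)
    also have "\<dots> \<le> C\<^sub>A * (z s \<bullet> z s) - \<kappa> * (norm (w s))\<^sup>2"
      using coercive[of "w s"] by (simp add: z_def power2_norm_eq_inner)
    also have "\<dots> \<le> C\<^sub>A * (z s \<bullet> z s)" using \<kappa>_pos by simp
    finally show ?thesis
      unfolding P'_def \<mu>_def by (intro mult_nonneg_nonpos) auto
  qed
  have z0: "z s = 0" if s: "s \<in> {0..T}" for s
  proof -
    have "P s \<le> P 0"
    proof -
      have "(P' has_integral (P s - P 0)) {0..s}"
      proof (rule fundamental_theorem_of_calculus)
        fix x assume "x \<in> {0..s}"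
        then have "x \<in> {0..T}" using s by auto
        from P_deriv[OF this] show "(P has_vector_derivative P' x) (at x within {0..s})"
          unfolding has_real_derivative_iff_has_vector_derivative
          by (rule has_vector_derivative_within_subset) (use s in auto)
      qed (use s in simp)
      moreover have "((\<lambda>_. 0) has_integral (0::real)) {0..s}" by simp
      moreover have "P' x \<le> 0" if "x \<in> {0..s}" for x using that s by (intro P'_le) auto
      ultimately have "P s - P 0 \<le> 0" by (rule has_integral_le)
      then show ?thesis by simp
    qed
    have "P 0 = 0" by (simp add: P_def z_def w_def i.zero)
    then have "exp (- \<mu> * s) * (z s \<bullet> z s) \<le> 0" using \<open>P s \<le> P 0\<close> by (simp only: P_def)
    then have "z s \<bullet> z s \<le> 0" by (simp only: mult_le_0_iff not_exp_less_zero not_exp_le_zero) simp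
    then have "z s \<bullet> z s = 0" using inner_ge_zero[of "z s"] by linarith
    then show ?thesis by simp
  qed
  have "w t = 0" using z0[OF t] inj_i by (simp add: z_def inj_def i.zero flip: i.zero)
  then have "j (u t) = j 0" using Aw[OF t] by (simp add: A.zero j.zero)
  then show ?thesis using inj_j by (simp add: inj_def)
qed

end

subsection \<open>Hermite polynomials\<close>

text \<open>Differentiating H_n(x) e^(-x^2/2) gives this recursion. Working with formal polynomials
  makes every product integrable against the Gaussian weight and its derivative algebraic.\<close>

fun hermite_poly :: "nat \<Rightarrow> real poly" where
  "hermite_poly 0 = 1"
| "hermite_poly (Suc n) = [:0, 1:] * hermite_poly n - pderiv (hermite_poly n)"

lemma hermite_eq_poly: "hermite n x = poly (hermite_poly n) x"
proof -
  have "(deriv ^^ n) (\<lambda>y. exp (- y\<^sup>2 / 2)) = (\<lambda>x::real. (-1) ^ n * poly (hermite_poly n) x * exp (- x\<^sup>2 / 2))" for n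
  proof (induction n)
    case (Suc n)
    have "deriv (\<lambda>x::real. (-1) ^ n * poly (hermite_poly n) x * exp (- x\<^sup>2 / 2)) x
        = (-1) ^ Suc n * poly (hermite_poly (Suc n)) x * exp (- x\<^sup>2 / 2)" for x
    proof (rule DERIV_imp_deriv)
      show "((\<lambda>x::real. (-1) ^ n * poly (hermite_poly n) x * exp (- x\<^sup>2 / 2)) has_field_derivative
        (-1) ^ Suc n * poly (hermite_poly (Suc n)) x * exp (- x\<^sup>2 / 2)) (at x)"
        by (rule derivative_eq_intros refl poly_DERIV | simp)+ (simp add: algebra_simps power2_eq_square)
    qed
    then show ?case unfolding funpow.simps o_apply Suc.IH by (intro ext)
  qed simp
  then have "hermite n x = ((-1) ^ n * (-1) ^ n) * (exp (x\<^sup>2 / 2) * exp (- x\<^sup>2 / 2)) * poly (hermite_poly n) x"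
    by (simp only: hermite_def mult_ac)
  moreover have "(-1) ^ n * (-1) ^ n = (1::real)" by (simp flip: power_mult_distrib)
  moreover have "exp (x\<^sup>2 / 2) * exp (- x\<^sup>2 / 2) = 1" by (simp flip: exp_add)
  ultimately show ?thesis by (simp only: mult_1_left)
qed

lemma pderiv_hermite_poly_Suc: "pderiv (hermite_poly (Suc n)) = smult (real (Suc n)) (hermite_poly n)"
proof (induction n)
  case (Suc n)
  have "pderiv (hermite_poly (Suc (Suc n))) = hermite_poly (Suc n) + [:0, 1:] * pderiv (hermite_poly (Suc n))
      - pderiv (pderiv (hermite_poly (Suc n)))"
    by (simp only: hermite_poly.simps(2)[of "Suc n"] pderiv_diff pderiv_mult) (simp add: pderiv_pCons)
  also have "\<dots> = hermite_poly (Suc n) + smult (real (Suc n)) ([:0, 1:] * hermite_poly n - pderiv (hermite_poly n))"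
    by (simp only: Suc.IH pderiv_smult mult_smult_right smult_diff_right add_diff_eq)
  also have "[:0, 1:] * hermite_poly n - pderiv (hermite_poly n) = hermite_poly (Suc n)" by simp
  also have "hermite_poly (Suc n) + smult (real (Suc n)) (hermite_poly (Suc n)) = smult (real (Suc (Suc n))) (hermite_poly (Suc n))"
    by (simp only: of_nat_Suc smult_add_left smult_1_left)
  finally show ?case .
qed (simp add: pderiv_pCons)

section \<open>Gaussian integration by parts and orthogonality\<close>

abbreviation std_normal :: "real measure" where
  "std_normal \<equiv> density lborel (\<lambda>x. ennreal (std_normal_density x))"

lemma prob_space_std_normal: "prob_space std_normal"
  by (rule prob_space_normal_density) simp

lemma integrable_std_normal_power: "integrable std_normal (\<lambda>x. x ^ n)"
  by (subst integrable_density) (auto simp: integrable_std_normal_moment)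

lemma integrable_std_normal_poly: "integrable std_normal (\<lambda>x. poly p x)"
  unfolding poly_altdef by (intro Bochner_Integration.integrable_sum integrable_mult_right integrable_std_normal_power)

lemma integral_std_normal_power_rec:
  "(\<integral>x. x ^ Suc (Suc n) \<partial>std_normal) = real (Suc n) * (\<integral>x. x ^ n \<partial>std_normal)"
proof -
  have eq: "(\<integral>x. x ^ m \<partial>std_normal) = (\<integral>x. std_normal_density x * x ^ m \<partial>lborel)" for m
    by (subst integral_density) auto
  show ?thesis
  proof (cases "even n")
    case True
    then obtain k where k: "n = 2 * k" by (rule evenE)
    have "(\<integral>x. x ^ Suc (Suc n) \<partial>std_normal) = fact (2 * Suc k) / (2 ^ Suc k * fact (Suc k))"
      unfolding eq using integral_std_normal_moment_even[of "Suc k"] by (simp add: k)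
    also have "\<dots> = real (Suc n) * (fact (2 * k) / (2 ^ k * fact k))"
    proof -
      have "fact (2 * Suc k) = (2 * real (Suc k)) * (real (Suc n) * fact (2 * k))"
        by (simp add: k algebra_simps)
      moreover have "2 ^ Suc k * fact (Suc k) = (2 * real (Suc k)) * (2 ^ k * fact k)" by simp
      ultimately show ?thesis
        by (simp only: mult_divide_mult_cancel_left times_divide_eq_right) simp
    qed
    finally show ?thesis unfolding eq using integral_std_normal_moment_even[of k] by (simp add: k)
  next
    case False
    then obtain k where k: "n = 2 * k + 1" by (rule oddE)
    show ?thesis
      unfolding eq using integral_std_normal_moment_odd[of k] integral_std_normal_moment_odd[of "Suc k"]
      by (simp add: k)
  qed
qed

text \<open>Integration by parts against the Gaussian weight, read off the moments: on monomials it
  is their recursion, and linearity does the rest.\<close>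

lemma stein_std_normal:
  "(\<integral>x. poly ([:0, 1:] * p) x \<partial>std_normal) = (\<integral>x. poly (pderiv p) x \<partial>std_normal)"
proof -
  have mono: "(\<integral>x. poly ([:0, 1:] * monom c n) x \<partial>std_normal) = (\<integral>x. poly (pderiv (monom c n)) x \<partial>std_normal)" for c n
  proof (cases n)
    case 0
    have "(\<integral>x. x \<partial>std_normal) = 0"
      using integral_std_normal_moment_odd[of 0] by (subst integral_density) auto
    then show ?thesis
      using integrable_std_normal_power[of 1] by (simp add: 0 pderiv_monom poly_monom mult.commute)
  next
    case (Suc m)
    have "(\<lambda>x. poly ([:0, 1:] * monom c n) x) = (\<lambda>x. c * x ^ Suc (Suc m))"
      by (simp add: Suc poly_monom fun_eq_iff)
    moreover have "(\<lambda>x. poly (pderiv (monom c n)) x) = (\<lambda>x. c * (real (Suc m) * x ^ m))"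
      by (simp add: Suc pderiv_monom poly_monom fun_eq_iff algebra_simps)
    ultimately show ?thesis
      using integral_std_normal_power_rec[of m]
      by (simp only: integral_mult_right_zero)
  qed
  have "(\<integral>x. poly ([:0, 1:] * (\<Sum>i\<in>I. monom (c i) (n i))) x \<partial>std_normal)
      = (\<integral>x. poly (pderiv (\<Sum>i\<in>I. monom (c i) (n i))) x \<partial>std_normal)" if "finite I"
    for I :: "nat set" and c n
    using that
  proof induction
    case (insert i I)
    have "(\<integral>x. poly ([:0, 1:] * (\<Sum>i\<in>insert i I. monom (c i) (n i))) x \<partial>std_normal)
        = (\<integral>x. poly ([:0, 1:] * monom (c i) (n i)) x + poly ([:0, 1:] * (\<Sum>i\<in>I. monom (c i) (n i))) x \<partial>std_normal)"
      using insert by (simp add: algebra_simps)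
    also have "\<dots> = (\<integral>x. poly (pderiv (monom (c i) (n i))) x \<partial>std_normal)
        + (\<integral>x. poly (pderiv (\<Sum>i\<in>I. monom (c i) (n i))) x \<partial>std_normal)"
      by (simp only: Bochner_Integration.integral_add integrable_std_normal_poly insert.IH mono)
    also have "\<dots> = (\<integral>x. poly (pderiv (monom (c i) (n i))) x + poly (pderiv (\<Sum>i\<in>I. monom (c i) (n i))) x \<partial>std_normal)"
      by (simp only: Bochner_Integration.integral_add integrable_std_normal_poly)
    finally show ?case using insert by (simp add: pderiv_add)
  qed simp
  from this[of "{..degree p}" "coeff p" "\<lambda>i. i"] show ?thesis
    by (simp only: poly_as_sum_of_monoms finite_atMost)
qed

text \<open>With x H_n - H_n' as the next polynomial, integration by parts moves one degree of the
  first factor into a derivative of the second, so both indices drop together and the factor n + 1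
  appears.\<close>

lemma hermite_orthogonal:
  "(\<integral>x. hermite m x * hermite n x \<partial>std_normal) = (if m = n then fact m else 0)"
proof -
  define E where "E p = (\<integral>x. poly p x \<partial>std_normal)" for p
  have E_diff: "E (p - q) = E p - E q" for p q
    unfolding E_def
    by (subst Bochner_Integration.integral_diff[symmetric, OF integrable_std_normal_poly integrable_std_normal_poly])
      (rule Bochner_Integration.integral_cong, simp_all)
  have E_add: "E (p + q) = E p + E q" for p q
    unfolding E_def
    by (subst Bochner_Integration.integral_add[symmetric, OF integrable_std_normal_poly integrable_std_normal_poly])
      (rule Bochner_Integration.integral_cong, simp_all)
  have step: "E (hermite_poly (Suc n) * q) = E (hermite_poly n * pderiv q)" for n q
  proof -
    have "hermite_poly (Suc n) * q = [:0, 1:] * (hermite_poly n * q) - pderiv (hermite_poly n) * q"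
      by (simp only: hermite_poly.simps left_diff_distrib mult.assoc)
    then have "E (hermite_poly (Suc n) * q) = E (pderiv (hermite_poly n * q)) - E (pderiv (hermite_poly n) * q)"
      using stein_std_normal[of "hermite_poly n * q"] by (simp only: E_diff) (simp only: E_def)
    then show ?thesis by (simp only: pderiv_mult E_add) (simp add: mult.commute)
  qed
  have "E (hermite_poly m * hermite_poly n) = (if m = n then fact m else 0)"
  proof (induction m arbitrary: n)
    case 0
    interpret std: prob_space std_normal by (rule prob_space_std_normal)
    show ?case
    proof (cases n)
      case 0
      then show ?thesis using std.prob_space by (simp add: E_def)
    next
      case (Suc k)
      then show ?thesis using step[of k 1] by (simp add: E_def)
    qed
  next
    case (Suc m)
    show ?case
    proof (cases n)
      case 0
      then show ?thesis using step[of m 1] by (simp add: E_def)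
    next
      case (Suc k)
      have "E (hermite_poly (Suc m) * hermite_poly (Suc k)) = E (smult (real (Suc k)) (hermite_poly m * hermite_poly k))"
        by (simp only: step pderiv_hermite_poly_Suc mult_smult_right)
      also have "\<dots> = real (Suc k) * E (hermite_poly m * hermite_poly k)"
        by (simp add: E_def)
      finally show ?thesis unfolding Suc by (simp add: Suc.IH)
    qed
  qed
  then show ?thesis by (simp add: E_def hermite_eq_poly)
qed

subsection \<open>Moments of Gaussian families\<close>

text \<open>Even powers are nonnegative and control all others. The class is closed under sums and
  products, so polynomials in Gaussian variables need no separate integrability arguments.\<close>

definition all_moments :: "'a measure \<Rightarrow> ('a \<Rightarrow> real) \<Rightarrow> bool" where
  "all_moments M f \<longleftrightarrow> f \<in> borel_measurable M \<and> (\<forall>n. integrable M (\<lambda>x. (f x) ^ (2 * n)))"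

lemma (in prob_space) all_moments_power_integrable:
  assumes "all_moments M f"
  shows "integrable M (\<lambda>x. (f x) ^ n)"
proof (rule Bochner_Integration.integrable_bound)
  have f: "f \<in> borel_measurable M" and i: "integrable M (\<lambda>x. (f x) ^ (2 * n))"
    using assms unfolding all_moments_def by auto
  show "integrable M (\<lambda>x. 1 + (f x) ^ (2 * n))" using i by simp
  show "(\<lambda>x. (f x) ^ n) \<in> borel_measurable M" using f by simp
  show "AE x in M. norm ((f x) ^ n) \<le> norm (1 + (f x) ^ (2 * n))"
  proof (rule AE_I2)
    fix x
    have "\<bar>f x ^ n\<bar> \<le> 1 + (f x ^ n)\<^sup>2"
      using zero_le_power2[of "\<bar>f x ^ n\<bar> - 1"] by (simp add: power2_diff)
    then show "norm ((f x) ^ n) \<le> norm (1 + (f x) ^ (2 * n))"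
      by (simp add: power_mult[symmetric] mult.commute)
  qed
qed

lemma (in prob_space) all_moments_integrable: "all_moments M f \<Longrightarrow> integrable M f"
  using all_moments_power_integrable[of f 1] by simp

lemma all_moments_mult:
  assumes "all_moments M f" "all_moments M g"
  shows "all_moments M (\<lambda>x. f x * g x)"
  unfolding all_moments_def
proof (intro conjI allI)
  have f: "f \<in> borel_measurable M" "\<And>n. integrable M (\<lambda>x. (f x) ^ (2 * n))"
    and g: "g \<in> borel_measurable M" "\<And>n. integrable M (\<lambda>x. (g x) ^ (2 * n))"
    using assms unfolding all_moments_def by auto
  show "(\<lambda>x. f x * g x) \<in> borel_measurable M" using f g by simp
  fix n
  show "integrable M (\<lambda>x. (f x * g x) ^ (2 * n))"
  proof (rule Bochner_Integration.integrable_bound)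
    show "integrable M (\<lambda>x. (f x) ^ (2 * (2 * n)) + (g x) ^ (2 * (2 * n)))"
      by (intro Bochner_Integration.integrable_add f g)
    show "(\<lambda>x. (f x * g x) ^ (2 * n)) \<in> borel_measurable M" using f g by simp
    show "AE x in M. norm ((f x * g x) ^ (2 * n)) \<le> norm ((f x) ^ (2 * (2 * n)) + (g x) ^ (2 * (2 * n)))"
    proof (rule AE_I2)
      fix x
      let ?a = "(f x) ^ (2 * n)" and ?b = "(g x) ^ (2 * n)"
      have "2 * \<bar>?a * ?b\<bar> \<le> ?a\<^sup>2 + ?b\<^sup>2"
        using sum_squares_bound[of "\<bar>?a\<bar>" "\<bar>?b\<bar>"] by (simp add: abs_mult)
      then have "\<bar>?a * ?b\<bar> \<le> ?a\<^sup>2 + ?b\<^sup>2" using abs_ge_zero[of "?a * ?b"] by linarith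
      then show "norm ((f x * g x) ^ (2 * n)) \<le> norm ((f x) ^ (2 * (2 * n)) + (g x) ^ (2 * (2 * n)))"
        by (simp add: power_mult_distrib power_mult[symmetric] mult.commute)
    qed
  qed
qed

lemma all_moments_add:
  assumes "all_moments M f" "all_moments M g"
  shows "all_moments M (\<lambda>x. f x + g x)"
  unfolding all_moments_def
proof (intro conjI allI)
  have f: "f \<in> borel_measurable M" "\<And>n. integrable M (\<lambda>x. (f x) ^ (2 * n))"
    and g: "g \<in> borel_measurable M" "\<And>n. integrable M (\<lambda>x. (g x) ^ (2 * n))"
    using assms unfolding all_moments_def by auto
  show "(\<lambda>x. f x + g x) \<in> borel_measurable M" using f g by simp
  fix n
  show "integrable M (\<lambda>x. (f x + g x) ^ (2 * n))"
  proof (rule Bochner_Integration.integrable_bound)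
    show "integrable M (\<lambda>x. 2 ^ (2 * n) * ((f x) ^ (2 * n) + (g x) ^ (2 * n)))"
      by (intro Bochner_Integration.integrable_add integrable_mult_right f g)
    show "(\<lambda>x. (f x + g x) ^ (2 * n)) \<in> borel_measurable M" using f g by simp
    show "AE x in M. norm ((f x + g x) ^ (2 * n)) \<le> norm (2 ^ (2 * n) * ((f x) ^ (2 * n) + (g x) ^ (2 * n)))"
    proof (rule AE_I2)
      fix x
      have "\<bar>f x + g x\<bar> ^ (2 * n) \<le> (2 * max \<bar>f x\<bar> \<bar>g x\<bar>) ^ (2 * n)"
        by (intro power_mono) auto
      also have "\<dots> = 2 ^ (2 * n) * max \<bar>f x\<bar> \<bar>g x\<bar> ^ (2 * n)" by (rule power_mult_distrib)
      also have "max \<bar>f x\<bar> \<bar>g x\<bar> ^ (2 * n) \<le> (f x) ^ (2 * n) + (g x) ^ (2 * n)"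
        by (auto simp: max_def power_mult)
      finally show "norm ((f x + g x) ^ (2 * n)) \<le> norm (2 ^ (2 * n) * ((f x) ^ (2 * n) + (g x) ^ (2 * n)))"
        by (simp add: power_mult)
    qed
  qed
qed

lemma (in prob_space) all_moments_const: "all_moments M (\<lambda>_. c)"
  by (simp add: all_moments_def)

lemma (in prob_space) all_moments_power: "all_moments M f \<Longrightarrow> all_moments M (\<lambda>x. f x ^ n)"
  by (induction n) (auto intro: all_moments_const all_moments_mult)

lemma (in prob_space) normal_all_moments:
  assumes X: "distributed M lborel X (\<lambda>x. ennreal (normal_density 0 \<sigma> x))" and \<sigma>: "0 < \<sigma>"
  shows "all_moments M X" and "expectation (\<lambda>x. (X x) ^ n) = (\<integral>x. normal_density 0 \<sigma> x * x ^ n \<partial>lborel)"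
    and "expectation (\<lambda>x. (X x)\<^sup>2) = \<sigma>\<^sup>2"
proof -
  have i: "integrable M (\<lambda>x. (X x) ^ n)" for n
    using distributed_integrable[OF X, of "\<lambda>x. x ^ n"] integrable_normal_moment[OF \<sigma>, of 0 n] by simp
  have "X \<in> borel_measurable M" using distributed_measurable[OF X] by simp
  with i show "all_moments M X" unfolding all_moments_def by blast
  show e: "expectation (\<lambda>x. (X x) ^ n) = (\<integral>x. normal_density 0 \<sigma> x * x ^ n \<partial>lborel)" for n
    using distributed_integral[OF X, of "\<lambda>x. x ^ n"] by simp
  show "expectation (\<lambda>x. (X x)\<^sup>2) = \<sigma>\<^sup>2"
    unfolding e using integral_normal_moment_even[OF \<sigma>, of 0 1] by simp
qed

lemma (in prob_space) centered_gaussian_all_moments: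
  assumes X: "centered_gaussian M X"
  shows "all_moments M X"
proof (cases "AE x in M. X x = 0")
  case True
  have m: "X \<in> borel_measurable M" using X unfolding centered_gaussian_def by blast
  have "integrable M (\<lambda>x. (X x) ^ (2 * n))" for n
    by (rule integrable_cong_AE_imp[OF integrable_const[of "0 ^ (2 * n)"]])
      (use m True in \<open>auto elim: eventually_mono\<close>)
  with m show ?thesis unfolding all_moments_def by blast
next
  case False
  then obtain \<sigma> where "0 < \<sigma>" "distributed M lborel X (\<lambda>x. ennreal (normal_density 0 \<sigma> x))"
    using X unfolding centered_gaussian_def by blast
  then show ?thesis by (intro normal_all_moments)
qed

text \<open>The variance determines a centred Gaussian law, the degenerate one included; a
  degenerate and a nondegenerate variable cannot share it, as \<sigma> is positive.\<close>

lemma centered_gaussian_moments_eq: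
  assumes "prob_space M" "prob_space N"
    and X: "centered_gaussian M X" and Y: "centered_gaussian N Y"
    and eq: "(\<integral>x. (X x)\<^sup>2 \<partial>M) = (\<integral>x. (Y x)\<^sup>2 \<partial>N)"
  shows "(\<integral>x. (X x) ^ n \<partial>M) = (\<integral>x. (Y x) ^ n \<partial>N)"
proof -
  interpret M: prob_space M by fact
  interpret N: prob_space N by fact
  have zero: "(\<integral>x. (Z x) ^ n \<partial>P) = 0 ^ n" if "prob_space P" "AE x in P. Z x = 0" "Z \<in> borel_measurable P"
    for P and Z :: "'c \<Rightarrow> real" and n
  proof -
    interpret P: prob_space P by fact
    have "(\<integral>x. (Z x) ^ n \<partial>P) = (\<integral>x. 0 ^ n \<partial>P)"
      by (rule integral_cong_AE) (use that in \<open>auto elim: eventually_mono\<close>)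
    then show ?thesis by (simp add: P.prob_space)
  qed
  have mX: "X \<in> borel_measurable M" and mY: "Y \<in> borel_measurable N"
    using X Y unfolding centered_gaussian_def by blast+
  consider (zz) "AE x in M. X x = 0" "AE x in N. Y x = 0"
    | (zn) \<sigma> where "AE x in M. X x = 0" "0 < \<sigma>" "distributed N lborel Y (\<lambda>x. ennreal (normal_density 0 \<sigma> x))"
    | (nz) \<sigma> where "AE x in N. Y x = 0" "0 < \<sigma>" "distributed M lborel X (\<lambda>x. ennreal (normal_density 0 \<sigma> x))"
    | (nn) \<sigma> \<tau> where "0 < \<sigma>" "distributed M lborel X (\<lambda>x. ennreal (normal_density 0 \<sigma> x))"
        "0 < \<tau>" "distributed N lborel Y (\<lambda>x. ennreal (normal_density 0 \<tau> x))"
    using X Y unfolding centered_gaussian_def by blast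
  then show ?thesis
  proof cases
    case zz
    then show ?thesis using zero[OF \<open>prob_space M\<close> zz(1) mX] zero[OF \<open>prob_space N\<close> zz(2) mY] by simp
  next
    case zn
    then show ?thesis
      using eq zero[OF \<open>prob_space M\<close> zn(1) mX, of 2] N.normal_all_moments(3)[OF zn(3,2)] by simp
  next
    case nz
    then show ?thesis
      using eq zero[OF \<open>prob_space N\<close> nz(1) mY, of 2] M.normal_all_moments(3)[OF nz(3,2)] by simp
  next
    case nn
    then have "\<sigma>\<^sup>2 = \<tau>\<^sup>2"
      using eq M.normal_all_moments(3)[OF nn(2,1)] N.normal_all_moments(3)[OF nn(4,3)] by simp
    then have "\<sigma> = \<tau>" using nn by (simp add: power2_eq_iff_nonneg)
    then show ?thesis
      using M.normal_all_moments(2)[OF nn(2,1)] N.normal_all_moments(2)[OF nn(4,3)] by simp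
  qed
qed

subsection \<open>Orthonormality of the Wiener chaos\<close>

abbreviation std_normals :: "nat set \<Rightarrow> (nat \<Rightarrow> real) measure" where
  "std_normals K \<equiv> Pi\<^sub>M K (\<lambda>_. std_normal)"

lemma indep_vars_std_normals:
  assumes "K \<noteq> {}"
  shows "prob_space.indep_vars (std_normals K) (\<lambda>_. borel) (\<lambda>k x. x k) K"
proof -
  interpret product_prob_space "\<lambda>_. std_normal" K
    by (intro product_prob_spaceI prob_space_std_normal)
  have sets: "sets (Pi\<^sub>M K (\<lambda>_. borel :: real measure)) = sets (std_normals K)"
    by (intro sets_PiM_cong) auto
  have "distr (std_normals K) (Pi\<^sub>M K (\<lambda>_. borel)) (\<lambda>x. \<lambda>k\<in>K. x k) = distr (std_normals K) (std_normals K) (\<lambda>x. x)"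
    by (intro distr_cong sets refl) (auto simp: space_PiM PiE_def extensional_restrict)
  also have "\<dots> = std_normals K" by (rule distr_id)
  also have "\<dots> = (\<Pi>\<^sub>M k\<in>K. distr (std_normals K) borel (\<lambda>x. x k))"
  proof (intro PiM_cong refl)
    fix k assume "k \<in> K"
    have "distr (std_normals K) borel (\<lambda>x. x k) = distr (std_normals K) std_normal (\<lambda>x. x k)"
      by (intro distr_cong) auto
    then show "std_normal = distr (std_normals K) borel (\<lambda>x. x k)"
      using PiM_component[OF \<open>k \<in> K\<close>] by simp
  qed
  finally show ?thesis
    using assms by (subst P.indep_vars_iff_distr_eq_PiM') auto
qed

lemma std_normals_linear_gaussian:
  assumes K: "finite K"
  shows "centered_gaussian (std_normals K) (\<lambda>x. \<Sum>k\<in>K. a k * x k)"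
    and "(\<integral>x. (\<Sum>k\<in>K. a k * x k)\<^sup>2 \<partial>std_normals K) = (\<Sum>k\<in>K. (a k)\<^sup>2)"
proof -
  interpret product_prob_space "\<lambda>_. std_normal" K
    by (intro product_prob_spaceI prob_space_std_normal)
  \<comment> \<open>A zero multiple of a normal variable has no density, so the addition theorem for
    independent normals is applied to the nonzero coefficients; if there are none, the form is
    degenerate.\<close>
  define K' where "K' = {k\<in>K. a k \<noteq> 0}"
  have K': "finite K'" "K' \<subseteq> K" using K by (auto simp: K'_def)
  have sum_eq: "(\<Sum>k\<in>K. a k * x k) = (\<Sum>k\<in>K'. a k * x k)" for x
    unfolding K'_def using K by (intro sum.mono_neutral_right) auto
  have sq_eq: "(\<Sum>k\<in>K. (a k)\<^sup>2) = (\<Sum>k\<in>K'. (a k)\<^sup>2)"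
    unfolding K'_def using K by (intro sum.mono_neutral_right) auto
  have meas: "(\<lambda>x. \<Sum>k\<in>K. a k * x k) \<in> borel_measurable (std_normals K)"
  proof (intro borel_measurable_sum borel_measurable_times borel_measurable_const)
    fix k assume "k \<in> K"
    then have "(\<lambda>x. x k) \<in> measurable (std_normals K) std_normal" by (rule measurable_component_singleton)
    then show "(\<lambda>x. x k) \<in> borel_measurable (std_normals K)" by simp
  qed
  have "centered_gaussian (std_normals K) (\<lambda>x. \<Sum>k\<in>K. a k * x k) \<and>
    (\<integral>x. (\<Sum>k\<in>K. a k * x k)\<^sup>2 \<partial>std_normals K) = (\<Sum>k\<in>K. (a k)\<^sup>2)"
  proof (cases "K' = {}")
    case True
    then have "(\<Sum>k\<in>K. a k * x k) = 0" for x by (simp add: sum_eq)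
    then show ?thesis using meas True by (simp add: centered_gaussian_def sq_eq)
  next
    case False
    then have "K \<noteq> {}" using K' by blast
    have comp: "distributed (std_normals K) lborel (\<lambda>x. x k) (\<lambda>x. ennreal (std_normal_density x))" if "k \<in> K" for k
    proof -
      have "distr (std_normals K) lborel (\<lambda>x. x k) = distr (std_normals K) std_normal (\<lambda>x. x k)"
        by (intro distr_cong) auto
      also have "\<dots> = std_normal" by (rule PiM_component[OF that])
      finally show ?thesis
        using measurable_component_singleton[OF that, of "\<lambda>_. std_normal"] by (simp add: distributed_def)
    qed
    have dist: "distributed (std_normals K) lborel (\<lambda>x. a k * x k) (\<lambda>x. ennreal (normal_density 0 \<bar>a k\<bar> x))"
      if "k \<in> K'" for k
      using P.normal_density_affine[OF comp, of k "a k" 0] that by (simp add: K'_def)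
    have indep: "P.indep_vars (\<lambda>_. borel) (\<lambda>k x. a k * x k) K'"
      using P.indep_vars_compose2[OF P.indep_vars_subset[OF indep_vars_std_normals[OF \<open>K \<noteq> {}\<close>] K'(2)],
          of "\<lambda>k y. a k * y" "\<lambda>_. borel"] by simp
    have normal: "distributed (std_normals K) lborel (\<lambda>x. \<Sum>k\<in>K'. a k * x k)
        (\<lambda>x. ennreal (normal_density (\<Sum>k\<in>K'. 0) (sqrt (\<Sum>k\<in>K'. \<bar>a k\<bar>\<^sup>2)) x))"
      by (rule P.sum_indep_normal[OF K'(1) False indep _ dist]) (simp add: K'_def)
    have pos: "0 < sqrt (\<Sum>k\<in>K'. \<bar>a k\<bar>\<^sup>2)"
      using K'(1) False by (auto intro!: sum_pos simp: K'_def)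
    have normal': "distributed (std_normals K) lborel (\<lambda>x. \<Sum>k\<in>K. a k * x k)
        (\<lambda>x. ennreal (normal_density 0 (sqrt (\<Sum>k\<in>K'. \<bar>a k\<bar>\<^sup>2)) x))"
      using normal by (simp add: sum_eq)
    have "(\<integral>x. (\<Sum>k\<in>K. a k * x k)\<^sup>2 \<partial>std_normals K) = (sqrt (\<Sum>k\<in>K'. \<bar>a k\<bar>\<^sup>2))\<^sup>2"
      by (rule P.normal_all_moments(3)[OF normal' pos])
    then have "(\<integral>x. (\<Sum>k\<in>K. a k * x k)\<^sup>2 \<partial>std_normals K) = (\<Sum>k\<in>K. (a k)\<^sup>2)"
      by (simp add: sq_eq sum_nonneg)
    then show ?thesis using meas normal' pos unfolding centered_gaussian_def by blast
  qed
  then show "centered_gaussian (std_normals K) (\<lambda>x. \<Sum>k\<in>K. a k * x k)"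
    "(\<integral>x. (\<Sum>k\<in>K. a k * x k)\<^sup>2 \<partial>std_normals K) = (\<Sum>k\<in>K. (a k)\<^sup>2)" by auto
qed

lemma prob_space_std_normals: "prob_space (std_normals K)"
  by (rule prob_space_PiM) (rule prob_space_std_normal)

lemma integral_std_normals_prod:
  fixes f :: "nat \<Rightarrow> real \<Rightarrow> real"
  assumes K: "finite K" and f: "\<And>k. integrable std_normal (f k)"
  shows "(\<integral>x. (\<Prod>k\<in>K. f k (x k)) \<partial>std_normals K) = (\<Prod>k\<in>K. \<integral>x. f k x \<partial>std_normal)"
proof -
  interpret product_prob_space "\<lambda>_. std_normal" K
    by (intro product_prob_spaceI prob_space_std_normal)
  show ?thesis by (rule product_integral_prod[OF K f])
qed

context gaussian_noise
begin

definition coord :: "nat \<Rightarrow> 'a \<Rightarrow> real" where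
  "coord k = W (e k)"

lemma linear_gaussian:
  assumes "finite K"
  shows "centered_gaussian M (\<lambda>\<omega>. \<Sum>k\<in>K. a k * coord k \<omega>)"
proof -
  \<comment> \<open>The Gaussian property speaks of finite sets of vectors h, so the sum over k is
    reindexed along e.\<close>
  have inj: "inj_on e K"
  proof (rule inj_onI)
    fix k l assume "e k = e l"
    have "e m \<bullet> e n = (if m = n then 1 else 0)" for m n
      using basis unfolding orthonormal_basis_def by simp
    from this[of k k] this[of k l] \<open>e k = e l\<close> show "k = l" by (simp split: if_splits)
  qed
  have "centered_gaussian M (\<lambda>\<omega>. \<Sum>h\<in>e ` K. a (inv_into K e h) * W h \<omega>)"
    using gaussian[unfolded centered_gaussian_family_def, THEN spec, THEN spec, THEN mp, OF finite_imageI[OF assms]] .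
  also have "(\<lambda>\<omega>. \<Sum>h\<in>e ` K. a (inv_into K e h) * W h \<omega>) = (\<lambda>\<omega>. \<Sum>k\<in>K. a k * coord k \<omega>)"
  proof (rule ext)
    fix \<omega>
    have "(\<Sum>h\<in>e ` K. a (inv_into K e h) * W h \<omega>) = (\<Sum>k\<in>K. a (inv_into K e (e k)) * W (e k) \<omega>)"
      by (rule sum.reindex_cong[OF inj refl refl])
    also have "\<dots> = (\<Sum>k\<in>K. a k * coord k \<omega>)"
      by (intro sum.cong refl) (simp only: inv_into_f_f[OF inj] coord_def)
    finally show "(\<Sum>h\<in>e ` K. a (inv_into K e h) * W h \<omega>) = (\<Sum>k\<in>K. a k * coord k \<omega>)" .
  qed
  finally show ?thesis .
qed

lemma coord_all_moments: "all_moments M (coord k)"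
  using centered_gaussian_all_moments[OF linear_gaussian[of "{k}" "\<lambda>_. 1"]] by simp

lemma linear_variance:
  assumes "finite K"
  shows "expectation (\<lambda>\<omega>. (\<Sum>k\<in>K. a k * coord k \<omega>)\<^sup>2) = (\<Sum>k\<in>K. (a k)\<^sup>2)"
proof -
  have int: "integrable M (\<lambda>\<omega>. coord k \<omega> * coord l \<omega>)" for k l
    by (intro all_moments_integrable all_moments_mult coord_all_moments)
  have "expectation (\<lambda>\<omega>. (\<Sum>k\<in>K. a k * coord k \<omega>)\<^sup>2)
      = expectation (\<lambda>\<omega>. \<Sum>k\<in>K. \<Sum>l\<in>K. (a k * a l) * (coord k \<omega> * coord l \<omega>))"
    by (simp add: power2_eq_square sum_product mult_ac)
  also have "\<dots> = (\<Sum>k\<in>K. \<Sum>l\<in>K. (a k * a l) * expectation (\<lambda>\<omega>. coord k \<omega> * coord l \<omega>))"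
    by (simp add: Bochner_Integration.integral_sum int del: integral_mult_right_zero)
  also have "\<dots> = (\<Sum>k\<in>K. \<Sum>l\<in>K. if k = l then (a k)\<^sup>2 else 0)"
    using basis by (intro sum.cong refl) (simp add: coord_def covariance orthonormal_basis_def power2_eq_square)
  also have "\<dots> = (\<Sum>k\<in>K. (a k)\<^sup>2)" using assms by simp
  finally show ?thesis .
qed

text \<open>\<open>paired K f g\<close> holds for corresponding polynomials \<open>f\<close> in the coordinates of the noise and
  \<open>g\<close> in independent standard normal variables. Factors are introduced by polarisation: compare
  the coefficients of \<open>t\<close> in the moments of \<open>L + t x\<^sub>k\<close>.\<close>

definition paired :: "nat set \<Rightarrow> ('a \<Rightarrow> real) \<Rightarrow> ((nat \<Rightarrow> real) \<Rightarrow> real) \<Rightarrow> bool" where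
  "paired K f g \<longleftrightarrow> all_moments M f \<and> all_moments (std_normals K) g \<and>
     (\<forall>a n. expectation (\<lambda>\<omega>. f \<omega> * (\<Sum>k\<in>K. a k * coord k \<omega>) ^ n)
        = (\<integral>x. g x * (\<Sum>k\<in>K. a k * x k) ^ n \<partial>std_normals K))"

lemma paired_one:
  assumes "finite K"
  shows "paired K (\<lambda>_. 1) (\<lambda>_. 1)"
proof -
  interpret N: prob_space "std_normals K" by (rule prob_space_std_normals)
  show ?thesis
    unfolding paired_def
    using centered_gaussian_moments_eq[OF prob_space_axioms N.prob_space_axioms linear_gaussian[OF assms]
        std_normals_linear_gaussian(1)[OF assms]]
    by (simp add: all_moments_const N.all_moments_const linear_variance std_normals_linear_gaussian(2) assms)
qed

lemma paired_add:
  assumes "finite K" "paired K f g" "paired K f' g'"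
  shows "paired K (\<lambda>\<omega>. f \<omega> + c * f' \<omega>) (\<lambda>x. g x + c * g' x)"
proof -
  interpret N: prob_space "std_normals K" by (rule prob_space_std_normals)
  have am: "all_moments M f" "all_moments M f'" "all_moments (std_normals K) g" "all_moments (std_normals K) g'"
    and eq: "\<And>a n. expectation (\<lambda>\<omega>. f \<omega> * (\<Sum>k\<in>K. a k * coord k \<omega>) ^ n)
        = (\<integral>x. g x * (\<Sum>k\<in>K. a k * x k) ^ n \<partial>std_normals K)"
      "\<And>a n. expectation (\<lambda>\<omega>. f' \<omega> * (\<Sum>k\<in>K. a k * coord k \<omega>) ^ n)
        = (\<integral>x. g' x * (\<Sum>k\<in>K. a k * x k) ^ n \<partial>std_normals K)"
    using assms unfolding paired_def by auto
  have L: "all_moments M (\<lambda>\<omega>. (\<Sum>k\<in>K. a k * coord k \<omega>) ^ n)"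
    and L': "all_moments (std_normals K) (\<lambda>x. (\<Sum>k\<in>K. a k * x k) ^ n)" for a n
    by (intro all_moments_power centered_gaussian_all_moments linear_gaussian assms
        N.all_moments_power N.centered_gaussian_all_moments std_normals_linear_gaussian)+
  have "expectation (\<lambda>\<omega>. (f \<omega> + c * f' \<omega>) * (\<Sum>k\<in>K. a k * coord k \<omega>) ^ n)
      = (\<integral>x. (g x + c * g' x) * (\<Sum>k\<in>K. a k * x k) ^ n \<partial>std_normals K)" for a n
  proof -
    have i: "integrable M (\<lambda>\<omega>. f \<omega> * (\<Sum>k\<in>K. a k * coord k \<omega>) ^ n)"
      "integrable M (\<lambda>\<omega>. f' \<omega> * (\<Sum>k\<in>K. a k * coord k \<omega>) ^ n)"
      "integrable (std_normals K) (\<lambda>x. g x * (\<Sum>k\<in>K. a k * x k) ^ n)"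
      "integrable (std_normals K) (\<lambda>x. g' x * (\<Sum>k\<in>K. a k * x k) ^ n)"
      by (intro all_moments_integrable N.all_moments_integrable all_moments_mult am L L')+
    have "expectation (\<lambda>\<omega>. (f \<omega> + c * f' \<omega>) * (\<Sum>k\<in>K. a k * coord k \<omega>) ^ n)
        = expectation (\<lambda>\<omega>. f \<omega> * (\<Sum>k\<in>K. a k * coord k \<omega>) ^ n + c * (f' \<omega> * (\<Sum>k\<in>K. a k * coord k \<omega>) ^ n))"
      by (simp only: distrib_right mult.assoc)
    also have "\<dots> = (\<integral>x. g x * (\<Sum>k\<in>K. a k * x k) ^ n \<partial>std_normals K)
        + c * (\<integral>x. g' x * (\<Sum>k\<in>K. a k * x k) ^ n \<partial>std_normals K)"
      using i by (simp add: eq)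
    also have "\<dots> = (\<integral>x. g x * (\<Sum>k\<in>K. a k * x k) ^ n + c * (g' x * (\<Sum>k\<in>K. a k * x k) ^ n) \<partial>std_normals K)"
      using i by simp
    also have "\<dots> = (\<integral>x. (g x + c * g' x) * (\<Sum>k\<in>K. a k * x k) ^ n \<partial>std_normals K)"
      by (simp only: distrib_right mult.assoc)
    finally show ?thesis .
  qed
  then show ?thesis
    unfolding paired_def
    by (intro conjI allI all_moments_add all_moments_mult all_moments_const N.all_moments_const am)
qed

lemma polarize:
  fixes f x :: "'b \<Rightarrow> real"
  assumes P: "prob_space P" and am: "all_moments P f" "all_moments P L" "all_moments P x"
  shows "(\<integral>\<omega>. f \<omega> * (t * x \<omega> + L \<omega>) ^ Suc n \<partial>P)
     = (\<Sum>i\<le>Suc n. (real (Suc n choose i) * (\<integral>\<omega>. f \<omega> * (x \<omega> ^ i * L \<omega> ^ (Suc n - i)) \<partial>P)) * t ^ i)"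
proof -
  interpret P: prob_space P by fact
  have "(\<integral>\<omega>. f \<omega> * (t * x \<omega> + L \<omega>) ^ Suc n \<partial>P)
      = (\<integral>\<omega>. (\<Sum>i\<le>Suc n. (real (Suc n choose i) * t ^ i) * (f \<omega> * (x \<omega> ^ i * L \<omega> ^ (Suc n - i)))) \<partial>P)"
    by (simp only: binomial_ring sum_distrib_left power_mult_distrib mult_ac)
  also have "\<dots> = (\<Sum>i\<le>Suc n. (real (Suc n choose i) * t ^ i) * (\<integral>\<omega>. f \<omega> * (x \<omega> ^ i * L \<omega> ^ (Suc n - i)) \<partial>P))"
    by (subst Bochner_Integration.integral_sum)
      (intro integrable_mult_right P.all_moments_integrable all_moments_mult P.all_moments_power am, simp)
  finally show ?thesis by (simp only: mult_ac)
qed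

lemma paired_mult:
  assumes K: "finite K" "l \<in> K" and p: "paired K f g"
  shows "paired K (\<lambda>\<omega>. f \<omega> * coord l \<omega>) (\<lambda>x. g x * x l)"
proof -
  interpret N: prob_space "std_normals K" by (rule prob_space_std_normals)
  have am: "all_moments M f" "all_moments (std_normals K) g"
    and eq: "\<And>a n. expectation (\<lambda>\<omega>. f \<omega> * (\<Sum>k\<in>K. a k * coord k \<omega>) ^ n)
        = (\<integral>x. g x * (\<Sum>k\<in>K. a k * x k) ^ n \<partial>std_normals K)"
    using p unfolding paired_def by auto
  have L: "all_moments M (\<lambda>\<omega>. \<Sum>k\<in>K. a k * coord k \<omega>)"
    and L': "all_moments (std_normals K) (\<lambda>x. \<Sum>k\<in>K. a k * x k)" for a
    by (intro centered_gaussian_all_moments linear_gaussian K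
        N.centered_gaussian_all_moments std_normals_linear_gaussian)+
  have delta: "(\<Sum>k\<in>K. (if k = l then 1 else 0) * y k) = (y l :: real)" for y
    using K by (simp add: if_distrib[of "\<lambda>c. c * _"] cong: if_cong)
  have x: "all_moments (std_normals K) (\<lambda>x. x l)"
    using L'[of "\<lambda>k. if k = l then 1 else 0"] by (simp only: delta)
  have "expectation (\<lambda>\<omega>. (f \<omega> * coord l \<omega>) * (\<Sum>k\<in>K. a k * coord k \<omega>) ^ n)
      = (\<integral>x. (g x * x l) * (\<Sum>k\<in>K. a k * x k) ^ n \<partial>std_normals K)" for a n
  proof -
    \<comment> \<open>Exponent n + 1, so that the coefficient of t carries the nth power of the
      linear form; the binomial factor n + 1 cancels on both sides.\<close>
    let ?c = "\<lambda>i. real (Suc n choose i) * expectation (\<lambda>\<omega>. f \<omega> * (coord l \<omega> ^ i * (\<Sum>k\<in>K. a k * coord k \<omega>) ^ (Suc n - i)))"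
    let ?d = "\<lambda>i. real (Suc n choose i) * (\<integral>x. g x * (x l ^ i * (\<Sum>k\<in>K. a k * x k) ^ (Suc n - i)) \<partial>std_normals K)"
    have "(\<Sum>i\<le>Suc n. ?c i * t ^ i) = (\<Sum>i\<le>Suc n. ?d i * t ^ i)" for t
    proof -
      have comb: "(\<Sum>k\<in>K. (t * (if k = l then 1 else 0) + a k) * y k) = t * y l + (\<Sum>k\<in>K. a k * y k)" for y
        by (simp only: distrib_right sum.distrib mult.assoc sum_distrib_left[symmetric] delta)
      show ?thesis
        using eq[of "\<lambda>k. t * (if k = l then 1 else 0) + a k" "Suc n"]
        unfolding comb polarize[OF prob_space_axioms am(1) L coord_all_moments]
          polarize[OF N.prob_space_axioms am(2) L' x] .
    qed
    then have "\<forall>i\<le>Suc n. ?c i = ?d i"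
      using polyfun_eq_coeffs[of ?c "Suc n" ?d] by blast
    note coeff_eq = mp[OF spec[OF this, of 1]]
    have "1 \<le> Suc n" by simp
    from coeff_eq[OF this] show ?thesis by (simp add: mult.assoc)
  qed
  then show ?thesis
    unfolding paired_def by (intro conjI allI all_moments_mult am coord_all_moments x)
qed

lemma paired_poly:
  assumes K: "finite K" "l \<in> K" and p: "paired K f g"
  shows "paired K (\<lambda>\<omega>. f \<omega> * poly q (coord l \<omega>)) (\<lambda>x. g x * poly q (x l))"
  using p
proof (induction q arbitrary: f g)
  case 0
  from paired_add[OF K(1) 0 0, of "-1"] show ?case by simp
next
  case (pCons c q)
  have "paired K (\<lambda>\<omega>. f \<omega> * coord l \<omega> * poly q (coord l \<omega>)) (\<lambda>x. g x * x l * poly q (x l))"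
    by (rule pCons.IH[OF paired_mult[OF K pCons.prems]])
  from paired_add[OF K(1) this pCons.prems, of c] show ?case
    by (simp add: algebra_simps)
qed

lemma paired_prod_poly:
  assumes K: "finite K" "J \<subseteq> K"
  shows "paired K (\<lambda>\<omega>. \<Prod>k\<in>J. poly (q k) (coord k \<omega>)) (\<lambda>x. \<Prod>k\<in>J. poly (q k) (x k))"
proof -
  have "finite J" using K finite_subset by blast
  then show ?thesis
    using K(2)
  proof (induction J)
    case empty
    then show ?case using paired_one[OF K(1)] by simp
  next
    case (insert l J)
    then have "paired K (\<lambda>\<omega>. (\<Prod>k\<in>J. poly (q k) (coord k \<omega>)) * poly (q l) (coord l \<omega>))
        (\<lambda>x. (\<Prod>k\<in>J. poly (q k) (x k)) * poly (q l) (x l))"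
      by (intro paired_poly K) auto
    then show ?case using insert by (simp add: mult.commute)
  qed
qed

text \<open>Joint Gaussianity enters through the moments of linear forms, which the polarisation
  argument has extended to all polynomials. On these the noise coordinates therefore behave like
  independent variables, and the exponent 0 gives the plain expectation.\<close>

lemma expectation_prod_poly:
  assumes K: "finite K"
  shows "expectation (\<lambda>\<omega>. \<Prod>k\<in>K. poly (q k) (coord k \<omega>)) = (\<Prod>k\<in>K. \<integral>x. poly (q k) x \<partial>std_normal)"
proof -
  have "\<forall>a n. expectation (\<lambda>\<omega>. (\<Prod>k\<in>K. poly (q k) (coord k \<omega>)) * (\<Sum>k\<in>K. a k * coord k \<omega>) ^ n)
      = (\<integral>x. (\<Prod>k\<in>K. poly (q k) (x k)) * (\<Sum>k\<in>K. a k * x k) ^ n \<partial>std_normals K)"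
    using paired_prod_poly[OF K order_refl, of q] unfolding paired_def by (elim conjE)
  from spec[OF spec[OF this, of "\<lambda>_. 0"], of 0]
  have "expectation (\<lambda>\<omega>. \<Prod>k\<in>K. poly (q k) (coord k \<omega>))
     = (\<integral>x. (\<Prod>k\<in>K. poly (q k) (x k)) \<partial>std_normals K)"
    by (simp only: power_0 mult_1_right)
  then show ?thesis by (simp only: integral_std_normals_prod[OF K integrable_std_normal_poly])
qed

definition chaos_poly :: "multi_index \<Rightarrow> nat \<Rightarrow> real poly" where
  "chaos_poly \<alpha> k = smult (1 / sqrt (fact (Poly_Mapping.lookup \<alpha> k))) (hermite_poly (Poly_Mapping.lookup \<alpha> k))"

lemma chaos_basis_eq_prod:
  assumes "finite K" "Poly_Mapping.keys \<alpha> \<subseteq> K"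
  shows "chaos_basis e W \<alpha> \<omega> = (\<Prod>k\<in>K. poly (chaos_poly \<alpha> k) (coord k \<omega>))"
proof -
  have "chaos_basis e W \<alpha> \<omega> = (\<Prod>k\<in>Poly_Mapping.keys \<alpha>. poly (chaos_poly \<alpha> k) (coord k \<omega>))"
    by (simp add: chaos_basis_def chaos_poly_def hermite_eq_poly coord_def)
  also have "\<dots> = (\<Prod>k\<in>K. poly (chaos_poly \<alpha> k) (coord k \<omega>))"
    using assms by (intro prod.mono_neutral_left) (auto simp: chaos_poly_def in_keys_iff)
  finally show ?thesis .
qed

lemma chaos_basis_all_moments: "all_moments M (chaos_basis e W \<alpha>)"
proof -
  have "chaos_basis e W \<alpha> = (\<lambda>\<omega>. \<Prod>k\<in>Poly_Mapping.keys \<alpha>. poly (chaos_poly \<alpha> k) (coord k \<omega>))"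
    by (rule ext, rule chaos_basis_eq_prod[OF finite_keys order_refl])
  then show ?thesis
    using paired_prod_poly[OF finite_keys order_refl, of \<alpha> "chaos_poly \<alpha>"]
    unfolding paired_def by simp
qed

lemma chaos_basis_orthonormal:
  "expectation (\<lambda>\<omega>. chaos_basis e W \<alpha> \<omega> * chaos_basis e W \<beta> \<omega>) = (if \<alpha> = \<beta> then 1 else 0)"
proof -
  define K where "K = Poly_Mapping.keys \<alpha> \<union> Poly_Mapping.keys \<beta>"
  have K: "finite K" "Poly_Mapping.keys \<alpha> \<subseteq> K" "Poly_Mapping.keys \<beta> \<subseteq> K" by (auto simp: K_def)
  have "expectation (\<lambda>\<omega>. chaos_basis e W \<alpha> \<omega> * chaos_basis e W \<beta> \<omega>)
      = expectation (\<lambda>\<omega>. \<Prod>k\<in>K. poly (chaos_poly \<alpha> k * chaos_poly \<beta> k) (coord k \<omega>))"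
    by (simp add: chaos_basis_eq_prod[OF K(1,2)] chaos_basis_eq_prod[OF K(1,3)] prod.distrib)
  also have "\<dots> = (\<Prod>k\<in>K. \<integral>x. poly (chaos_poly \<alpha> k * chaos_poly \<beta> k) x \<partial>std_normal)"
    by (rule expectation_prod_poly[OF K(1)])
  also have "\<dots> = (\<Prod>k\<in>K. if Poly_Mapping.lookup \<alpha> k = Poly_Mapping.lookup \<beta> k then 1 else 0)"
  proof (intro prod.cong refl)
    fix k
    let ?m = "Poly_Mapping.lookup \<alpha> k" and ?n = "Poly_Mapping.lookup \<beta> k"
    have "(\<integral>x. poly (chaos_poly \<alpha> k * chaos_poly \<beta> k) x \<partial>std_normal)
        = (\<integral>x. 1 / (sqrt (fact ?m) * sqrt (fact ?n)) * (hermite ?m x * hermite ?n x) \<partial>std_normal)"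
      by (simp add: chaos_poly_def hermite_eq_poly)
    also have "\<dots> = 1 / (sqrt (fact ?m) * sqrt (fact ?n)) * (if ?m = ?n then fact ?m else 0)"
      by (simp only: integral_mult_right_zero hermite_orthogonal)
    also have "\<dots> = (if ?m = ?n then 1 else 0)" by simp
    finally show "(\<integral>x. poly (chaos_poly \<alpha> k * chaos_poly \<beta> k) x \<partial>std_normal) = (if ?m = ?n then 1 else 0)" .
  qed
  also have "\<dots> = (if \<alpha> = \<beta> then 1 else 0)"
  proof (cases "\<alpha> = \<beta>")
    case False
    then obtain k where "Poly_Mapping.lookup \<alpha> k \<noteq> Poly_Mapping.lookup \<beta> k"
      using poly_mapping_eqI[of \<alpha> \<beta>] by blast
    moreover then have "k \<in> K" by (auto simp: K_def in_keys_iff)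
    ultimately show ?thesis using False K(1) by (auto intro!: prod_zero)
  qed simp
  finally show ?thesis .
qed

end

section \<open>Mean square convergence of chaos expansions\<close>

context gaussian_noise
begin

definition chaos_sum :: "(multi_index \<Rightarrow> 'x::real_normed_vector) \<Rightarrow> multi_index set \<Rightarrow> 'a \<Rightarrow> 'x" where
  "chaos_sum v F \<omega> = (\<Sum>\<alpha>\<in>F. chaos_basis e W \<alpha> \<omega> *\<^sub>R v \<alpha>)"

lemma chaos_sum_in_L2: "in_L2 M (chaos_sum v F)"
  unfolding chaos_sum_def[abs_def]
proof (rule in_L2_sum, rule in_L2_scaled)
  fix \<alpha>
  show "chaos_basis e W \<alpha> \<in> borel_measurable M"
    using chaos_basis_all_moments[of \<alpha>] unfolding all_moments_def by blast
  show "integrable M (\<lambda>\<omega>. (chaos_basis e W \<alpha> \<omega>)\<^sup>2)"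
    by (rule all_moments_power_integrable[OF chaos_basis_all_moments])
qed

lemma expectation_chaos_sum:
  fixes v :: "multi_index \<Rightarrow> 'x::real_inner"
  assumes F: "finite F"
  shows "expectation (\<lambda>\<omega>. (norm (chaos_sum v F \<omega>))\<^sup>2) = (\<Sum>\<alpha>\<in>F. (norm (v \<alpha>))\<^sup>2)"
proof -
  let ?x = "chaos_basis e W"
  have int: "integrable M (\<lambda>\<omega>. ?x \<alpha> \<omega> * ?x \<beta> \<omega>)" for \<alpha> \<beta>
    by (intro all_moments_integrable all_moments_mult chaos_basis_all_moments)
  have "expectation (\<lambda>\<omega>. (norm (chaos_sum v F \<omega>))\<^sup>2)
      = expectation (\<lambda>\<omega>. \<Sum>\<alpha>\<in>F. \<Sum>\<beta>\<in>F. (v \<alpha> \<bullet> v \<beta>) * (?x \<alpha> \<omega> * ?x \<beta> \<omega>))"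
    unfolding chaos_sum_def power2_norm_eq_inner inner_sum_left
    unfolding inner_sum_right inner_scaleR_left inner_scaleR_right by (simp only: mult_ac)
  also have "\<dots> = (\<Sum>\<alpha>\<in>F. \<Sum>\<beta>\<in>F. (v \<alpha> \<bullet> v \<beta>) * expectation (\<lambda>\<omega>. ?x \<alpha> \<omega> * ?x \<beta> \<omega>))"
    by (simp add: Bochner_Integration.integral_sum int)
  also have "\<dots> = (\<Sum>\<alpha>\<in>F. \<Sum>\<beta>\<in>F. if \<alpha> = \<beta> then (norm (v \<alpha>))\<^sup>2 else 0)"
    by (intro sum.cong refl) (simp add: chaos_basis_orthonormal power2_norm_eq_inner)
  also have "\<dots> = (\<Sum>\<alpha>\<in>F. (norm (v \<alpha>))\<^sup>2)" using F by simp
  finally show ?thesis .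
qed

text \<open>Finite index sets whose sums come within 1/(n+1) of the supremum control everything
  beyond them: by orthonormality, any larger finite set changes the chaos sum by at most 1/(n+1) in
  mean square. The same tail bound gives a Cauchy sequence and upgrades its limit to one along all
  finite sets.\<close>

lemma chaos_expansion_exists:
  fixes v :: "multi_index \<Rightarrow> 'x::{real_inner, complete_space}"
  assumes bound: "\<And>F. finite F \<Longrightarrow> (\<Sum>\<alpha>\<in>F. (norm (v \<alpha>))\<^sup>2) \<le> R"
  obtains U where "has_chaos_expansion M e W U v" "expectation (\<lambda>\<omega>. (norm (U \<omega>))\<^sup>2) \<le> R"
proof -
  let ?S = "\<lambda>F. \<Sum>\<alpha>\<in>F. (norm (v \<alpha>))\<^sup>2"
  define s where "s = Sup (?S ` Collect finite)"
  have bdd: "bdd_above (?S ` Collect finite)"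
    by (rule bdd_aboveI[of _ R]) (use bound in auto)
  have ne: "?S ` Collect finite \<noteq> {}" by blast
  have S_le: "?S F \<le> s" if "finite F" for F
    unfolding s_def by (rule cSup_upper) (use that bdd in auto)
  have ex: "\<exists>F. finite F \<and> s - inverse (real (Suc n)) < ?S F" for n
  proof -
    have "s - inverse (real (Suc n)) < Sup (?S ` Collect finite)" by (simp add: s_def)
    from less_cSupD[OF ne this] show ?thesis by auto
  qed
  define F0 where "F0 n = (SOME F. finite F \<and> s - inverse (real (Suc n)) < ?S F)" for n
  have F0: "finite (F0 n)" "s - inverse (real (Suc n)) < ?S (F0 n)" for n
    using someI_ex[OF ex, of n] unfolding F0_def by blast+
  \<comment> \<open>Unions make the index sets increasing while keeping them nearly optimal.\<close>
  define Fs where "Fs n = (\<Union>k\<le>n. F0 k)" for n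
  have Fs: "finite (Fs n)" for n unfolding Fs_def using F0(1) by blast
  have Fs_mono: "Fs n \<subseteq> Fs m" if "n \<le> m" for n m unfolding Fs_def using that by fastforce
  have tail: "expectation (\<lambda>\<omega>. (norm (chaos_sum v F \<omega> - chaos_sum v (Fs n) \<omega>))\<^sup>2) \<le> inverse (real (Suc n))"
    if "finite F" "Fs n \<subseteq> F" for F n
  proof -
    have "chaos_sum v F \<omega> - chaos_sum v (Fs n) \<omega> = chaos_sum v (F - Fs n) \<omega>" for \<omega>
      unfolding chaos_sum_def using that by (simp add: sum_diff)
    then have "expectation (\<lambda>\<omega>. (norm (chaos_sum v F \<omega> - chaos_sum v (Fs n) \<omega>))\<^sup>2) = ?S (F - Fs n)"
      using expectation_chaos_sum[of "F - Fs n" v] that by simp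
    also have "\<dots> = ?S F - ?S (Fs n)" using that by (simp add: sum_diff)
    also have "\<dots> \<le> s - ?S (F0 n)"
    proof (rule diff_mono[OF S_le[OF that(1)]])
      have "F0 n \<subseteq> Fs n" unfolding Fs_def by blast
      then show "?S (F0 n) \<le> ?S (Fs n)" using Fs by (intro sum_mono2) auto
    qed
    also have "\<dots> \<le> inverse (real (Suc n))" using F0(2)[of n] by linarith
    finally show ?thesis .
  qed
  have Cau: "\<exists>N. \<forall>m\<ge>N. \<forall>n\<ge>N. expectation (\<lambda>\<omega>. (norm (chaos_sum v (Fs m) \<omega> - chaos_sum v (Fs n) \<omega>))\<^sup>2) < d"
    if d: "0 < d" for d
  proof -
    have "0 < d / 4" using d by simp
    then obtain N where N: "inverse (real (Suc N)) < d / 4" using reals_Archimedean by blast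
    show ?thesis
    proof (intro exI[of _ N] allI impI)
      fix m n assume m: "m \<ge> N" and n: "n \<ge> N"
      have i: "integrable M (\<lambda>\<omega>. (norm (chaos_sum v (Fs m) \<omega> - chaos_sum v (Fs N) \<omega>))\<^sup>2)" for m
        by (intro in_L2_integrable in_L2_diff chaos_sum_in_L2)
      have "expectation (\<lambda>\<omega>. (norm (chaos_sum v (Fs m) \<omega> - chaos_sum v (Fs n) \<omega>))\<^sup>2)
          \<le> expectation (\<lambda>\<omega>. 2 * (norm (chaos_sum v (Fs m) \<omega> - chaos_sum v (Fs N) \<omega>))\<^sup>2
             + 2 * (norm (chaos_sum v (Fs n) \<omega> - chaos_sum v (Fs N) \<omega>))\<^sup>2)"
      proof (rule integral_mono)
        show "integrable M (\<lambda>\<omega>. (norm (chaos_sum v (Fs m) \<omega> - chaos_sum v (Fs n) \<omega>))\<^sup>2)"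
          by (intro in_L2_integrable in_L2_diff chaos_sum_in_L2)
        show "integrable M (\<lambda>\<omega>. 2 * (norm (chaos_sum v (Fs m) \<omega> - chaos_sum v (Fs N) \<omega>))\<^sup>2
             + 2 * (norm (chaos_sum v (Fs n) \<omega> - chaos_sum v (Fs N) \<omega>))\<^sup>2)"
          using i by simp
        show "(norm (chaos_sum v (Fs m) \<omega> - chaos_sum v (Fs n) \<omega>))\<^sup>2
          \<le> 2 * (norm (chaos_sum v (Fs m) \<omega> - chaos_sum v (Fs N) \<omega>))\<^sup>2
             + 2 * (norm (chaos_sum v (Fs n) \<omega> - chaos_sum v (Fs N) \<omega>))\<^sup>2" for \<omega>
          using power2_norm_diff_triangle[of "chaos_sum v (Fs m) \<omega>" "chaos_sum v (Fs n) \<omega>" "chaos_sum v (Fs N) \<omega>"]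
          by (simp only: norm_minus_commute[of "chaos_sum v (Fs N) \<omega>"])
      qed
      also have "\<dots> = 2 * expectation (\<lambda>\<omega>. (norm (chaos_sum v (Fs m) \<omega> - chaos_sum v (Fs N) \<omega>))\<^sup>2)
          + 2 * expectation (\<lambda>\<omega>. (norm (chaos_sum v (Fs n) \<omega> - chaos_sum v (Fs N) \<omega>))\<^sup>2)"
        using i by simp
      also have "\<dots> < d"
        using tail[OF Fs Fs_mono[OF m]] tail[OF Fs Fs_mono[OF n]] N by linarith
      finally show "expectation (\<lambda>\<omega>. (norm (chaos_sum v (Fs m) \<omega> - chaos_sum v (Fs n) \<omega>))\<^sup>2) < d" .
    qed
  qed
  obtain U r where U: "in_L2 M U" and "strict_mono (r :: nat \<Rightarrow> nat)"
    and lim: "(\<lambda>n. expectation (\<lambda>\<omega>. (norm (chaos_sum v (Fs n) \<omega> - U \<omega>))\<^sup>2)) \<longlonglongrightarrow> 0"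
    using L2_complete[OF chaos_sum_in_L2 Cau] by blast
  have intU: "integrable M (\<lambda>\<omega>. (norm (chaos_sum v F \<omega> - U \<omega>))\<^sup>2)" for F
    by (intro in_L2_integrable in_L2_diff chaos_sum_in_L2 U)
  have filt: "((\<lambda>F. expectation (\<lambda>\<omega>. (norm (U \<omega> - chaos_sum v F \<omega>))\<^sup>2)) \<longlongrightarrow> 0) (finite_subsets_at_top UNIV)"
  proof (rule tendstoI)
    fix d :: real assume d: "0 < d"
    then have "0 < d / 4" by simp
    then have "\<forall>\<^sub>F n in sequentially. expectation (\<lambda>\<omega>. (norm (chaos_sum v (Fs n) \<omega> - U \<omega>))\<^sup>2) < d / 4"
      by (rule order_tendstoD(2)[OF lim])
    moreover have "\<forall>\<^sub>F n in sequentially. inverse (real (Suc n)) < d / 4"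
      using \<open>0 < d / 4\<close> by (rule order_tendstoD(2)[OF LIMSEQ_inverse_real_of_nat])
    ultimately have "\<exists>n. expectation (\<lambda>\<omega>. (norm (chaos_sum v (Fs n) \<omega> - U \<omega>))\<^sup>2) < d / 4 \<and>
        inverse (real (Suc n)) < d / 4"
      by (intro eventually_happens'[OF sequentially_bot] eventually_conj)
    then obtain n where n: "expectation (\<lambda>\<omega>. (norm (chaos_sum v (Fs n) \<omega> - U \<omega>))\<^sup>2) < d / 4"
        "inverse (real (Suc n)) < d / 4" by blast
    have "expectation (\<lambda>\<omega>. (norm (U \<omega> - chaos_sum v F \<omega>))\<^sup>2) < d" if F: "finite F" "Fs n \<subseteq> F" for F
    proof -
      have i: "integrable M (\<lambda>\<omega>. (norm (chaos_sum v F \<omega> - chaos_sum v (Fs n) \<omega>))\<^sup>2)"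
        by (intro in_L2_integrable in_L2_diff chaos_sum_in_L2)
      have "expectation (\<lambda>\<omega>. (norm (U \<omega> - chaos_sum v F \<omega>))\<^sup>2)
          \<le> expectation (\<lambda>\<omega>. 2 * (norm (chaos_sum v (Fs n) \<omega> - U \<omega>))\<^sup>2
            + 2 * (norm (chaos_sum v F \<omega> - chaos_sum v (Fs n) \<omega>))\<^sup>2)"
      proof (rule integral_mono)
        show "integrable M (\<lambda>\<omega>. (norm (U \<omega> - chaos_sum v F \<omega>))\<^sup>2)"
          by (intro in_L2_integrable in_L2_diff chaos_sum_in_L2 U)
        show "integrable M (\<lambda>\<omega>. 2 * (norm (chaos_sum v (Fs n) \<omega> - U \<omega>))\<^sup>2
            + 2 * (norm (chaos_sum v F \<omega> - chaos_sum v (Fs n) \<omega>))\<^sup>2)"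
          using i intU by simp
        show "(norm (U \<omega> - chaos_sum v F \<omega>))\<^sup>2 \<le> 2 * (norm (chaos_sum v (Fs n) \<omega> - U \<omega>))\<^sup>2
            + 2 * (norm (chaos_sum v F \<omega> - chaos_sum v (Fs n) \<omega>))\<^sup>2" for \<omega>
          using power2_norm_diff_triangle[of "U \<omega>" "chaos_sum v F \<omega>" "chaos_sum v (Fs n) \<omega>"]
          by (simp only: norm_minus_commute[of "U \<omega>" "chaos_sum v (Fs n) \<omega>"]
              norm_minus_commute[of "chaos_sum v (Fs n) \<omega>" "chaos_sum v F \<omega>"])
      qed
      also have "\<dots> = 2 * expectation (\<lambda>\<omega>. (norm (chaos_sum v (Fs n) \<omega> - U \<omega>))\<^sup>2)
            + 2 * expectation (\<lambda>\<omega>. (norm (chaos_sum v F \<omega> - chaos_sum v (Fs n) \<omega>))\<^sup>2)"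
        using i intU by simp
      also have "\<dots> < d" using n tail[OF F] by linarith
      finally show ?thesis .
    qed
    then show "\<forall>\<^sub>F F in finite_subsets_at_top UNIV. dist (expectation (\<lambda>\<omega>. (norm (U \<omega> - chaos_sum v F \<omega>))\<^sup>2)) 0 < d"
      unfolding eventually_finite_subsets_at_top
      by (intro exI[of _ "Fs n"]) (simp add: Fs)
  qed
  have "has_chaos_expansion M e W U v"
    unfolding has_chaos_expansion_def
  proof
    have "(\<lambda>F. \<integral>\<^sup>+\<omega>. ennreal ((norm (U \<omega> - (\<Sum>\<alpha>\<in>F. chaos_basis e W \<alpha> \<omega> *\<^sub>R v \<alpha>)))\<^sup>2) \<partial>M)
        = (\<lambda>F. ennreal (expectation (\<lambda>\<omega>. (norm (U \<omega> - chaos_sum v F \<omega>))\<^sup>2)))"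
      unfolding chaos_sum_def[symmetric]
      by (intro ext nn_integral_eq_integral in_L2_integrable in_L2_diff chaos_sum_in_L2 U) simp
    then show "((\<lambda>F. \<integral>\<^sup>+\<omega>. ennreal ((norm (U \<omega> - (\<Sum>\<alpha>\<in>F. chaos_basis e W \<alpha> \<omega> *\<^sub>R v \<alpha>)))\<^sup>2) \<partial>M) \<longlongrightarrow> 0)
        (finite_subsets_at_top UNIV)"
      using tendsto_ennrealI[OF filt] by (simp only: ennreal_0)
  qed (rule U)
  moreover have "expectation (\<lambda>\<omega>. (norm (U \<omega>))\<^sup>2) \<le> R"
  proof -
    have R: "0 \<le> R" using bound[of "{}"] by simp
    \<comment> \<open>Letting \<delta> tend to 0 preserves the constant R, where the plain squared
      triangle inequality would double it.\<close>
    have le: "expectation (\<lambda>\<omega>. (norm (U \<omega>))\<^sup>2) \<le> (1 + \<delta>) * R" if \<delta>: "0 < \<delta>" for \<delta>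
    proof -
      have step: "expectation (\<lambda>\<omega>. (norm (U \<omega>))\<^sup>2)
          \<le> (1 + \<delta>) * R + (1 + 1 / \<delta>) * expectation (\<lambda>\<omega>. (norm (chaos_sum v (Fs n) \<omega> - U \<omega>))\<^sup>2)" for n
      proof -
        have i: "integrable M (\<lambda>\<omega>. (norm (chaos_sum v (Fs n) \<omega>))\<^sup>2)"
          by (rule in_L2_integrable[OF chaos_sum_in_L2])
        have "expectation (\<lambda>\<omega>. (norm (U \<omega>))\<^sup>2) \<le> expectation (\<lambda>\<omega>. (1 + \<delta>) * (norm (chaos_sum v (Fs n) \<omega>))\<^sup>2
            + (1 + 1 / \<delta>) * (norm (chaos_sum v (Fs n) \<omega> - U \<omega>))\<^sup>2)"
        proof (rule integral_mono)
          show "integrable M (\<lambda>\<omega>. (1 + \<delta>) * (norm (chaos_sum v (Fs n) \<omega>))\<^sup>2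
            + (1 + 1 / \<delta>) * (norm (chaos_sum v (Fs n) \<omega> - U \<omega>))\<^sup>2)"
            using i intU by simp
          show "(norm (U \<omega>))\<^sup>2 \<le> (1 + \<delta>) * (norm (chaos_sum v (Fs n) \<omega>))\<^sup>2
            + (1 + 1 / \<delta>) * (norm (chaos_sum v (Fs n) \<omega> - U \<omega>))\<^sup>2" for \<omega>
            using power2_norm_diff_weighted[OF \<delta>, of "U \<omega>" 0 "chaos_sum v (Fs n) \<omega>"]
            by (simp only: diff_zero norm_minus_commute[of "U \<omega>"])
        qed (rule in_L2_integrable[OF U])
        also have "\<dots> = (1 + \<delta>) * expectation (\<lambda>\<omega>. (norm (chaos_sum v (Fs n) \<omega>))\<^sup>2)
            + (1 + 1 / \<delta>) * expectation (\<lambda>\<omega>. (norm (chaos_sum v (Fs n) \<omega> - U \<omega>))\<^sup>2)"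
          using i intU by simp
        also have "\<dots> \<le> (1 + \<delta>) * R + (1 + 1 / \<delta>) * expectation (\<lambda>\<omega>. (norm (chaos_sum v (Fs n) \<omega> - U \<omega>))\<^sup>2)"
        proof (intro add_right_mono mult_left_mono)
          show "expectation (\<lambda>\<omega>. (norm (chaos_sum v (Fs n) \<omega>))\<^sup>2) \<le> R"
            unfolding expectation_chaos_sum[OF Fs] by (rule bound[OF Fs])
        qed (use \<delta> in simp)
        finally show ?thesis .
      qed
      have "(\<lambda>n. (1 + \<delta>) * R + (1 + 1 / \<delta>) * expectation (\<lambda>\<omega>. (norm (chaos_sum v (Fs n) \<omega> - U \<omega>))\<^sup>2))
          \<longlonglongrightarrow> (1 + \<delta>) * R + (1 + 1 / \<delta>) * 0"
        by (intro tendsto_intros lim)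
      from LIMSEQ_le_const[OF this] step show ?thesis by simp
    qed
    show ?thesis
    proof (rule field_le_epsilon)
      fix d :: real assume d: "0 < d"
      have "expectation (\<lambda>\<omega>. (norm (U \<omega>))\<^sup>2) \<le> (1 + d / (R + 1)) * R"
        using d R by (intro le) simp
      also have "\<dots> = R + d / (R + 1) * R" by (simp add: distrib_right)
      also have "d / (R + 1) * R \<le> d" using d R by (simp add: field_simps)
      finally show "expectation (\<lambda>\<omega>. (norm (U \<omega>))\<^sup>2) \<le> R + d" by simp
    qed
  qed
  ultimately show ?thesis by (rule that)
qed

end

section \<open>Weights and combinatorics of multi-indices\<close>

lemma countable_multi_index: "countable (UNIV :: multi_index set)"
proof (rule countableI')
  let ?g = "\<lambda>\<alpha> :: multi_index. (\<lambda>k. (k, Poly_Mapping.lookup \<alpha> k)) ` Poly_Mapping.keys \<alpha>"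
  have "\<alpha> = \<beta>" if eq: "?g \<alpha> = ?g \<beta>" for \<alpha> \<beta>
  proof (rule poly_mapping_eqI)
    fix k
    have "(k, n) \<in> ?g \<gamma> \<longleftrightarrow> n \<noteq> 0 \<and> Poly_Mapping.lookup \<gamma> k = n" for n \<gamma>
      by (auto simp: in_keys_iff)
    then show "Poly_Mapping.lookup \<alpha> k = Poly_Mapping.lookup \<beta> k" using eq by metis
  qed
  then have inj: "inj ?g" by (rule injI)
  have "countable (range ?g)"
    by (rule countable_subset[OF _ countable_Collect_finite]) auto
  then show "inj_on (to_nat_on (range ?g) \<circ> ?g) UNIV"
    by (intro comp_inj_on inj inj_on_to_nat_on)
qed

text \<open>Enumerate the multi-indices and damp the nth one by 2^-n / (1 + |N|): the weighted
  squares are then at most 4^-n. Thus membership in some weighted space imposes no growth condition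
  on the coefficients.\<close>

lemma chaos_weights_exist:
  obtains r where "chaos_weights r" "in_weighted_chaos r N"
proof -
  let ?n = "to_nat_on (UNIV :: multi_index set)"
  have inj: "inj ?n" by (rule inj_on_to_nat_on[OF countable_multi_index])
  define r where "r \<alpha> = (1/2) ^ ?n \<alpha> / (1 + \<bar>N \<alpha>\<bar>)" for \<alpha>
  have pos: "0 < 1 + \<bar>N \<alpha>\<bar>" for \<alpha> by (simp add: add_pos_nonneg)
  have "0 < r \<alpha>" for \<alpha> using pos by (simp add: r_def)
  moreover have "r \<alpha> \<le> 1" for \<alpha>
  proof -
    have "(1/2 :: real) ^ ?n \<alpha> \<le> 1" by (rule power_le_one) auto
    also have "1 \<le> 1 + \<bar>N \<alpha>\<bar>" by simp
    finally show ?thesis unfolding r_def using pos by (simp only: pos_divide_le_eq) simp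
  qed
  ultimately have "chaos_weights r" unfolding chaos_weights_def by blast
  moreover have "in_weighted_chaos r N"
    unfolding in_weighted_chaos_def
  proof (rule summable_on_comparison_test)
    have "(\<lambda>n::nat. (1/4 :: real) ^ n) summable_on UNIV"
      by (subst summable_on_UNIV_nonneg_real_iff) (auto intro: summable_geometric)
    then have "(\<lambda>n::nat. (1/4 :: real) ^ n) summable_on range ?n"
      by (rule summable_on_subset_banach) simp
    then show "((\<lambda>n. (1/4 :: real) ^ n) \<circ> ?n) summable_on UNIV"
      by (simp only: summable_on_reindex[OF inj])
    fix \<alpha>
    have "r \<alpha> * \<bar>N \<alpha>\<bar> \<le> (1/2) ^ ?n \<alpha>"
    proof -
      have "(1/2 :: real) ^ ?n \<alpha> * \<bar>N \<alpha>\<bar> \<le> (1/2) ^ ?n \<alpha> * (1 + \<bar>N \<alpha>\<bar>)" by (intro mult_left_mono) auto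
      then show ?thesis using pos unfolding r_def by (simp add: pos_divide_le_eq)
    qed
    then have "(r \<alpha> * \<bar>N \<alpha>\<bar>)\<^sup>2 \<le> ((1/2) ^ ?n \<alpha>)\<^sup>2"
      using \<open>0 < r \<alpha>\<close> by (intro power_mono) auto
    also have "((1/2) ^ ?n \<alpha>)\<^sup>2 = (1/4 :: real) ^ ?n \<alpha>"
      by (simp add: power2_eq_square flip: power_mult_distrib)
    finally show "(r \<alpha>)\<^sup>2 * (N \<alpha>)\<^sup>2 \<le> ((\<lambda>n. (1/4) ^ n) \<circ> ?n) \<alpha>"
      by (simp add: power_mult_distrib)
  qed simp
  ultimately show ?thesis by (rule that)
qed

subsection \<open>The chaos expansion of the solution\<close>

definition total_degree :: "multi_index \<Rightarrow> nat" where
  "total_degree \<alpha> = (\<Sum>k\<in>Poly_Mapping.keys \<alpha>. Poly_Mapping.lookup \<alpha> k)"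

lemma total_degree_eq_sum:
  assumes "finite K" "Poly_Mapping.keys \<alpha> \<subseteq> K"
  shows "total_degree \<alpha> = (\<Sum>k\<in>K. Poly_Mapping.lookup \<alpha> k)"
  unfolding total_degree_def using assms by (intro sum.mono_neutral_left) (auto simp: in_keys_iff)

lemma total_degree_eq_0: "total_degree \<alpha> = 0 \<longleftrightarrow> \<alpha> = 0"
proof
  assume "total_degree \<alpha> = 0"
  then have "Poly_Mapping.lookup \<alpha> k = 0" for k
    unfolding total_degree_def by (cases "k \<in> Poly_Mapping.keys \<alpha>") (auto simp: in_keys_iff)
  then show "\<alpha> = 0" by (intro poly_mapping_eqI) simp
qed (simp add: total_degree_def)

text \<open>Subtraction of multi-indices is truncated: at k in the support it can be undone and
  lowers the degree, while elsewhere it would change nothing.\<close>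

lemma lower_index:
  assumes "k \<in> Poly_Mapping.keys \<alpha>"
  shows "\<alpha> - Poly_Mapping.single k 1 + Poly_Mapping.single k 1 = \<alpha>"
    and "total_degree \<alpha> = Suc (total_degree (\<alpha> - Poly_Mapping.single k 1))"
proof -
  define \<beta> where "\<beta> = \<alpha> - Poly_Mapping.single k 1"
  have pos: "0 < Poly_Mapping.lookup \<alpha> k" using assms by (simp add: in_keys_iff)
  have lookup: "Poly_Mapping.lookup \<beta> l = (if l = k then Poly_Mapping.lookup \<alpha> l - 1 else Poly_Mapping.lookup \<alpha> l)" for l
    by (simp add: \<beta>_def lookup_minus lookup_single)
  show "\<alpha> - Poly_Mapping.single k 1 + Poly_Mapping.single k 1 = \<alpha>"
    unfolding \<beta>_def[symmetric]
    using pos by (intro poly_mapping_eqI) (auto simp: lookup lookup_add lookup_single when_def)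
  have "Poly_Mapping.keys \<beta> \<subseteq> Poly_Mapping.keys \<alpha>"
    by (auto simp: in_keys_iff lookup split: if_splits)
  then have "total_degree \<beta> = (\<Sum>l\<in>Poly_Mapping.keys \<alpha>. Poly_Mapping.lookup \<beta> l)"
    by (intro total_degree_eq_sum) auto
  then have "Suc (total_degree \<beta>) = Suc (Poly_Mapping.lookup \<beta> k + (\<Sum>l\<in>Poly_Mapping.keys \<alpha> - {k}. Poly_Mapping.lookup \<beta> l))"
    using assms by (simp add: sum.remove)
  also have "\<dots> = Poly_Mapping.lookup \<alpha> k + (\<Sum>l\<in>Poly_Mapping.keys \<alpha> - {k}. Poly_Mapping.lookup \<alpha> l)"
    using pos by (simp add: lookup)
  also have "\<dots> = total_degree \<alpha>" unfolding total_degree_def using assms by (simp add: sum.remove)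
  finally show "total_degree \<alpha> = Suc (total_degree (\<alpha> - Poly_Mapping.single k 1))"
    by (simp only: \<beta>_def)
qed

text \<open>The map from (\<alpha>, k) to (\<alpha> - \<open>single k 1\<close>, k) is injective for
  k in the support of \<alpha>, so the double sum is part of the product of the two sums. With b k =
  (c k)^2 this is how \<open>C\<^sub>M\<close> enters the estimate.\<close>

lemma sum_lower_index_le:
  fixes a :: "multi_index \<Rightarrow> real" and b :: "nat \<Rightarrow> real"
  assumes F: "finite F" "F \<subseteq> {\<alpha>. total_degree \<alpha> = Suc n}" and a: "\<And>\<beta>. 0 \<le> a \<beta>" and b: "\<And>k. 0 \<le> b k"
    and K: "\<And>G. finite G \<Longrightarrow> G \<subseteq> {\<beta>. total_degree \<beta> = n} \<Longrightarrow> sum a G \<le> S"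
    and B: "\<And>J. finite J \<Longrightarrow> sum b J \<le> C"
  shows "(\<Sum>\<alpha>\<in>F. \<Sum>k\<in>Poly_Mapping.keys \<alpha>. b k * a (\<alpha> - Poly_Mapping.single k 1)) \<le> C * S"
proof -
  let ?P = "SIGMA \<alpha>:F. Poly_Mapping.keys \<alpha>"
  let ?h = "\<lambda>(\<alpha>, k). (\<alpha> - Poly_Mapping.single k 1, k)"
  define G where "G = fst ` ?h ` ?P"
  define J where "J = snd ` ?h ` ?P"
  have fin: "finite ?P" using F(1) by simp
  then have G: "finite G" and J: "finite J" by (simp_all add: G_def J_def)
  have inj: "inj_on ?h ?P"
  proof (rule inj_onI)
    fix p q assume p: "p \<in> ?P" and q: "q \<in> ?P" and eq: "?h p = ?h q"
    obtain \<alpha> k \<beta> l where pq: "p = (\<alpha>, k)" "q = (\<beta>, l)" by (cases p, cases q)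
    have "k = l" "\<alpha> - Poly_Mapping.single k 1 = \<beta> - Poly_Mapping.single k 1" using eq by (auto simp: pq)
    moreover have "k \<in> Poly_Mapping.keys \<alpha>" "l \<in> Poly_Mapping.keys \<beta>" using p q by (auto simp: pq)
    ultimately have "\<alpha> = \<beta>" using lower_index(1)[of k \<alpha>] lower_index(1)[of l \<beta>] by simp
    with \<open>k = l\<close> show "p = q" by (simp add: pq)
  qed
  have "(\<Sum>\<alpha>\<in>F. \<Sum>k\<in>Poly_Mapping.keys \<alpha>. b k * a (\<alpha> - Poly_Mapping.single k 1))
      = (\<Sum>p\<in>?P. (\<lambda>(\<beta>, k). b k * a \<beta>) (?h p))"
    using F(1) by (simp add: sum.Sigma case_prod_unfold)
  also have "\<dots> = (\<Sum>(\<beta>, k)\<in>?h ` ?P. b k * a \<beta>)"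
    using inj by (simp add: sum.reindex)
  also have "\<dots> \<le> (\<Sum>(\<beta>, k)\<in>G \<times> J. b k * a \<beta>)"
  proof (rule sum_mono2)
    show "finite (G \<times> J)" using G J by simp
    show "?h ` ?P \<subseteq> G \<times> J" unfolding G_def J_def by force
    show "0 \<le> (case p of (\<beta>, k) \<Rightarrow> b k * a \<beta>)" for p
      using a b by (cases p) simp
  qed
  also have "\<dots> = sum b J * sum a G"
    by (simp add: sum.cartesian_product[symmetric] sum_product sum.swap[of _ G] mult.commute)
  also have "\<dots> \<le> C * S"
  proof (rule mult_mono)
    have "G \<subseteq> {\<beta>. total_degree \<beta> = n}"
    proof
      fix \<beta> assume "\<beta> \<in> G"
      then obtain \<alpha> k where "\<alpha> \<in> F" "k \<in> Poly_Mapping.keys \<alpha>" "\<beta> = \<alpha> - Poly_Mapping.single k 1"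
        unfolding G_def by auto
      then show "\<beta> \<in> {\<beta>. total_degree \<beta> = n}" using F(2) lower_index(2)[of k \<alpha>] by auto
    qed
    then show "sum a G \<le> S" by (rule K[OF G])
    show "0 \<le> C" using B[of "{}"] by simp
  qed (use B[OF J] a in \<open>auto intro: sum_nonneg\<close>)
  finally show ?thesis .
qed

section \<open>The triangular system for the coefficients\<close>

context coercive_evolution
begin

text \<open>Formed in H, before j is applied, so that it can serve as the H-valued part h in the
  energy inequality.\<close>

definition noise_term :: "(nat \<Rightarrow> 'h \<Rightarrow> 'h) \<Rightarrow> (multi_index \<Rightarrow> real \<Rightarrow> 'h) \<Rightarrow> multi_index \<Rightarrow> real \<Rightarrow> 'h" where
  "noise_term B u \<alpha> s = (\<Sum>k\<in>Poly_Mapping.keys \<alpha>. sqrt (real (Poly_Mapping.lookup \<alpha> k)) *\<^sub>R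
      B k (u (\<alpha> - Poly_Mapping.single k 1) s))"

lemma noise_term_cong:
  assumes "\<And>\<beta>. Suc (total_degree \<beta>) = total_degree \<alpha> \<Longrightarrow> u \<beta> s = u' \<beta> s"
  shows "noise_term B u \<alpha> s = noise_term B u' \<alpha> s"
  unfolding noise_term_def using lower_index(2) assms by (intro sum.cong refl) (metis (no_types, lifting))

lemma noise_term_continuous:
  assumes "\<And>k. bounded_linear (B k)" and "\<And>\<beta>. Suc (total_degree \<beta>) = total_degree \<alpha> \<Longrightarrow> continuous_on S (u \<beta>)"
  shows "continuous_on S (noise_term B u \<alpha>)"
  unfolding noise_term_def[abs_def]
proof (intro continuous_intros bounded_linear.continuous_on[OF assms(1)])
  fix k assume "k \<in> Poly_Mapping.keys \<alpha>"
  then show "continuous_on S (\<lambda>s. u (\<alpha> - Poly_Mapping.single k 1) s)"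
    by (intro assms(2) lower_index(2)[symmetric])
qed

text \<open>For \<alpha> different from 0 the energy inequality is used with h equal to the noise
  term, which leaves no V'-valued remainder; for \<alpha> = 0 it is used with h = 0 and all of f in
  the remainder.\<close>

lemma chaos_coefficients_exist:
  fixes f :: "real \<Rightarrow> 'w" and x :: 'h
  assumes T: "0 < T" and B: "\<And>k. bounded_linear (B k)" and f: "in_L2 (lebesgue_on {0..T}) f"
  obtains u v where
    "\<And>\<alpha>. evolution_solution T (\<lambda>s. (if \<alpha> = 0 then f s else 0) + j (noise_term B u \<alpha> s))
        (if \<alpha> = 0 then x else 0) (u \<alpha>) (v \<alpha>)"
    "\<And>\<nu> t. 0 < \<nu> \<Longrightarrow> t \<in> {0..T} \<Longrightarrow> exp (- (2 * \<bar>C\<^sub>A\<bar> + \<nu>) * t) * (norm (u 0 t))\<^sup>2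
        \<le> (norm x)\<^sup>2 + D\<^sup>2 / \<kappa> * integral {0..t} (\<lambda>s. exp (- (2 * \<bar>C\<^sub>A\<bar> + \<nu>) * s) * (norm (f s))\<^sup>2)"
    "\<And>\<alpha> \<nu> t. \<alpha> \<noteq> 0 \<Longrightarrow> 0 < \<nu> \<Longrightarrow> t \<in> {0..T} \<Longrightarrow> exp (- (2 * \<bar>C\<^sub>A\<bar> + \<nu>) * t) * (norm (u \<alpha> t))\<^sup>2
        \<le> integral {0..t} (\<lambda>s. exp (- (2 * \<bar>C\<^sub>A\<bar> + \<nu>) * s) * (norm (noise_term B u \<alpha> s))\<^sup>2) / \<nu>"
proof -
  define good where "good F x p \<longleftrightarrow> evolution_solution T F x (fst p) (snd p) \<and>
    (\<forall>h \<nu> t. continuous_on {0..T} h \<longrightarrow> 0 < \<nu> \<longrightarrow> t \<in> {0..T} \<longrightarrow>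
       exp (- (2 * \<bar>C\<^sub>A\<bar> + \<nu>) * t) * (norm (fst p t))\<^sup>2 \<le> (norm x)\<^sup>2
         + integral {0..t} (\<lambda>s. exp (- (2 * \<bar>C\<^sub>A\<bar> + \<nu>) * s) * (norm (h s))\<^sup>2) / \<nu>
         + D\<^sup>2 / \<kappa> * integral {0..t} (\<lambda>s. exp (- (2 * \<bar>C\<^sub>A\<bar> + \<nu>) * s) * (norm (F s - j (h s)))\<^sup>2))"
    for F x and p :: "(real \<Rightarrow> 'h) \<times> (real \<Rightarrow> 'v)"
  \<comment> \<open>A single choice fixes the solution together with its energy inequality, so both
    hold for the same pair.\<close>
  define Sol where "Sol F x = (SOME p. good F x p)" for F x
  have Sol: "good F x (Sol F x)" if F: "in_L2 (lebesgue_on {0..T}) F" for F x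
  proof (rule evolution_solution_exists[OF T F, of x])
    fix u v
    assume uv: "evolution_solution T F x u v"
      "\<And>h \<nu> t. continuous_on {0..T} h \<Longrightarrow> 0 < \<nu> \<Longrightarrow> t \<in> {0..T} \<Longrightarrow>
       exp (- (2 * \<bar>C\<^sub>A\<bar> + \<nu>) * t) * (norm (u t))\<^sup>2 \<le> (norm x)\<^sup>2
         + integral {0..t} (\<lambda>s. exp (- (2 * \<bar>C\<^sub>A\<bar> + \<nu>) * s) * (norm (h s))\<^sup>2) / \<nu>
         + D\<^sup>2 / \<kappa> * integral {0..t} (\<lambda>s. exp (- (2 * \<bar>C\<^sub>A\<bar> + \<nu>) * s) * (norm (F s - j (h s)))\<^sup>2)"
    have "good F x (u, v)"
      unfolding good_def fst_conv snd_conv using uv(1) by (intro conjI allI impI uv(2))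
    then show ?thesis unfolding Sol_def by (rule someI)
  qed
  define rhs where "rhs u \<alpha> = (\<lambda>s. (if \<alpha> = 0 then f s else 0) + j (noise_term B u \<alpha> s))" for u \<alpha>
  define x0 where "x0 \<alpha> = (if \<alpha> = 0 then x else 0)" for \<alpha> :: multi_index
  \<comment> \<open>\<open>L n\<close> assigns a candidate to every multi-index, but only its values
    in degree n matter: the noise term at \<alpha> looks only at indices of degree one less, so
    level n is solved with level n - 1 inserted.\<close>
  define L where "L = rec_nat (\<lambda>\<alpha>. Sol (rhs (\<lambda>_ _. 0) \<alpha>) (x0 \<alpha>)) (\<lambda>n prev \<alpha>. Sol (rhs (\<lambda>\<beta>. fst (prev \<beta>)) \<alpha>) (x0 \<alpha>))"
  have L0: "L 0 \<alpha> = Sol (rhs (\<lambda>_ _. 0) \<alpha>) (x0 \<alpha>)"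
    and LS: "L (Suc n) \<alpha> = Sol (rhs (\<lambda>\<beta>. fst (L n \<beta>)) \<alpha>) (x0 \<alpha>)" for n \<alpha>
    unfolding L_def by simp_all
  define p where "p \<alpha> = L (total_degree \<alpha>) \<alpha>" for \<alpha>
  define u where "u \<alpha> = fst (p \<alpha>)" for \<alpha>
  define v where "v \<alpha> = snd (p \<alpha>)" for \<alpha>
  have p_eq: "p \<alpha> = Sol (rhs u \<alpha>) (x0 \<alpha>)" for \<alpha>
  proof (cases "total_degree \<alpha>")
    case 0
    have "rhs (\<lambda>_ _. 0) \<alpha> = rhs u \<alpha>"
      unfolding rhs_def using 0 by (intro ext arg_cong2[where f="(+)"] arg_cong[where f=j] noise_term_cong refl) simp
    then show ?thesis unfolding p_def 0 L0 by simp
  next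
    case (Suc n)
    have "rhs (\<lambda>\<beta>. fst (L n \<beta>)) \<alpha> = rhs u \<alpha>"
      unfolding rhs_def
    proof (intro ext arg_cong2[where f="(+)"] arg_cong[where f=j] noise_term_cong refl)
      fix \<beta> s assume "Suc (total_degree \<beta>) = total_degree \<alpha>"
      then show "fst (L n \<beta>) s = u \<beta> s" unfolding u_def p_def using Suc by simp
    qed
    then show ?thesis unfolding p_def Suc LS by simp
  qed
  have f0: "in_L2 (lebesgue_on {0..T}) (\<lambda>s. if \<alpha> = 0 then f s else 0)" for \<alpha> :: multi_index
    using f by (cases "\<alpha> = 0") (auto intro: in_L2_continuous continuous_on_const)
  have rhs_L2: "in_L2 (lebesgue_on {0..T}) (rhs u \<alpha>)" if "continuous_on {0..T} (noise_term B u \<alpha>)" for \<alpha>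
    unfolding rhs_def
    by (intro lebesgue_on_interval.in_L2_add f0 in_L2_continuous j.continuous_on that)
  \<comment> \<open>\<open>Sol\<close> delivers a solution only for square integrable right-hand
    sides, so continuity is propagated by degree before its guarantee is available for every
    \<alpha>.\<close>
  have u_cont: "continuous_on {0..T} (u \<alpha>)" for \<alpha>
  proof (induction "total_degree \<alpha>" arbitrary: \<alpha> rule: less_induct)
    case less
    have "continuous_on {0..T} (noise_term B u \<alpha>)"
      by (rule noise_term_continuous[OF B]) (rule less, simp)
    then have "good (rhs u \<alpha>) (x0 \<alpha>) (p \<alpha>)" unfolding p_eq[of \<alpha>] by (intro Sol rhs_L2)
    then show ?case unfolding good_def evolution_solution_def u_def by blast
  qed
  have nc: "continuous_on {0..T} (noise_term B u \<alpha>)" for \<alpha>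
    by (rule noise_term_continuous[OF B u_cont])
  have good: "good (rhs u \<alpha>) (x0 \<alpha>) (p \<alpha>)" for \<alpha>
    by (subst p_eq) (intro Sol rhs_L2 nc)
  show ?thesis
  proof (rule that)
    show "evolution_solution T (\<lambda>s. (if \<alpha> = 0 then f s else 0) + j (noise_term B u \<alpha> s))
        (if \<alpha> = 0 then x else 0) (u \<alpha>) (v \<alpha>)" for \<alpha>
      using good[of \<alpha>] unfolding good_def rhs_def x0_def u_def v_def by (rule conjunct1)
    have est: "exp (- (2 * \<bar>C\<^sub>A\<bar> + \<nu>) * t) * (norm (u \<alpha> t))\<^sup>2 \<le> (norm (x0 \<alpha>))\<^sup>2
         + integral {0..t} (\<lambda>s. exp (- (2 * \<bar>C\<^sub>A\<bar> + \<nu>) * s) * (norm (h s))\<^sup>2) / \<nu>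
         + D\<^sup>2 / \<kappa> * integral {0..t} (\<lambda>s. exp (- (2 * \<bar>C\<^sub>A\<bar> + \<nu>) * s) * (norm (rhs u \<alpha> s - j (h s)))\<^sup>2)"
      if "continuous_on {0..T} h" "0 < \<nu>" "t \<in> {0..T}" for h \<nu> t \<alpha>
      using good[of \<alpha>] that unfolding good_def u_def by blast
    show "exp (- (2 * \<bar>C\<^sub>A\<bar> + \<nu>) * t) * (norm (u 0 t))\<^sup>2
        \<le> (norm x)\<^sup>2 + D\<^sup>2 / \<kappa> * integral {0..t} (\<lambda>s. exp (- (2 * \<bar>C\<^sub>A\<bar> + \<nu>) * s) * (norm (f s))\<^sup>2)"
      if "0 < \<nu>" "t \<in> {0..T}" for \<nu> t
      using est[OF continuous_on_const[of _ 0] that, of 0]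
      by (simp add: rhs_def x0_def noise_term_def j.zero)
    show "exp (- (2 * \<bar>C\<^sub>A\<bar> + \<nu>) * t) * (norm (u \<alpha> t))\<^sup>2
        \<le> integral {0..t} (\<lambda>s. exp (- (2 * \<bar>C\<^sub>A\<bar> + \<nu>) * s) * (norm (noise_term B u \<alpha> s))\<^sup>2) / \<nu>"
      if "\<alpha> \<noteq> 0" "0 < \<nu>" "t \<in> {0..T}" for \<alpha> \<nu> t
      using est[OF nc[of \<alpha>] that(2,3), of \<alpha>] that(1) by (simp add: rhs_def x0_def)
  qed
qed

lemma norm_noise_term_le:
  assumes B: "\<And>k. bounded_linear (B k)" "\<And>k. onorm (B k) \<le> c k"
  shows "(norm (noise_term B u \<alpha> s))\<^sup>2
    \<le> real (total_degree \<alpha>) * (\<Sum>k\<in>Poly_Mapping.keys \<alpha>. (c k)\<^sup>2 * (norm (u (\<alpha> - Poly_Mapping.single k 1) s))\<^sup>2)"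
proof -
  let ?K = "Poly_Mapping.keys \<alpha>" and ?r = "\<lambda>k. sqrt (real (Poly_Mapping.lookup \<alpha> k))"
    and ?y = "\<lambda>k. u (\<alpha> - Poly_Mapping.single k 1) s"
  have "norm (noise_term B u \<alpha> s) \<le> (\<Sum>k\<in>?K. norm (?r k *\<^sub>R B k (?y k)))"
    unfolding noise_term_def by (rule norm_sum)
  also have "\<dots> \<le> (\<Sum>k\<in>?K. ?r k * (c k * norm (?y k)))"
  proof (rule sum_mono)
    fix k
    have "norm (B k (?y k)) \<le> onorm (B k) * norm (?y k)" by (rule onorm[OF B(1)])
    also have "\<dots> \<le> c k * norm (?y k)" using B(2) by (rule mult_right_mono) simp
    finally show "norm (?r k *\<^sub>R B k (?y k)) \<le> ?r k * (c k * norm (?y k))"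
      by (simp add: mult_left_mono)
  qed
  finally have "(norm (noise_term B u \<alpha> s))\<^sup>2 \<le> (\<Sum>k\<in>?K. ?r k * (c k * norm (?y k)))\<^sup>2"
    by (rule power_mono) simp
  also have "\<dots> \<le> (\<Sum>k\<in>?K. (?r k)\<^sup>2) * (\<Sum>k\<in>?K. (c k * norm (?y k))\<^sup>2)"
    by (rule Cauchy_Schwarz_ineq_sum)
  also have "(\<Sum>k\<in>?K. (?r k)\<^sup>2) = real (total_degree \<alpha>)" by (simp add: total_degree_def)
  finally show ?thesis by (simp add: power_mult_distrib)
qed

end

section \<open>Summation over all multi-indices and uniqueness\<close>

context coercive_evolution
begin

text \<open>Summing the energy inequality over all multi-indices of total degree \<open>n\<close>, each step of the
  induction contributes a factor \<open>(n + 1) C\<^sub>M / \<nu>\<close>, and the time integral of \<open>s\<^sup>n\<close> removes \<open>n + 1\<close>.\<close>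

lemma chaos_coefficients_bound:
  fixes u :: "multi_index \<Rightarrow> real \<Rightarrow> 'h" and K :: real
  assumes B: "\<And>k. bounded_linear (B k)" "\<And>k. onorm (B k) \<le> c k" and c: "(\<lambda>k. (c k)\<^sup>2) sums C\<^sub>M"
    and u_cont: "\<And>\<alpha>. continuous_on {0..\<tau>} (u \<alpha>)" and "0 < \<nu>"
    and zero: "\<And>t. t \<in> {0..\<tau>} \<Longrightarrow> exp (- (2 * \<bar>C\<^sub>A\<bar> + \<nu>) * t) * (norm (u 0 t))\<^sup>2 \<le> K"
    and step: "\<And>\<alpha> t. \<alpha> \<noteq> 0 \<Longrightarrow> t \<in> {0..\<tau>} \<Longrightarrow> exp (- (2 * \<bar>C\<^sub>A\<bar> + \<nu>) * t) * (norm (u \<alpha> t))\<^sup>2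
        \<le> integral {0..t} (\<lambda>s. exp (- (2 * \<bar>C\<^sub>A\<bar> + \<nu>) * s) * (norm (noise_term B u \<alpha> s))\<^sup>2) / \<nu>"
    and F: "finite F" "F \<subseteq> {\<alpha>. total_degree \<alpha> = n}" and t: "t \<in> {0..\<tau>}"
  shows "(\<Sum>\<alpha>\<in>F. exp (- (2 * \<bar>C\<^sub>A\<bar> + \<nu>) * t) * (norm (u \<alpha> t))\<^sup>2) \<le> K * (C\<^sub>M * t / \<nu>) ^ n"
proof -
  define E where "E s = exp (- (2 * \<bar>C\<^sub>A\<bar> + \<nu>) * s)" for s
  have E: "0 \<le> E s" for s by (simp add: E_def)
  have E_cont: "continuous_on S E" for S unfolding E_def[abs_def] by (intro continuous_intros)
  have "0 \<le> E 0 * (norm (u 0 0))\<^sup>2" using E by simp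
  also have "\<dots> \<le> K" using zero[of 0] t unfolding E_def by auto
  finally have K: "0 \<le> K" .
  have "\<forall>F t. finite F \<longrightarrow> F \<subseteq> {\<alpha>. total_degree \<alpha> = n} \<longrightarrow> t \<in> {0..\<tau>} \<longrightarrow>
      (\<Sum>\<alpha>\<in>F. E t * (norm (u \<alpha> t))\<^sup>2) \<le> K * (C\<^sub>M * t / \<nu>) ^ n"
  proof (induction n)
    case 0
    show ?case
    proof (intro allI impI)
      fix F t assume "finite F" "F \<subseteq> {\<alpha>. total_degree \<alpha> = 0}" and t: "t \<in> {0..\<tau>}"
      then have "F \<subseteq> {0}" by (auto simp: total_degree_eq_0)
      then have "(\<Sum>\<alpha>\<in>F. E t * (norm (u \<alpha> t))\<^sup>2) \<le> (\<Sum>\<alpha>\<in>{0}. E t * (norm (u \<alpha> t))\<^sup>2)"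
        using E by (intro sum_mono2) auto
      also have "\<dots> \<le> K" using zero[OF t] by (simp add: E_def)
      finally show "(\<Sum>\<alpha>\<in>F. E t * (norm (u \<alpha> t))\<^sup>2) \<le> K * (C\<^sub>M * t / \<nu>) ^ 0" by simp
    qed
  next
    case (Suc n)
    show ?case
    proof (intro allI impI)
      fix F t assume F: "finite F" "F \<subseteq> {\<alpha>. total_degree \<alpha> = Suc n}" and t: "t \<in> {0..\<tau>}"
      have ucont: "continuous_on {0..t} (u \<alpha>)" for \<alpha>
        using t by (intro continuous_on_subset[OF u_cont]) auto
      have nc: "continuous_on {0..t} (noise_term B u \<alpha>)" for \<alpha>
        by (rule noise_term_continuous[OF B(1) ucont])
      have int: "(\<lambda>s. E s * (norm (noise_term B u \<alpha> s))\<^sup>2) integrable_on {0..t}" for \<alpha>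
        by (intro integrable_continuous_interval continuous_intros E_cont nc)
      \<comment> \<open>Q s^n bounds the noise energy of level n + 1 at time s: n + 1 from Cauchy's
        inequality, \<open>C\<^sub>M\<close> from the shifted sum, and the induction hypothesis with
        its power of s split off.\<close>
      define Q where "Q = real (Suc n) * (C\<^sub>M * (K * (C\<^sub>M / \<nu>) ^ n))"
      have pow: "((\<lambda>s. Q * s ^ n) has_integral (Q * (t ^ Suc n / real (Suc n)))) {0..t}"
      proof (rule has_integral_mult_right)
        have "((\<lambda>s. s ^ n) has_integral (t ^ Suc n / real (Suc n) - 0 ^ Suc n / real (Suc n))) {0..t}"
        proof (rule fundamental_theorem_of_calculus)
          fix s :: real
          have "((\<lambda>s. s ^ Suc n / real (Suc n)) has_real_derivative s ^ n) (at s within {0..t})"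
            by (rule derivative_eq_intros refl | simp add: field_simps del: of_nat_Suc)+
          then show "((\<lambda>s. s ^ Suc n / real (Suc n)) has_vector_derivative s ^ n) (at s within {0..t})"
            by (simp only: has_real_derivative_iff_has_vector_derivative)
        qed (use t in simp)
        then show "((\<lambda>s. s ^ n) has_integral (t ^ Suc n / real (Suc n))) {0..t}" by simp
      qed
      have pointwise: "(\<Sum>\<alpha>\<in>F. E s * (norm (noise_term B u \<alpha> s))\<^sup>2) \<le> Q * s ^ n" if s: "s \<in> {0..t}" for s
      proof -
        have s': "s \<in> {0..\<tau>}" using s t by auto
        have "(\<Sum>\<alpha>\<in>F. E s * (norm (noise_term B u \<alpha> s))\<^sup>2)
            \<le> (\<Sum>\<alpha>\<in>F. real (Suc n) * (\<Sum>k\<in>Poly_Mapping.keys \<alpha>. (c k)\<^sup>2 * (E s * (norm (u (\<alpha> - Poly_Mapping.single k 1) s))\<^sup>2)))"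
        proof (rule sum_mono)
          fix \<alpha> assume "\<alpha> \<in> F"
          then have deg: "total_degree \<alpha> = Suc n" using F(2) by auto
          have "E s * (norm (noise_term B u \<alpha> s))\<^sup>2
              \<le> E s * (real (Suc n) * (\<Sum>k\<in>Poly_Mapping.keys \<alpha>. (c k)\<^sup>2 * (norm (u (\<alpha> - Poly_Mapping.single k 1) s))\<^sup>2))"
            using norm_noise_term_le[OF B, where u=u and \<alpha>=\<alpha> and s=s] unfolding deg by (intro mult_left_mono E)
          also have "\<dots> = real (Suc n) * (\<Sum>k\<in>Poly_Mapping.keys \<alpha>. (c k)\<^sup>2 * (E s * (norm (u (\<alpha> - Poly_Mapping.single k 1) s))\<^sup>2))"
            by (simp only: sum_distrib_left mult.left_commute)
          finally show "E s * (norm (noise_term B u \<alpha> s))\<^sup>2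
            \<le> real (Suc n) * (\<Sum>k\<in>Poly_Mapping.keys \<alpha>. (c k)\<^sup>2 * (E s * (norm (u (\<alpha> - Poly_Mapping.single k 1) s))\<^sup>2))" .
        qed
        also have "\<dots> = real (Suc n) * (\<Sum>\<alpha>\<in>F. \<Sum>k\<in>Poly_Mapping.keys \<alpha>. (c k)\<^sup>2 * (E s * (norm (u (\<alpha> - Poly_Mapping.single k 1) s))\<^sup>2))"
          by (rule sum_distrib_left[symmetric])
        also have "\<dots> \<le> real (Suc n) * (C\<^sub>M * (K * (C\<^sub>M * s / \<nu>) ^ n))"
        proof (intro mult_left_mono sum_lower_index_le[OF F])
          show "sum (\<lambda>k. (c k)\<^sup>2) J \<le> C\<^sub>M" if "finite J" for J
            using sum_le_suminf[of "\<lambda>k. (c k)\<^sup>2" J] c that by (simp add: sums_iff)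
          show "(\<Sum>\<beta>\<in>G. E s * (norm (u \<beta> s))\<^sup>2) \<le> K * (C\<^sub>M * s / \<nu>) ^ n"
            if "finite G" "G \<subseteq> {\<beta>. total_degree \<beta> = n}" for G
            using Suc.IH that s' by blast
        qed (use E in auto)
        also have "\<dots> = Q * s ^ n"
          unfolding Q_def times_divide_eq_left[symmetric] power_mult_distrib by (simp only: mult_ac)
        finally show ?thesis .
      qed
      have "(\<Sum>\<alpha>\<in>F. E t * (norm (u \<alpha> t))\<^sup>2)
          \<le> (\<Sum>\<alpha>\<in>F. integral {0..t} (\<lambda>s. E s * (norm (noise_term B u \<alpha> s))\<^sup>2) / \<nu>)"
      proof (rule sum_mono)
        fix \<alpha> assume "\<alpha> \<in> F"
        then have "\<alpha> \<noteq> 0" using F(2) by (auto simp: total_degree_def)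
        then show "E t * (norm (u \<alpha> t))\<^sup>2 \<le> integral {0..t} (\<lambda>s. E s * (norm (noise_term B u \<alpha> s))\<^sup>2) / \<nu>"
          using t unfolding E_def by (rule step)
      qed
      also have "\<dots> = integral {0..t} (\<lambda>s. \<Sum>\<alpha>\<in>F. E s * (norm (noise_term B u \<alpha> s))\<^sup>2) / \<nu>"
        by (simp only: sum_divide_distrib[symmetric] integral_sum[OF F(1) int])
      also have "\<dots> \<le> (Q * (t ^ Suc n / real (Suc n))) / \<nu>"
      proof (intro divide_right_mono)
        show "integral {0..t} (\<lambda>s. \<Sum>\<alpha>\<in>F. E s * (norm (noise_term B u \<alpha> s))\<^sup>2) \<le> Q * (t ^ Suc n / real (Suc n))"
          using integral_le[OF integrable_sum[OF F(1) int] has_integral_integrable[OF pow] pointwise]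
          unfolding integral_unique[OF pow] .
      qed (use \<open>0 < \<nu>\<close> in simp)
      also have "\<dots> = K * (C\<^sub>M * t / \<nu>) ^ Suc n"
        using \<open>0 < \<nu>\<close> unfolding Q_def by (simp add: field_simps power_mult_distrib power_divide del: of_nat_Suc)
      finally show "(\<Sum>\<alpha>\<in>F. E t * (norm (u \<alpha> t))\<^sup>2) \<le> K * (C\<^sub>M * t / \<nu>) ^ Suc n" .
    qed
  qed
  then show ?thesis using F t unfolding E_def by blast
qed

text \<open>By induction on the degree the two noise terms agree, so the difference of the
  coefficients solves the homogeneous equation with zero initial value.\<close>

lemma chaos_solution_unique:
  assumes u: "chaos_solution i j T A B f x u" and u': "chaos_solution i j T A B f x u'"
  shows "\<forall>t\<in>{0..T}. u' \<alpha> t = u \<alpha> t"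
proof -
  obtain v where u_cont: "\<And>\<alpha>. continuous_on {0..T} (u \<alpha>)" and v: "\<And>\<alpha>. in_L2 (lebesgue_on {0..T}) (v \<alpha>)"
    and iv: "\<And>\<alpha>. AE s in lebesgue_on {0..T}. i (v \<alpha> s) = u \<alpha> s"
    and eq: "\<And>\<alpha> t. t \<in> {0..T} \<Longrightarrow> ((\<lambda>s. A (v \<alpha> s) + (if \<alpha> = 0 then f s else 0) +
         (\<Sum>k\<in>Poly_Mapping.keys \<alpha>. sqrt (real (Poly_Mapping.lookup \<alpha> k)) *\<^sub>R j (B k (u (\<alpha> - Poly_Mapping.single k 1) s))))
         has_integral (j (u \<alpha> t) - (if \<alpha> = 0 then j x else 0))) {0..t}"
    using u unfolding chaos_solution_def by blast
  obtain v' where u'_cont: "\<And>\<alpha>. continuous_on {0..T} (u' \<alpha>)" and v': "\<And>\<alpha>. in_L2 (lebesgue_on {0..T}) (v' \<alpha>)"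
    and iv': "\<And>\<alpha>. AE s in lebesgue_on {0..T}. i (v' \<alpha> s) = u' \<alpha> s"
    and eq': "\<And>\<alpha> t. t \<in> {0..T} \<Longrightarrow> ((\<lambda>s. A (v' \<alpha> s) + (if \<alpha> = 0 then f s else 0) +
         (\<Sum>k\<in>Poly_Mapping.keys \<alpha>. sqrt (real (Poly_Mapping.lookup \<alpha> k)) *\<^sub>R j (B k (u' (\<alpha> - Poly_Mapping.single k 1) s))))
         has_integral (j (u' \<alpha> t) - (if \<alpha> = 0 then j x else 0))) {0..t}"
    using u' unfolding chaos_solution_def by blast
  show ?thesis
  proof (induction "total_degree \<alpha>" arbitrary: \<alpha> rule: less_induct)
    case less
    show ?case
    proof
      fix t assume t: "t \<in> {0..T}"
      have "u' \<alpha> t - u \<alpha> t = 0"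
      proof (rule evolution_solution_zero[where u="\<lambda>t. u' \<alpha> t - u \<alpha> t" and v="\<lambda>s. v' \<alpha> s - v \<alpha> s", OF _ _ _ _ t])
        show "continuous_on {0..T} (\<lambda>t. u' \<alpha> t - u \<alpha> t)" by (intro continuous_intros u_cont u'_cont)
        show "in_L2 (lebesgue_on {0..T}) (\<lambda>s. v' \<alpha> s - v \<alpha> s)"
          by (intro lebesgue_on_interval.in_L2_diff v v')
        show "AE s in lebesgue_on {0..T}. i (v' \<alpha> s - v \<alpha> s) = u' \<alpha> s - u \<alpha> s"
          using iv[of \<alpha>] iv'[of \<alpha>] by eventually_elim (simp add: i.diff)
        fix t assume t: "t \<in> {0..T}"
        have lower: "(\<Sum>k\<in>Poly_Mapping.keys \<alpha>. sqrt (real (Poly_Mapping.lookup \<alpha> k)) *\<^sub>R j (B k (u' (\<alpha> - Poly_Mapping.single k 1) s)))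
           = (\<Sum>k\<in>Poly_Mapping.keys \<alpha>. sqrt (real (Poly_Mapping.lookup \<alpha> k)) *\<^sub>R j (B k (u (\<alpha> - Poly_Mapping.single k 1) s)))"
          if "s \<in> {0..t}" for s
        proof (intro sum.cong refl)
          fix k assume k: "k \<in> Poly_Mapping.keys \<alpha>"
          have "s \<in> {0..T}" using that t by auto
          then have "u' (\<alpha> - Poly_Mapping.single k 1) s = u (\<alpha> - Poly_Mapping.single k 1) s"
            using less[of "\<alpha> - Poly_Mapping.single k 1"] lower_index(2)[OF k] by simp
          then show "sqrt (real (Poly_Mapping.lookup \<alpha> k)) *\<^sub>R j (B k (u' (\<alpha> - Poly_Mapping.single k 1) s))
            = sqrt (real (Poly_Mapping.lookup \<alpha> k)) *\<^sub>R j (B k (u (\<alpha> - Poly_Mapping.single k 1) s))" by simp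
        qed
        have "((\<lambda>s. A (v' \<alpha> s - v \<alpha> s)) has_integral
           ((j (u' \<alpha> t) - (if \<alpha> = 0 then j x else 0)) - (j (u \<alpha> t) - (if \<alpha> = 0 then j x else 0)))) {0..t}"
          by (rule has_integral_eq[OF _ has_integral_diff[OF eq'[OF t] eq[OF t]]]) (simp only: lower A.diff, simp)
        then show "((\<lambda>s. A (v' \<alpha> s - v \<alpha> s)) has_integral j (u' \<alpha> t - u \<alpha> t)) {0..t}"
          by (simp add: j.diff)
      qed
      then show "u' \<alpha> t = u \<alpha> t" by simp
    qed
  qed
qed

text \<open>Each final time t gets its own \<nu>. Undoing the weight at time t produces the
  exponential, the geometric series over the levels produces the factor 2, and 1 + D^2 / \<kappa>
  comes from the coefficient at \<alpha> = 0, the only one that sees f and x directly.\<close>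

lemma chaos_solution_exists:
  fixes f :: "real \<Rightarrow> 'w" and x :: 'h
  assumes T: "0 < T" and f: "in_L2 (lebesgue_on {0..T}) f"
    and B: "\<And>k. bounded_linear (B k)" "\<And>k. onorm (B k) \<le> c k" and c: "(\<lambda>k. (c k)\<^sup>2) sums C\<^sub>M"
  obtains u where "chaos_solution i j T A B f x u"
    "\<And>t F. t \<in> {0..T} \<Longrightarrow> finite F \<Longrightarrow> (\<Sum>\<alpha>\<in>F. (norm (u \<alpha> t))\<^sup>2)
      \<le> exp ((2 * \<bar>C\<^sub>A\<bar> + (2 * C\<^sub>M * t + 1)) * t) * (2 * (1 + D\<^sup>2 / \<kappa>))
        * ((\<integral>s. (norm (f s))\<^sup>2 \<partial>lebesgue_on {0..t}) + (norm x)\<^sup>2)"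
proof (rule chaos_coefficients_exist[OF T B(1) f, where x=x])
  fix u v
  assume sol: "\<And>\<alpha>. evolution_solution T (\<lambda>s. (if \<alpha> = 0 then f s else 0) + j (noise_term B u \<alpha> s))
        (if \<alpha> = 0 then x else 0) (u \<alpha>) (v \<alpha>)"
    and est0: "\<And>\<nu> t. 0 < \<nu> \<Longrightarrow> t \<in> {0..T} \<Longrightarrow> exp (- (2 * \<bar>C\<^sub>A\<bar> + \<nu>) * t) * (norm (u 0 t))\<^sup>2
        \<le> (norm x)\<^sup>2 + D\<^sup>2 / \<kappa> * integral {0..t} (\<lambda>s. exp (- (2 * \<bar>C\<^sub>A\<bar> + \<nu>) * s) * (norm (f s))\<^sup>2)"
    and est: "\<And>\<alpha> \<nu> t. \<alpha> \<noteq> 0 \<Longrightarrow> 0 < \<nu> \<Longrightarrow> t \<in> {0..T} \<Longrightarrow> exp (- (2 * \<bar>C\<^sub>A\<bar> + \<nu>) * t) * (norm (u \<alpha> t))\<^sup>2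
        \<le> integral {0..t} (\<lambda>s. exp (- (2 * \<bar>C\<^sub>A\<bar> + \<nu>) * s) * (norm (noise_term B u \<alpha> s))\<^sup>2) / \<nu>"
  have u_cont: "continuous_on {0..T} (u \<alpha>)" and v: "in_L2 (lebesgue_on {0..T}) (v \<alpha>)"
    and iv: "AE s in lebesgue_on {0..T}. i (v \<alpha> s) = u \<alpha> s"
    and eq: "\<And>t. t \<in> {0..T} \<Longrightarrow> ((\<lambda>s. A (v \<alpha> s) + ((if \<alpha> = 0 then f s else 0) + j (noise_term B u \<alpha> s)))
        has_integral (j (u \<alpha> t) - j (if \<alpha> = 0 then x else 0))) {0..t}" for \<alpha>
    using sol[of \<alpha>] unfolding evolution_solution_def by blast+
  obtain r where r: "chaos_weights r" "in_weighted_chaos r (\<lambda>\<alpha>. L2_norm (lebesgue_on {0..T}) (v \<alpha>))"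
    by (rule chaos_weights_exist)
  have C\<^sub>M: "0 \<le> C\<^sub>M" using c by (rule sums_le[OF _ sums_zero, rotated]) simp
  have "chaos_solution i j T A B f x u"
    unfolding chaos_solution_def
  proof (intro conjI allI exI[of _ v] exI[of _ r] ballI u_cont v iv r)
    fix \<alpha> t assume t: "t \<in> {0..T}"
    have "j (noise_term B u \<alpha> s) = (\<Sum>k\<in>Poly_Mapping.keys \<alpha>. sqrt (real (Poly_Mapping.lookup \<alpha> k)) *\<^sub>R
        j (B k (u (\<alpha> - Poly_Mapping.single k 1) s)))" for s
      unfolding noise_term_def by (simp only: j.sum j.scaleR)
    moreover have "j (if \<alpha> = 0 then x else 0) = (if \<alpha> = 0 then j x else 0)" by (simp add: j.zero)
    ultimately show "((\<lambda>s. A (v \<alpha> s) + (if \<alpha> = 0 then f s else 0) +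
         (\<Sum>k\<in>Poly_Mapping.keys \<alpha>. sqrt (real (Poly_Mapping.lookup \<alpha> k)) *\<^sub>R j (B k (u (\<alpha> - Poly_Mapping.single k 1) s))))
         has_integral (j (u \<alpha> t) - (if \<alpha> = 0 then j x else 0))) {0..t}"
      using eq[OF t, of \<alpha>] by (simp only: add.assoc)
  qed
  moreover have "(\<Sum>\<alpha>\<in>F. (norm (u \<alpha> t))\<^sup>2)
      \<le> exp ((2 * \<bar>C\<^sub>A\<bar> + (2 * C\<^sub>M * t + 1)) * t) * (2 * (1 + D\<^sup>2 / \<kappa>))
        * ((\<integral>s. (norm (f s))\<^sup>2 \<partial>lebesgue_on {0..t}) + (norm x)\<^sup>2)"
    if t: "t \<in> {0..T}" and F: "finite F" for t F
  proof -
    \<comment> \<open>Ensures \<open>C\<^sub>M\<close> t / \<nu> \<le> 1/2; the added 1 keeps \<nu>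
      positive when \<open>C\<^sub>M\<close> t = 0.\<close>
    define \<nu> where "\<nu> = 2 * C\<^sub>M * t + 1"
    have \<nu>: "0 < \<nu>" using C\<^sub>M t by (simp add: \<nu>_def add_nonneg_pos)
    define I where "I = (\<integral>s. (norm (f s))\<^sup>2 \<partial>lebesgue_on {0..t})"
    define K where "K = (1 + D\<^sup>2 / \<kappa>) * (I + (norm x)\<^sup>2)"
    have sub: "s \<in> {0..T}" if "s \<in> {0..t}" for s using that t by auto
    have If: "(\<lambda>s. (norm (f s))\<^sup>2) integrable_on {0..s}" if "s \<in> {0..T}" for s
      using weighted_L2_integrable_on[OF f continuous_on_const[of _ 1] that] by simp
    have "integrable (lebesgue_on {0..t}) (\<lambda>s. (norm (f s))\<^sup>2)"
      using t by (intro integrable_subinterval[OF in_L2_integrable[OF f]]) auto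
    then have I_eq: "I = integral {0..t} (\<lambda>s. (norm (f s))\<^sup>2)"
      unfolding I_def by (rule lebesgue_integral_eq_integral) simp
    have I: "0 \<le> I" unfolding I_def by simp
    have dk: "0 \<le> D\<^sup>2 / \<kappa>" using \<kappa>_pos by simp
    have K0: "0 \<le> K" using dk I unfolding K_def by (intro mult_nonneg_nonneg add_nonneg_nonneg) auto
    define E where "E s = exp (- (2 * \<bar>C\<^sub>A\<bar> + \<nu>) * s)" for s
    have zero: "E s * (norm (u 0 s))\<^sup>2 \<le> K" if s: "s \<in> {0..t}" for s
    proof -
      have cE: "continuous_on {0..T} E" unfolding E_def[abs_def] by (intro continuous_intros)
      have "integral {0..s} (\<lambda>r. E r * (norm (f r))\<^sup>2) \<le> integral {0..s} (\<lambda>r. (norm (f r))\<^sup>2)"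
      proof (rule integral_le[OF weighted_L2_integrable_on[OF f cE sub[OF s]] If[OF sub[OF s]]])
        fix r assume "r \<in> {0..s}"
        then have "0 \<le> (2 * \<bar>C\<^sub>A\<bar> + \<nu>) * r" using \<nu> by (intro mult_nonneg_nonneg) auto
        then have "E r \<le> 1" unfolding E_def by (simp only: exp_le_one_iff mult_minus_left neg_le_0_iff_le)
        then show "E r * (norm (f r))\<^sup>2 \<le> (norm (f r))\<^sup>2"
          by (intro mult_left_le_one_le) (auto simp: E_def)
      qed
      also have "\<dots> \<le> I"
        unfolding I_eq using s t by (intro integral_subset_le If) auto
      finally have "D\<^sup>2 / \<kappa> * integral {0..s} (\<lambda>r. E r * (norm (f r))\<^sup>2) \<le> D\<^sup>2 / \<kappa> * I"
        using dk by (rule mult_left_mono)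
      moreover have "E s * (norm (u 0 s))\<^sup>2 \<le> (norm x)\<^sup>2 + D\<^sup>2 / \<kappa> * integral {0..s} (\<lambda>r. E r * (norm (f r))\<^sup>2)"
        unfolding E_def by (rule est0[OF \<nu> sub[OF s]])
      moreover have "(norm x)\<^sup>2 + D\<^sup>2 / \<kappa> * I \<le> K"
        using I mult_nonneg_nonneg[OF dk zero_le_power2[of "norm x"]] unfolding K_def
        by (simp add: algebra_simps)
      ultimately show ?thesis by linarith
    qed
    have "(\<Sum>\<alpha>\<in>F. E t * (norm (u \<alpha> t))\<^sup>2) \<le> 2 * K"
    proof -
      define N where "N = Suc (Max (insert 0 (total_degree ` F)))"
      have N: "total_degree ` F \<subseteq> {..<N}"
      proof
        fix m assume "m \<in> total_degree ` F"
        then have "m \<le> Max (insert 0 (total_degree ` F))" using F by (intro Max_ge) auto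
        then show "m \<in> {..<N}" by (simp add: N_def)
      qed
      have q: "0 \<le> C\<^sub>M * t / \<nu>" "C\<^sub>M * t / \<nu> \<le> 1 / 2"
        using C\<^sub>M t \<nu> by (auto simp: \<nu>_def field_simps)
      have "(\<Sum>\<alpha>\<in>F. E t * (norm (u \<alpha> t))\<^sup>2)
          = (\<Sum>n<N. \<Sum>\<alpha>\<in>{\<alpha>\<in>F. total_degree \<alpha> = n}. E t * (norm (u \<alpha> t))\<^sup>2)"
        by (rule sum.group[OF F _ N, symmetric]) simp
      also have "\<dots> \<le> (\<Sum>n<N. K * (1 / 2) ^ n)"
      proof (rule sum_mono)
        fix n
        \<comment> \<open>Applied on the interval {0..t} itself, since \<nu> depends on t and K on
          the integral of f up to t.\<close>
        have "(\<Sum>\<alpha>\<in>{\<alpha>\<in>F. total_degree \<alpha> = n}. E t * (norm (u \<alpha> t))\<^sup>2) \<le> K * (C\<^sub>M * t / \<nu>) ^ n"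
          unfolding E_def
        proof (rule chaos_coefficients_bound[OF B c _ \<nu>])
          show "continuous_on {0..t} (u \<alpha>)" for \<alpha>
            using t by (intro continuous_on_subset[OF u_cont]) auto
        qed (use zero[unfolded E_def] est[OF _ \<nu> sub] F t in auto)
        also have "\<dots> \<le> K * (1 / 2) ^ n"
          using q K0 by (intro mult_left_mono power_mono)
        finally show "(\<Sum>\<alpha>\<in>{\<alpha>\<in>F. total_degree \<alpha> = n}. E t * (norm (u \<alpha> t))\<^sup>2) \<le> K * (1 / 2) ^ n" .
      qed
      also have "\<dots> = K * (\<Sum>n<N. (1 / 2) ^ n)" by (rule sum_distrib_left[symmetric])
      also have "\<dots> \<le> K * 2"
      proof (rule mult_left_mono[OF _ K0])
        have "(\<Sum>n<N. (1 / 2 :: real) ^ n) \<le> suminf (\<lambda>n. (1 / 2) ^ n)"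
          by (rule sum_le_suminf) (auto intro: summable_geometric)
        also have "\<dots> = 2" by (simp add: suminf_geometric)
        finally show "(\<Sum>n<N. (1 / 2 :: real) ^ n) \<le> 2" .
      qed
      finally show ?thesis by (simp add: mult.commute)
    qed
    then have "E t * (\<Sum>\<alpha>\<in>F. (norm (u \<alpha> t))\<^sup>2) \<le> 2 * K" by (simp only: sum_distrib_left)
    then have "exp ((2 * \<bar>C\<^sub>A\<bar> + \<nu>) * t) * (E t * (\<Sum>\<alpha>\<in>F. (norm (u \<alpha> t))\<^sup>2)) \<le> exp ((2 * \<bar>C\<^sub>A\<bar> + \<nu>) * t) * (2 * K)"
      by (rule mult_left_mono) simp
    moreover have "exp ((2 * \<bar>C\<^sub>A\<bar> + \<nu>) * t) * E t = 1"
      unfolding E_def mult_minus_left by (rule exp_minus_inverse)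
    ultimately have "(\<Sum>\<alpha>\<in>F. (norm (u \<alpha> t))\<^sup>2) \<le> exp ((2 * \<bar>C\<^sub>A\<bar> + \<nu>) * t) * (2 * K)"
      by (simp only: mult.assoc[symmetric] mult_1_left)
    then show ?thesis unfolding K_def \<nu>_def I_def by (simp only: mult.assoc)
  qed
  ultimately show ?thesis by (rule that)
qed

end

theorem theorem13:
  fixes M :: "'a measure"
    and e :: "nat \<Rightarrow> 'u::{real_inner, complete_space}"
    and W :: "'u \<Rightarrow> 'a \<Rightarrow> real"
    and i :: "'v::{real_inner, complete_space} \<Rightarrow> 'h::{real_inner, complete_space}"
    and j :: "'h \<Rightarrow> 'w::{real_inner, complete_space}"
    and dual :: "'w \<Rightarrow> 'v \<Rightarrow> real"
  assumes noise: "gaussian_noise M e W"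
    and triple: "normal_triple i j dual"
  shows "\<exists>C :: real \<Rightarrow> real \<Rightarrow> real \<Rightarrow> real \<Rightarrow> real.
    \<forall>(T::real) (A :: 'v \<Rightarrow> 'w) (\<kappa>::real) (C\<^sub>A::real) (B :: nat \<Rightarrow> 'h \<Rightarrow> 'h) (c :: nat \<Rightarrow> real) (C\<^sub>M::real).
      0 < T \<longrightarrow>
      bounded_linear A \<longrightarrow>
      0 < \<kappa> \<longrightarrow>
      (\<forall>v. dual (A v) v + \<kappa> * (norm v)\<^sup>2 \<le> C\<^sub>A * (norm (i v))\<^sup>2) \<longrightarrow>
      (\<forall>k. bounded_linear (B k) \<and> onorm (B k) \<le> c k) \<longrightarrow>
      (\<lambda>k. (c k)\<^sup>2) sums C\<^sub>M \<longrightarrow>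
      (\<forall>(f :: real \<Rightarrow> 'w) (u\<^sub>0 :: 'h). in_L2 (lebesgue_on {0..T}) f \<longrightarrow>
        (\<exists>u. chaos_solution i j T A B f u\<^sub>0 u \<and>
          (\<forall>u'. chaos_solution i j T A B f u\<^sub>0 u' \<longrightarrow> (\<forall>\<alpha>. \<forall>t\<in>{0..T}. u' \<alpha> t = u \<alpha> t)) \<and>
          (\<forall>t\<in>{0..T}.
             in_weighted_chaos (\<lambda>_. 1) (\<lambda>\<alpha>. norm (u \<alpha> t)) \<and>
             (\<exists>U :: 'a \<Rightarrow> 'h. has_chaos_expansion M e W U (\<lambda>\<alpha>. u \<alpha> t) \<and>
                prob_space.expectation M (\<lambda>\<omega>. (norm (U \<omega>))\<^sup>2)
                  \<le> C C\<^sub>A C\<^sub>M \<kappa> t *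
                     ((\<integral>s. (norm (f s))\<^sup>2 \<partial>lebesgue_on {0..t}) + (norm u\<^sub>0)\<^sup>2)))))"
proof -
  interpret noise: gaussian_noise M e W by (rule noise)
  interpret triple: normal_triple i j dual by (rule triple)
  obtain D where D: "\<And>w v. norm (dual w v) \<le> norm w * norm v * D"
    using triple.dual.bounded by blast
  \<comment> \<open>D bounds the pairing and depends on the triple alone. Hence C is fixed before
    the equation is given and sees the operators only through \<open>C\<^sub>A\<close>,
    \<open>C\<^sub>M\<close> and \<kappa>.\<close>
  define C where "C C\<^sub>A C\<^sub>M \<kappa> t = exp ((2 * \<bar>C\<^sub>A\<bar> + (2 * C\<^sub>M * t + 1)) * t) * (2 * (1 + D\<^sup>2 / \<kappa>))"
    for C\<^sub>A C\<^sub>M \<kappa> t :: real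
  show ?thesis
  proof (intro exI[of _ C] allI impI)
    fix T \<kappa> C\<^sub>A C\<^sub>M :: real and A :: "'v \<Rightarrow> 'w" and B :: "nat \<Rightarrow> 'h \<Rightarrow> 'h" and c :: "nat \<Rightarrow> real"
      and f :: "real \<Rightarrow> 'w" and u\<^sub>0 :: 'h
    assume T: "0 < T" and A: "bounded_linear A" "0 < \<kappa>"
      and coercive: "\<forall>v. dual (A v) v + \<kappa> * (norm v)\<^sup>2 \<le> C\<^sub>A * (norm (i v))\<^sup>2"
      and B: "\<forall>k. bounded_linear (B k) \<and> onorm (B k) \<le> c k" and c: "(\<lambda>k. (c k)\<^sup>2) sums C\<^sub>M"
      and f: "in_L2 (lebesgue_on {0..T}) f"
    interpret coercive_evolution i j dual A \<kappa> C\<^sub>A D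
    proof (rule coercive_evolution.intro[OF triple coercive_evolution_axioms.intro])
      show "\<bar>dual w v\<bar> \<le> D * norm w * norm v" for w v
        using D[of w v] by (simp add: mult_ac)
    qed (use A coercive in auto)
    have B1: "bounded_linear (B k)" and B2: "onorm (B k) \<le> c k" for k using B by auto
    show "\<exists>u. chaos_solution i j T A B f u\<^sub>0 u \<and>
          (\<forall>u'. chaos_solution i j T A B f u\<^sub>0 u' \<longrightarrow> (\<forall>\<alpha>. \<forall>t\<in>{0..T}. u' \<alpha> t = u \<alpha> t)) \<and>
          (\<forall>t\<in>{0..T}.
             in_weighted_chaos (\<lambda>_. 1) (\<lambda>\<alpha>. norm (u \<alpha> t)) \<and>
             (\<exists>U :: 'a \<Rightarrow> 'h. has_chaos_expansion M e W U (\<lambda>\<alpha>. u \<alpha> t) \<and>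
                prob_space.expectation M (\<lambda>\<omega>. (norm (U \<omega>))\<^sup>2)
                  \<le> C C\<^sub>A C\<^sub>M \<kappa> t *
                     ((\<integral>s. (norm (f s))\<^sup>2 \<partial>lebesgue_on {0..t}) + (norm u\<^sub>0)\<^sup>2)))"
    proof (rule chaos_solution_exists[OF T f B1 B2 c, where x=u\<^sub>0])
      fix u
      assume sol: "chaos_solution i j T A B f u\<^sub>0 u"
        and "\<And>t F. t \<in> {0..T} \<Longrightarrow> finite F \<Longrightarrow> (\<Sum>\<alpha>\<in>F. (norm (u \<alpha> t))\<^sup>2)
          \<le> exp ((2 * \<bar>C\<^sub>A\<bar> + (2 * C\<^sub>M * t + 1)) * t) * (2 * (1 + D\<^sup>2 / \<kappa>))
            * ((\<integral>s. (norm (f s))\<^sup>2 \<partial>lebesgue_on {0..t}) + (norm u\<^sub>0)\<^sup>2)"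
      note bound = this(2)[folded C_def]
      have "in_weighted_chaos (\<lambda>_. 1) (\<lambda>\<alpha>. norm (u \<alpha> t))" if "t \<in> {0..T}" for t
        unfolding in_weighted_chaos_def
      proof (rule nonneg_bdd_above_summable_on)
        show "bdd_above (sum (\<lambda>\<alpha>. 1\<^sup>2 * (norm (u \<alpha> t))\<^sup>2) ` {F. F \<subseteq> UNIV \<and> finite F})"
          by (rule bdd_aboveI2[where M="C C\<^sub>A C\<^sub>M \<kappa> t * ((\<integral>s. (norm (f s))\<^sup>2 \<partial>lebesgue_on {0..t}) + (norm u\<^sub>0)\<^sup>2)"])
            (use bound[OF that] in simp)
      qed simp
      moreover have "\<exists>U :: 'a \<Rightarrow> 'h. has_chaos_expansion M e W U (\<lambda>\<alpha>. u \<alpha> t) \<and>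
         prob_space.expectation M (\<lambda>\<omega>. (norm (U \<omega>))\<^sup>2)
           \<le> C C\<^sub>A C\<^sub>M \<kappa> t * ((\<integral>s. (norm (f s))\<^sup>2 \<partial>lebesgue_on {0..t}) + (norm u\<^sub>0)\<^sup>2)" if "t \<in> {0..T}" for t
        by (rule noise.chaos_expansion_exists[OF bound[OF that]]) (assumption, intro exI conjI)
      ultimately show ?thesis using sol chaos_solution_unique[OF sol] by blast
    qed
  qed
qed

end
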